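(* Let \(X:\mathcal U\) and let \(\mathcal V\) be any universe. There is an equivalence between the type of \(\mathcal V\)-covered subsets of \(X\) with values in \(\Omega_{\mathcal U\sqcup\mathcal V}\), i.e. \(\Sigma_{S:X\to\Omega_{\mathcal U\sqcup\mathcal V}}\Sigma_{I:\mathcal V}(I\twoheadrightarrow\mathbb T(S))\), and the type \(\Sigma_{I:\mathcal V}(I\to X)\) of families in \(X\) indexed by types in \(\mathcal V\).
   Context: Work in univalent foundations (intensional Martin-Löf type theory with universes, function and propositional extensionality, propositional truncations). \(\Omega_{\mathcal T}\) is the type of propositions in \(\mathcal T\); a subset of \(X\) is a map \(S:X\to\Omega_{\mathcal T}\). The total space of \(S\) is \(\mathbb T(S):=\Sigma_{x:X}(x\in S)\). A map \(e:I\to Y\) is a surjection (written \(I\twoheadrightarrow Y\)) if for every \(y:Y\) there exists (in the truncated sense) \(i\) with \(e(i)=y\); the type \(I\twoheadrightarrow Y\) consists of maps together with a proof of surjectivity. A subset \(S\) is \(\mathcal V\)-covered if it comes with a type \(I:\mathcal V\) and a surjection \(I\twoheadrightarrow\mathbb T(S)\). *)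

theory Defs
  imports Main
begin

text \<open>
  The object theory is intensional Martin-Loef type theory with \<open>\<Pi>\<close>, \<open>\<Sigma>\<close>, identity types, empty
  and unit types, binary sums, natural numbers, a hierarchy of universes \<open>Univ 0 : Univ 1 : \<dots>\<close>,
  propositional truncations, and constants for function extensionality and propositional
  extensionality.  It is given by its syntax (de Bruijn indices), an untyped definitional equality
  and a typing judgement.  A statement ``there is an element of the type \<open>T\<close>'' of univalent
  foundations is rendered as: some term \<open>t\<close> satisfies \<open>\<Gamma> \<turnstile> t : T\<close>.

  Conventions:
  \<^item> Universes are Russell-style and not cumulative; the join of \<open>Univ i\<close> and \<open>Univ j\<close> is
    \<open>Univ (max i j)\<close>, the successor of \<open>Univ i\<close> is \<open>Univ (Suc i)\<close>.
  \<^item> Only \<open>Pi\<close> and \<open>Lam\<close> bind a variable.  The second argument of \<open>Sig\<close>, and the motives and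
    methods of the eliminators, are terms of function type.
  \<^item> Definitional equality is the congruence generated by the computation rules; there is no
    definitional \<open>\<eta>\<close>-rule (the propositional ones are derivable) and the axioms do not compute.
    Every derivation remains one in any extension of these rules.
\<close>

section \<open>Syntax\<close>

datatype tm =
    Var nat
  | Univ nat
  | Pi tm tm
  | Lam tm tm
  | App tm tm
  | Sig tm tm
  | Tup tm tm tm                  \<comment> \<open>\<open>Tup B a b\<close>: the pair \<open>(a, b)\<close>, annotated with the family \<open>B\<close>\<close>
  | SigElim tm tm tm
  | Eq tm tm tm
  | Refl tm
  | EqElim tm tm tm
  | Void nat
  | VoidElim tm tm
  | Unit nat
  | Star nat
  | UnitElim tm tm tm
  | Plus tm tm
  | Inl tm tm
  | Inr tm tm
  | PlusElim tm tm tm tm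
  | NatT
  | Zero
  | Succ tm
  | NatElim tm tm tm tm
  | Trunc tm
  | TruncIn tm
  | TruncPath tm tm
  | TruncRec tm tm tm tm
  | FunExt tm tm tm
  | PropExt tm tm tm tm tm tm

text \<open>Renaming and parallel substitution.\<close>

primrec ren :: "(nat \<Rightarrow> nat) \<Rightarrow> tm \<Rightarrow> tm" where
  "ren r (Var n) = Var (r n)"
| "ren r (Univ i) = Univ i"
| "ren r (Pi A B) = Pi (ren r A) (ren (case_nat 0 (\<lambda>n. Suc (r n))) B)"
| "ren r (Lam A b) = Lam (ren r A) (ren (case_nat 0 (\<lambda>n. Suc (r n))) b)"
| "ren r (App f a) = App (ren r f) (ren r a)"
| "ren r (Sig A B) = Sig (ren r A) (ren r B)"
| "ren r (Tup B a b) = Tup (ren r B) (ren r a) (ren r b)"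
| "ren r (SigElim C d p) = SigElim (ren r C) (ren r d) (ren r p)"
| "ren r (Eq A a b) = Eq (ren r A) (ren r a) (ren r b)"
| "ren r (Refl a) = Refl (ren r a)"
| "ren r (EqElim C d p) = EqElim (ren r C) (ren r d) (ren r p)"
| "ren r (Void i) = Void i"
| "ren r (VoidElim C p) = VoidElim (ren r C) (ren r p)"
| "ren r (Unit i) = Unit i"
| "ren r (Star i) = Star i"
| "ren r (UnitElim C d p) = UnitElim (ren r C) (ren r d) (ren r p)"
| "ren r (Plus A B) = Plus (ren r A) (ren r B)"
| "ren r (Inl B a) = Inl (ren r B) (ren r a)"
| "ren r (Inr A b) = Inr (ren r A) (ren r b)"
| "ren r (PlusElim C f g p) = PlusElim (ren r C) (ren r f) (ren r g) (ren r p)"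
| "ren r NatT = NatT"
| "ren r Zero = Zero"
| "ren r (Succ n) = Succ (ren r n)"
| "ren r (NatElim C z s n) = NatElim (ren r C) (ren r z) (ren r s) (ren r n)"
| "ren r (Trunc A) = Trunc (ren r A)"
| "ren r (TruncIn a) = TruncIn (ren r a)"
| "ren r (TruncPath s t) = TruncPath (ren r s) (ren r t)"
| "ren r (TruncRec P h f t) = TruncRec (ren r P) (ren r h) (ren r f) (ren r t)"
| "ren r (FunExt f g h) = FunExt (ren r f) (ren r g) (ren r h)"
| "ren r (PropExt P Q p q f g) =
     PropExt (ren r P) (ren r Q) (ren r p) (ren r q) (ren r f) (ren r g)"

abbreviation wk :: "tm \<Rightarrow> tm" where
  "wk \<equiv> ren Suc"

primrec sub :: "(nat \<Rightarrow> tm) \<Rightarrow> tm \<Rightarrow> tm" where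
  "sub s (Var n) = s n"
| "sub s (Univ i) = Univ i"
| "sub s (Pi A B) = Pi (sub s A) (sub (case_nat (Var 0) (\<lambda>n. wk (s n))) B)"
| "sub s (Lam A b) = Lam (sub s A) (sub (case_nat (Var 0) (\<lambda>n. wk (s n))) b)"
| "sub s (App f a) = App (sub s f) (sub s a)"
| "sub s (Sig A B) = Sig (sub s A) (sub s B)"
| "sub s (Tup B a b) = Tup (sub s B) (sub s a) (sub s b)"
| "sub s (SigElim C d p) = SigElim (sub s C) (sub s d) (sub s p)"
| "sub s (Eq A a b) = Eq (sub s A) (sub s a) (sub s b)"
| "sub s (Refl a) = Refl (sub s a)"
| "sub s (EqElim C d p) = EqElim (sub s C) (sub s d) (sub s p)"
| "sub s (Void i) = Void i"
| "sub s (VoidElim C p) = VoidElim (sub s C) (sub s p)"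
| "sub s (Unit i) = Unit i"
| "sub s (Star i) = Star i"
| "sub s (UnitElim C d p) = UnitElim (sub s C) (sub s d) (sub s p)"
| "sub s (Plus A B) = Plus (sub s A) (sub s B)"
| "sub s (Inl B a) = Inl (sub s B) (sub s a)"
| "sub s (Inr A b) = Inr (sub s A) (sub s b)"
| "sub s (PlusElim C f g p) = PlusElim (sub s C) (sub s f) (sub s g) (sub s p)"
| "sub s NatT = NatT"
| "sub s Zero = Zero"
| "sub s (Succ n) = Succ (sub s n)"
| "sub s (NatElim C z t n) = NatElim (sub s C) (sub s z) (sub s t) (sub s n)"
| "sub s (Trunc A) = Trunc (sub s A)"
| "sub s (TruncIn a) = TruncIn (sub s a)"
| "sub s (TruncPath t u) = TruncPath (sub s t) (sub s u)"
| "sub s (TruncRec P h f t) = TruncRec (sub s P) (sub s h) (sub s f) (sub s t)"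
| "sub s (FunExt f g h) = FunExt (sub s f) (sub s g) (sub s h)"
| "sub s (PropExt P Q p q f g) =
     PropExt (sub s P) (sub s Q) (sub s p) (sub s q) (sub s f) (sub s g)"

definition inst :: "tm \<Rightarrow> tm \<Rightarrow> tm" where
  "inst b a = sub (case_nat a Var) b"

text \<open>Non-dependent functions and products, and the statement that a type is a proposition.\<close>

definition Arr :: "tm \<Rightarrow> tm \<Rightarrow> tm" where
  "Arr A B = Pi A (wk B)"

definition Prod :: "tm \<Rightarrow> tm \<Rightarrow> tm" where
  "Prod A B = Sig A (Lam A (wk B))"

definition is_prop :: "tm \<Rightarrow> tm" where
  "is_prop P = Pi P (Pi (wk P) (Eq (wk (wk P)) (Var 1) (Var 0)))"


section \<open>Definitional equality\<close>

inductive conv :: "tm \<Rightarrow> tm \<Rightarrow> bool" (infix "\<cong>" 50) where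
  conv_refl: "t \<cong> t"
| conv_sym: "t \<cong> u \<Longrightarrow> u \<cong> t"
| conv_trans: "t \<cong> u \<Longrightarrow> u \<cong> v \<Longrightarrow> t \<cong> v"
  \<comment> \<open>computation rules\<close>
| beta_Pi: "App (Lam A b) a \<cong> inst b a"
| beta_Sig: "SigElim C d (Tup B a b) \<cong> App (App d a) b"
| beta_Eq: "EqElim C d (Refl a) \<cong> d"
| beta_Unit: "UnitElim C d (Star i) \<cong> d"
| beta_Inl: "PlusElim C f g (Inl B a) \<cong> App f a"
| beta_Inr: "PlusElim C f g (Inr A b) \<cong> App g b"
| beta_Zero: "NatElim C z s Zero \<cong> z"
| beta_Succ: "NatElim C z s (Succ n) \<cong> App (App s n) (NatElim C z s n)"
  \<comment> \<open>congruence rules\<close>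
| cong_Pi: "A \<cong> A' \<Longrightarrow> B \<cong> B' \<Longrightarrow> Pi A B \<cong> Pi A' B'"
| cong_Lam: "A \<cong> A' \<Longrightarrow> b \<cong> b' \<Longrightarrow> Lam A b \<cong> Lam A' b'"
| cong_App: "f \<cong> f' \<Longrightarrow> a \<cong> a' \<Longrightarrow> App f a \<cong> App f' a'"
| cong_Sig: "A \<cong> A' \<Longrightarrow> B \<cong> B' \<Longrightarrow> Sig A B \<cong> Sig A' B'"
| cong_Tup: "B \<cong> B' \<Longrightarrow> a \<cong> a' \<Longrightarrow> b \<cong> b' \<Longrightarrow> Tup B a b \<cong> Tup B' a' b'"
| cong_SigElim: "C \<cong> C' \<Longrightarrow> d \<cong> d' \<Longrightarrow> p \<cong> p' \<Longrightarrow> SigElim C d p \<cong> SigElim C' d' p'"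
| cong_Eq: "A \<cong> A' \<Longrightarrow> a \<cong> a' \<Longrightarrow> b \<cong> b' \<Longrightarrow> Eq A a b \<cong> Eq A' a' b'"
| cong_Refl: "a \<cong> a' \<Longrightarrow> Refl a \<cong> Refl a'"
| cong_EqElim: "C \<cong> C' \<Longrightarrow> d \<cong> d' \<Longrightarrow> p \<cong> p' \<Longrightarrow> EqElim C d p \<cong> EqElim C' d' p'"
| cong_VoidElim: "C \<cong> C' \<Longrightarrow> p \<cong> p' \<Longrightarrow> VoidElim C p \<cong> VoidElim C' p'"
| cong_UnitElim: "C \<cong> C' \<Longrightarrow> d \<cong> d' \<Longrightarrow> p \<cong> p' \<Longrightarrow> UnitElim C d p \<cong> UnitElim C' d' p'"
| cong_Plus: "A \<cong> A' \<Longrightarrow> B \<cong> B' \<Longrightarrow> Plus A B \<cong> Plus A' B'"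
| cong_Inl: "B \<cong> B' \<Longrightarrow> a \<cong> a' \<Longrightarrow> Inl B a \<cong> Inl B' a'"
| cong_Inr: "A \<cong> A' \<Longrightarrow> b \<cong> b' \<Longrightarrow> Inr A b \<cong> Inr A' b'"
| cong_PlusElim: "C \<cong> C' \<Longrightarrow> f \<cong> f' \<Longrightarrow> g \<cong> g' \<Longrightarrow> p \<cong> p' \<Longrightarrow>
    PlusElim C f g p \<cong> PlusElim C' f' g' p'"
| cong_Succ: "n \<cong> n' \<Longrightarrow> Succ n \<cong> Succ n'"
| cong_NatElim: "C \<cong> C' \<Longrightarrow> z \<cong> z' \<Longrightarrow> s \<cong> s' \<Longrightarrow> n \<cong> n' \<Longrightarrow>
    NatElim C z s n \<cong> NatElim C' z' s' n'"
| cong_Trunc: "A \<cong> A' \<Longrightarrow> Trunc A \<cong> Trunc A'"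
| cong_TruncIn: "a \<cong> a' \<Longrightarrow> TruncIn a \<cong> TruncIn a'"
| cong_TruncPath: "t \<cong> t' \<Longrightarrow> u \<cong> u' \<Longrightarrow> TruncPath t u \<cong> TruncPath t' u'"
| cong_TruncRec: "P \<cong> P' \<Longrightarrow> h \<cong> h' \<Longrightarrow> f \<cong> f' \<Longrightarrow> t \<cong> t' \<Longrightarrow>
    TruncRec P h f t \<cong> TruncRec P' h' f' t'"
| cong_FunExt: "f \<cong> f' \<Longrightarrow> g \<cong> g' \<Longrightarrow> h \<cong> h' \<Longrightarrow> FunExt f g h \<cong> FunExt f' g' h'"
| cong_PropExt: "P \<cong> P' \<Longrightarrow> Q \<cong> Q' \<Longrightarrow> p \<cong> p' \<Longrightarrow> q \<cong> q' \<Longrightarrow> f \<cong> f' \<Longrightarrow> g \<cong> g' \<Longrightarrow>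
    PropExt P Q p q f g \<cong> PropExt P' Q' p' q' f' g'"


section \<open>Typing\<close>

text \<open>
  A context lists the types of its variables, the innermost one first; each type lives in the
  context formed by the rest of the list.  ``\<open>A\<close> is a type'' means \<open>\<Gamma> \<turnstile> A : Univ i\<close> for some \<open>i\<close>.
\<close>

inductive
  wf_ctx :: "tm list \<Rightarrow> bool" and
  has_type :: "tm list \<Rightarrow> tm \<Rightarrow> tm \<Rightarrow> bool" ("(_ \<turnstile>/ _ :/ _)" [51, 51, 51] 50)
where
  wf_Nil: "wf_ctx []"
| wf_Cons: "wf_ctx \<Gamma> \<Longrightarrow> \<Gamma> \<turnstile> A : Univ i \<Longrightarrow> wf_ctx (A # \<Gamma>)"

| ty_Var: "wf_ctx \<Gamma> \<Longrightarrow> n < length \<Gamma> \<Longrightarrow> \<Gamma> \<turnstile> Var n : (wk ^^ Suc n) (\<Gamma> ! n)"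
| ty_conv: "\<Gamma> \<turnstile> t : A \<Longrightarrow> \<Gamma> \<turnstile> B : Univ i \<Longrightarrow> A \<cong> B \<Longrightarrow> \<Gamma> \<turnstile> t : B"
| ty_Univ: "wf_ctx \<Gamma> \<Longrightarrow> \<Gamma> \<turnstile> Univ i : Univ (Suc i)"

| ty_Pi: "\<Gamma> \<turnstile> A : Univ i \<Longrightarrow> A # \<Gamma> \<turnstile> B : Univ j \<Longrightarrow> \<Gamma> \<turnstile> Pi A B : Univ (max i j)"
| ty_Lam: "\<Gamma> \<turnstile> A : Univ i \<Longrightarrow> A # \<Gamma> \<turnstile> b : B \<Longrightarrow> \<Gamma> \<turnstile> Lam A b : Pi A B"
| ty_App: "\<Gamma> \<turnstile> f : Pi A B \<Longrightarrow> \<Gamma> \<turnstile> a : A \<Longrightarrow> \<Gamma> \<turnstile> App f a : inst B a"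

| ty_Sig: "\<Gamma> \<turnstile> A : Univ i \<Longrightarrow> \<Gamma> \<turnstile> B : Arr A (Univ j) \<Longrightarrow> \<Gamma> \<turnstile> Sig A B : Univ (max i j)"
| ty_Tup: "\<Gamma> \<turnstile> A : Univ i \<Longrightarrow> \<Gamma> \<turnstile> B : Arr A (Univ j) \<Longrightarrow> \<Gamma> \<turnstile> a : A \<Longrightarrow> \<Gamma> \<turnstile> b : App B a \<Longrightarrow>
    \<Gamma> \<turnstile> Tup B a b : Sig A B"
| ty_SigElim: "\<Gamma> \<turnstile> C : Arr (Sig A B) (Univ k) \<Longrightarrow>
    \<Gamma> \<turnstile> d : Pi A (Pi (App (wk B) (Var 0))
               (App (wk (wk C)) (Tup (wk (wk B)) (Var 1) (Var 0)))) \<Longrightarrow>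
    \<Gamma> \<turnstile> p : Sig A B \<Longrightarrow> \<Gamma> \<turnstile> SigElim C d p : App C p"

| ty_Eq: "\<Gamma> \<turnstile> A : Univ i \<Longrightarrow> \<Gamma> \<turnstile> a : A \<Longrightarrow> \<Gamma> \<turnstile> b : A \<Longrightarrow> \<Gamma> \<turnstile> Eq A a b : Univ i"
| ty_Refl: "\<Gamma> \<turnstile> a : A \<Longrightarrow> \<Gamma> \<turnstile> Refl a : Eq A a a"
| ty_EqElim: "\<Gamma> \<turnstile> C : Pi A (Pi (Eq (wk A) (wk a) (Var 0)) (Univ k)) \<Longrightarrow>
    \<Gamma> \<turnstile> d : App (App C a) (Refl a) \<Longrightarrow> \<Gamma> \<turnstile> p : Eq A a b \<Longrightarrow>
    \<Gamma> \<turnstile> EqElim C d p : App (App C b) p"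

| ty_Void: "wf_ctx \<Gamma> \<Longrightarrow> \<Gamma> \<turnstile> Void i : Univ i"
| ty_VoidElim: "\<Gamma> \<turnstile> C : Arr (Void i) (Univ k) \<Longrightarrow> \<Gamma> \<turnstile> p : Void i \<Longrightarrow> \<Gamma> \<turnstile> VoidElim C p : App C p"

| ty_Unit: "wf_ctx \<Gamma> \<Longrightarrow> \<Gamma> \<turnstile> Unit i : Univ i"
| ty_Star: "wf_ctx \<Gamma> \<Longrightarrow> \<Gamma> \<turnstile> Star i : Unit i"
| ty_UnitElim: "\<Gamma> \<turnstile> C : Arr (Unit i) (Univ k) \<Longrightarrow> \<Gamma> \<turnstile> d : App C (Star i) \<Longrightarrow> \<Gamma> \<turnstile> p : Unit i \<Longrightarrow>
    \<Gamma> \<turnstile> UnitElim C d p : App C p"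

| ty_Plus: "\<Gamma> \<turnstile> A : Univ i \<Longrightarrow> \<Gamma> \<turnstile> B : Univ j \<Longrightarrow> \<Gamma> \<turnstile> Plus A B : Univ (max i j)"
| ty_Inl: "\<Gamma> \<turnstile> B : Univ j \<Longrightarrow> \<Gamma> \<turnstile> a : A \<Longrightarrow> \<Gamma> \<turnstile> Inl B a : Plus A B"
| ty_Inr: "\<Gamma> \<turnstile> A : Univ i \<Longrightarrow> \<Gamma> \<turnstile> b : B \<Longrightarrow> \<Gamma> \<turnstile> Inr A b : Plus A B"
| ty_PlusElim: "\<Gamma> \<turnstile> C : Arr (Plus A B) (Univ k) \<Longrightarrow>
    \<Gamma> \<turnstile> f : Pi A (App (wk C) (Inl (wk B) (Var 0))) \<Longrightarrow>
    \<Gamma> \<turnstile> g : Pi B (App (wk C) (Inr (wk A) (Var 0))) \<Longrightarrow>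
    \<Gamma> \<turnstile> p : Plus A B \<Longrightarrow> \<Gamma> \<turnstile> PlusElim C f g p : App C p"

| ty_Nat: "wf_ctx \<Gamma> \<Longrightarrow> \<Gamma> \<turnstile> NatT : Univ 0"
| ty_Zero: "wf_ctx \<Gamma> \<Longrightarrow> \<Gamma> \<turnstile> Zero : NatT"
| ty_Succ: "\<Gamma> \<turnstile> n : NatT \<Longrightarrow> \<Gamma> \<turnstile> Succ n : NatT"
| ty_NatElim: "\<Gamma> \<turnstile> C : Arr NatT (Univ k) \<Longrightarrow> \<Gamma> \<turnstile> z : App C Zero \<Longrightarrow>
    \<Gamma> \<turnstile> s : Pi NatT (Pi (App (wk C) (Var 0)) (App (wk (wk C)) (Succ (Var 1)))) \<Longrightarrow>
    \<Gamma> \<turnstile> n : NatT \<Longrightarrow> \<Gamma> \<turnstile> NatElim C z s n : App C n"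

  \<comment> \<open>propositional truncation\<close>
| ty_Trunc: "\<Gamma> \<turnstile> A : Univ i \<Longrightarrow> \<Gamma> \<turnstile> Trunc A : Univ i"
| ty_TruncIn: "\<Gamma> \<turnstile> a : A \<Longrightarrow> \<Gamma> \<turnstile> TruncIn a : Trunc A"
| ty_TruncPath: "\<Gamma> \<turnstile> t : Trunc A \<Longrightarrow> \<Gamma> \<turnstile> u : Trunc A \<Longrightarrow> \<Gamma> \<turnstile> TruncPath t u : Eq (Trunc A) t u"
| ty_TruncRec: "\<Gamma> \<turnstile> P : Univ k \<Longrightarrow> \<Gamma> \<turnstile> h : is_prop P \<Longrightarrow> \<Gamma> \<turnstile> f : Arr A P \<Longrightarrow> \<Gamma> \<turnstile> t : Trunc A \<Longrightarrow>
    \<Gamma> \<turnstile> TruncRec P h f t : P"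

  \<comment> \<open>function extensionality and propositional extensionality\<close>
| ty_FunExt: "\<Gamma> \<turnstile> f : Pi A B \<Longrightarrow> \<Gamma> \<turnstile> g : Pi A B \<Longrightarrow>
    \<Gamma> \<turnstile> h : Pi A (Eq B (App (wk f) (Var 0)) (App (wk g) (Var 0))) \<Longrightarrow>
    \<Gamma> \<turnstile> FunExt f g h : Eq (Pi A B) f g"
| ty_PropExt: "\<Gamma> \<turnstile> P : Univ i \<Longrightarrow> \<Gamma> \<turnstile> Q : Univ i \<Longrightarrow>
    \<Gamma> \<turnstile> p : is_prop P \<Longrightarrow> \<Gamma> \<turnstile> q : is_prop Q \<Longrightarrow> \<Gamma> \<turnstile> f : Arr P Q \<Longrightarrow> \<Gamma> \<turnstile> g : Arr Q P \<Longrightarrow>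
    \<Gamma> \<turnstile> PropExt P Q p q f g : Eq (Univ i) P Q"


section \<open>Subsets, surjections, equivalences\<close>

definition Proj1 :: "tm \<Rightarrow> tm \<Rightarrow> tm \<Rightarrow> tm" where
  "Proj1 A B p =
     SigElim (Lam (Sig A B) (wk A)) (Lam A (Lam (App (wk B) (Var 0)) (Var 1))) p"

definition Omega :: "nat \<Rightarrow> tm" where
  "Omega k = Sig (Univ k) (Lam (Univ k) (is_prop (Var 0)))"

text \<open>\<open>Member k S x\<close> is the type underlying the proposition \<open>S x : Omega k\<close>.\<close>

definition Member :: "nat \<Rightarrow> tm \<Rightarrow> tm \<Rightarrow> tm" where
  "Member k S x = Proj1 (Univ k) (Lam (Univ k) (is_prop (Var 0))) (App S x)"

definition Total :: "nat \<Rightarrow> tm \<Rightarrow> tm \<Rightarrow> tm" where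
  "Total k X S = Sig X (Lam X (Member k (wk S) (Var 0)))"

text \<open>\<open>\<Sigma> e : I \<rightarrow> Y. \<Pi> y : Y. Trunc (\<Sigma> a : I. e a = y)\<close>\<close>

definition Surj :: "tm \<Rightarrow> tm \<Rightarrow> tm" where
  "Surj I Y = Sig (Arr I Y) (Lam (Arr I Y)
     (Pi (wk Y)
       (Trunc (Sig (wk (wk I)) (Lam (wk (wk I))
         (Eq (wk (wk (wk Y))) (App (Var 2) (Var 0)) (Var 1)))))))"

text \<open>
  \<open>\<Sigma> f : A \<rightarrow> B. (\<Sigma> g : B \<rightarrow> A. \<Pi> y : B. f (g y) = y) \<times> (\<Sigma> h : B \<rightarrow> A. \<Pi> x : A. h (f x) = x)\<close>,
  that is, functions with a section and a retraction.
\<close>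

definition Equiv :: "tm \<Rightarrow> tm \<Rightarrow> tm" where
  "Equiv A B = Sig (Arr A B) (Lam (Arr A B) (Prod
     (Sig (wk (Arr B A)) (Lam (wk (Arr B A))
       (Pi (wk (wk B)) (Eq (wk (wk (wk B))) (App (Var 2) (App (Var 1) (Var 0))) (Var 0)))))
     (Sig (wk (Arr B A)) (Lam (wk (Arr B A))
       (Pi (wk (wk A)) (Eq (wk (wk (wk A))) (App (Var 1) (App (Var 2) (Var 0))) (Var 0)))))))"

text \<open>For \<open>X : Univ i\<close>: the type \<open>\<Sigma> S : X \<rightarrow> Omega (max i j). \<Sigma> I : Univ j. Surj I (Total S)\<close>.\<close>

definition CoveredSubsets :: "nat \<Rightarrow> nat \<Rightarrow> tm \<Rightarrow> tm" where
  "CoveredSubsets i j X = Sig (Arr X (Omega (max i j))) (Lam (Arr X (Omega (max i j)))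
     (Sig (Univ j) (Lam (Univ j)
       (Surj (Var 0) (Total (max i j) (wk (wk X)) (Var 1))))))"

text \<open>\<open>\<Sigma> I : Univ j. I \<rightarrow> X\<close>\<close>

definition Families :: "nat \<Rightarrow> tm \<Rightarrow> tm" where
  "Families j X = Sig (Univ j) (Lam (Univ j) (Arr (Var 0) (wk X)))"

end

theory Submission
  imports Defs
begin

text \<open>
  A covered subset \<open>(S, I, e)\<close> is sent to the family \<open>pr\<^sub>1 \<circ> e\<close>, and a family \<open>f : I \<rightarrow> X\<close> to its
  image \<open>\<lambda>x. \<parallel>\<Sigma> a : I. f a = x\<parallel>\<close> together with the corestriction of \<open>f\<close>.  One composite is the
  identity up to \<open>\<eta>\<close>.  For the other one, surjectivity of \<open>e\<close> gives that the image of \<open>pr\<^sub>1 \<circ> e\<close> is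
  equal to \<open>S\<close>, by propositional and function extensionality; transport along this path reduces
  the claim to two maps into the same total space with equal first components, and those are
  equal because membership and surjectivity are propositions.

  Only the two maps need explicit terms.  The identities between them are obtained by working with
  mere inhabitation of types, which satisfies natural-deduction rules once weakening, substitution
  and the fact that the type of a term is itself a type are available.
\<close>


section \<open>Renaming and substitution\<close>

text \<open>The path between the image and \<open>S\<close> is built from axioms that do not
  compute, so nothing is known about the value of a transport along it. Hence the surjection itself
  is never transported. What is transported is a statement with the subset as a free variable,
  quantified over all surjections onto its total space and over proofs that they have the same
  values as the given family; it can be proved at the image and applied at \<open>S\<close> to the
  given surjection. The one delicate fact about propositions is that being a proposition is itself a
  proposition. It lifts a path between types to a path in \<open>Omega\<close>, and it rests on
  propositions being sets. A generic element of a nested sum is split into variables before the maps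
  are applied to it, so that both maps compute on literal pairs.\<close>

definition upr :: "(nat \<Rightarrow> nat) \<Rightarrow> nat \<Rightarrow> nat" where
  "upr r = case_nat 0 (\<lambda>n. Suc (r n))"

definition ups :: "(nat \<Rightarrow> tm) \<Rightarrow> nat \<Rightarrow> tm" where
  "ups s = case_nat (Var 0) (\<lambda>n. wk (s n))"

lemma upr_simps [simp]: "upr r 0 = 0" "upr r (Suc n) = Suc (r n)"
  by (simp_all add: upr_def)

lemma ups_simps [simp]: "ups s 0 = Var 0" "ups s (Suc n) = wk (s n)"
  by (simp_all add: ups_def)

lemma upr_comp [simp]: "(\<lambda>n. upr r (upr q n)) = upr (\<lambda>n. r (q n))"
  by (auto simp: fun_eq_iff upr_def split: nat.split)

lemma ups_upr [simp]: "(\<lambda>n. ups s (upr r n)) = ups (\<lambda>n. s (r n))"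
  by (auto simp: fun_eq_iff upr_def ups_def split: nat.split)

lemma ups_Var [simp]: "ups Var = Var"
  by (auto simp: fun_eq_iff ups_def split: nat.split)

text \<open>The binder clauses restated with the named liftings. The raw equations leave the
  simplifier afterwards, because the \<open>case_nat\<close> that they introduce would not match the
  rules for \<open>upr\<close> and \<open>ups\<close>.\<close>

lemma ren_binders [simp]:
  "ren r (Pi A B) = Pi (ren r A) (ren (upr r) B)"
  "ren r (Lam A B) = Lam (ren r A) (ren (upr r) B)"
  by (simp_all add: upr_def)

lemma sub_binders [simp]:
  "sub s (Pi A B) = Pi (sub s A) (sub (ups s) B)"
  "sub s (Lam A B) = Lam (sub s A) (sub (ups s) B)"
  by (simp_all add: ups_def)

declare ren.simps(3,4) [simp del] sub.simps(3,4) [simp del]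

lemma ren_ren: "ren r (ren q t) = ren (\<lambda>n. r (q n)) t"
  by (induction t arbitrary: r q) simp_all

lemma ren_ren_wk [simp]: "ren (upr r) (wk t) = wk (ren r t)"
  by (simp add: ren_ren)

lemma sub_ren: "sub s (ren r t) = sub (\<lambda>n. s (r n)) t"
  by (induction t arbitrary: s r) simp_all

lemma ren_ups: "(\<lambda>n. ren (upr r) (ups s n)) = ups (\<lambda>n. ren r (s n))"
  by (auto simp: fun_eq_iff ups_def split: nat.split)

lemma ren_sub: "ren r (sub s t) = sub (\<lambda>n. ren r (s n)) t"
  by (induction t arbitrary: s r) (simp_all add: ren_ups)

lemma sub_ups_wk [simp]: "sub (ups s) (wk t) = wk (sub s t)"
  by (simp add: sub_ren ren_sub)

lemma sub_ups: "(\<lambda>n. sub (ups s) (ups q n)) = ups (\<lambda>n. sub s (q n))"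
  by (auto simp: fun_eq_iff ups_def[of q] ups_def[of "\<lambda>n. sub s (q n)"] split: nat.split)

lemma sub_sub: "sub s (sub q t) = sub (\<lambda>n. sub s (q n)) t"
  by (induction t arbitrary: s q) (simp_all add: sub_ups)

lemma sub_Var [simp]: "sub Var t = t"
  by (induction t) simp_all

lemma ren_eq_sub: "ren r t = sub (\<lambda>n. Var (r n)) t"
  using sub_ren[of Var r t] by simp

lemma sub_case_wk [simp]: "sub (case_nat a s) (wk t) = sub s t"
  by (simp add: sub_ren)

lemma inst_wk [simp]: "inst (wk t) a = t"
  by (simp add: inst_def)

lemma ren_inst [simp]: "ren r (inst b a) = inst (ren (upr r) b) (ren r a)"
  unfolding inst_def ren_sub sub_ren
  by (rule arg_cong[of _ _ "\<lambda>s. sub s b"]) (auto simp: fun_eq_iff upr_def split: nat.split)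

lemma sub_inst [simp]: "sub s (inst b a) = inst (sub (ups s) b) (sub s a)"
  unfolding inst_def sub_sub
  by (rule arg_cong[of _ _ "\<lambda>s. sub s b"]) (auto simp: fun_eq_iff ups_def split: nat.split)

lemma ren_Arr [simp]: "ren r (Arr A B) = Arr (ren r A) (ren r B)"
  by (simp add: Arr_def)

lemma sub_Arr [simp]: "sub s (Arr A B) = Arr (sub s A) (sub s B)"
  by (simp add: Arr_def)

lemma ren_is_prop [simp]: "ren r (is_prop A) = is_prop (ren r A)"
  by (simp add: is_prop_def)

lemma sub_is_prop [simp]: "sub s (is_prop A) = is_prop (sub s A)"
  by (simp add: is_prop_def)


section \<open>Stability of definitional equality under renaming and substitution\<close>

lemma conv_ren: "t \<cong> u \<Longrightarrow> ren r t \<cong> ren r u"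
proof (induction arbitrary: r rule: conv.induct)
  case (conv_trans t u v) then show ?case by (blast intro: conv.conv_trans)
qed (auto intro: conv.intros)

lemma conv_sub: "t \<cong> u \<Longrightarrow> sub s t \<cong> sub s u"
proof (induction arbitrary: s rule: conv.induct)
  case (conv_trans t u v) then show ?case by (blast intro: conv.conv_trans)
qed (auto intro: conv.intros)

lemma conv_ups: "(\<And>n. s n \<cong> s' n) \<Longrightarrow> ups s n \<cong> ups s' n"
  by (cases n) (auto intro: conv_refl conv_ren)

lemma conv_sub_cong: "(\<And>n. s n \<cong> s' n) \<Longrightarrow> sub s t \<cong> sub s' t"
proof (induction t arbitrary: s s')
  case (Pi A B)
  then show ?case using conv_ups[of s s'] by (simp add: cong_Pi)
next
  case (Lam A b)
  then show ?case using conv_ups[of s s'] by (simp add: cong_Lam)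
\<comment> \<open>\<open>conv.intros(12-)\<close> are the congruence rules; symmetry, transitivity
  and the computation rules stay out, so the search follows the term structure.\<close>
qed (auto intro: conv_refl intro!: conv.intros(12-))

lemma conv_inst: "b \<cong> b' \<Longrightarrow> a \<cong> a' \<Longrightarrow> inst b a \<cong> inst b' a'"
  unfolding inst_def
  by (rule conv_trans[OF conv_sub conv_sub_cong]) (auto intro: conv_refl split: nat.split)

section \<open>Weakening, substitution and regularity of typing\<close>

lemma wf_has_type: "\<Gamma> \<turnstile> t : A \<Longrightarrow> wf_ctx \<Gamma>"
  by (induction rule: wf_ctx_has_type.inducts(2)[where ?P1.0 = "\<lambda>_. True"])
    (auto elim: wf_ctx.cases)

text \<open>Every context extension contributes exactly one \<open>wk\<close>, so the iterate in
  \<open>ty_Var\<close> never has to be computed.\<close>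

definition lookup :: "tm list \<Rightarrow> nat \<Rightarrow> tm" where
  "lookup \<Gamma> n = (wk ^^ Suc n) (\<Gamma> ! n)"

lemma lookup_Cons [simp]: "lookup (A # \<Gamma>) 0 = wk A" "lookup (A # \<Gamma>) (Suc n) = wk (lookup \<Gamma> n)"
  by (simp_all add: lookup_def)

text \<open>Well-formedness of the target is included because the leaf rules, such as
  \<open>ty_Univ\<close>, demand it.\<close>

definition renaming :: "(nat \<Rightarrow> nat) \<Rightarrow> tm list \<Rightarrow> tm list \<Rightarrow> bool" where
  "renaming r \<Gamma> \<Delta> \<longleftrightarrow> wf_ctx \<Delta> \<and>
     (\<forall>n < length \<Gamma>. r n < length \<Delta> \<and> lookup \<Delta> (r n) = ren r (lookup \<Gamma> n))"

lemma ty_lookup: "wf_ctx \<Gamma> \<Longrightarrow> n < length \<Gamma> \<Longrightarrow> \<Gamma> \<turnstile> Var n : lookup \<Gamma> n"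
  unfolding lookup_def by (rule ty_Var)

lemma renaming_wf: "renaming r \<Gamma> \<Delta> \<Longrightarrow> wf_ctx \<Delta>"
  by (simp add: renaming_def)

lemma renaming_upr:
  "renaming r \<Gamma> \<Delta> \<Longrightarrow> \<Delta> \<turnstile> ren r A : Univ i \<Longrightarrow> renaming (upr r) (A # \<Gamma>) (ren r A # \<Delta>)"
  by (auto simp: renaming_def less_Suc_eq_0_disj intro: wf_Cons)

lemma has_type_ren: "\<Gamma> \<turnstile> t : A \<Longrightarrow> renaming r \<Gamma> \<Delta> \<Longrightarrow> \<Delta> \<turnstile> ren r t : ren r A"
proof (induction arbitrary: \<Delta> r rule: wf_ctx_has_type.inducts(2)[where ?P1.0 = "\<lambda>_. True"])
  case (ty_Var \<Gamma> n)
  have "\<Delta> \<turnstile> Var (r n) : lookup \<Delta> (r n)"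
    using ty_Var by (intro ty_lookup) (auto simp: renaming_def)
  then show ?case using ty_Var unfolding renaming_def lookup_def[symmetric] by simp
next
  case (ty_conv \<Gamma> t A B i)
  show ?case
    by (rule wf_ctx_has_type.ty_conv[OF ty_conv.IH(1) _ conv_ren])
      (use ty_conv in \<open>fastforce+\<close>)
next
  case (ty_Pi \<Gamma> A i B j)
  have A: "\<Delta> \<turnstile> ren r A : Univ i" using ty_Pi.IH(1)[OF ty_Pi.prems] by simp
  then show ?case
    using ty_Pi.IH(2)[OF renaming_upr[OF ty_Pi.prems A]] by (simp add: wf_ctx_has_type.ty_Pi)
next
  case (ty_Lam \<Gamma> A i b B)
  have A: "\<Delta> \<turnstile> ren r A : Univ i" using ty_Lam.IH(1)[OF ty_Lam.prems] by simp
  then show ?case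
    using ty_Lam.IH(2)[OF renaming_upr[OF ty_Lam.prems A]] by (simp add: wf_ctx_has_type.ty_Lam)
next
  \<comment> \<open>The rule mentions \<open>Var 1\<close>, which simplification turns into
    \<open>Var (Suc 0)\<close>; the rule is brought to the same form before it is applied.\<close>
  case (ty_SigElim \<Gamma> C A B k d p)
  from ty_SigElim.IH[OF ty_SigElim.prems] show ?case
    by simp (rule wf_ctx_has_type.ty_SigElim[unfolded One_nat_def])
next
  case (ty_NatElim \<Gamma> C k z s' n)
  from ty_NatElim.IH[OF ty_NatElim.prems] show ?case
    by simp (rule wf_ctx_has_type.ty_NatElim[unfolded One_nat_def])
qed (simp_all, (blast intro: wf_ctx_has_type.intros(5-)[unfolded One_nat_def] renaming_wf)+)

lemma has_type_wk:
  assumes "\<Gamma> \<turnstile> t : T" "\<Gamma> \<turnstile> A : Univ i"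
  shows "A # \<Gamma> \<turnstile> wk t : wk T"
  by (rule has_type_ren[OF assms(1)])
    (use assms wf_has_type in \<open>auto simp: renaming_def intro: wf_Cons\<close>)

lemma ty_Var_0: "\<Gamma> \<turnstile> A : Univ i \<Longrightarrow> A # \<Gamma> \<turnstile> Var 0 : wk A"
  using ty_lookup[of "A # \<Gamma>" 0] by (auto intro: wf_Cons wf_has_type)

definition substitution :: "(nat \<Rightarrow> tm) \<Rightarrow> tm list \<Rightarrow> tm list \<Rightarrow> bool" where
  "substitution s \<Gamma> \<Delta> \<longleftrightarrow> wf_ctx \<Delta> \<and> (\<forall>n < length \<Gamma>. \<Delta> \<turnstile> s n : sub s (lookup \<Gamma> n))"

lemma substitution_wf: "substitution s \<Gamma> \<Delta> \<Longrightarrow> wf_ctx \<Delta>"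
  by (simp add: substitution_def)

lemma substitution_ups:
  "substitution s \<Gamma> \<Delta> \<Longrightarrow> \<Delta> \<turnstile> sub s A : Univ i \<Longrightarrow>
    substitution (ups s) (A # \<Gamma>) (sub s A # \<Delta>)"
  unfolding substitution_def by (auto simp: less_Suc_eq_0_disj intro: wf_Cons ty_Var_0)
    (metis has_type_wk)

lemma has_type_sub: "\<Gamma> \<turnstile> t : A \<Longrightarrow> substitution s \<Gamma> \<Delta> \<Longrightarrow> \<Delta> \<turnstile> sub s t : sub s A"
proof (induction arbitrary: \<Delta> s rule: wf_ctx_has_type.inducts(2)[where ?P1.0 = "\<lambda>_. True"])
  case (ty_Var \<Gamma> n)
  then show ?case unfolding substitution_def lookup_def[symmetric] by simp
next
  case (ty_conv \<Gamma> t A B i)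
  show ?case
    by (rule wf_ctx_has_type.ty_conv[OF ty_conv.IH(1) _ conv_sub])
      (use ty_conv in \<open>fastforce+\<close>)
next
  case (ty_Pi \<Gamma> A i B j)
  have A: "\<Delta> \<turnstile> sub s A : Univ i" using ty_Pi.IH(1)[OF ty_Pi.prems] by simp
  then show ?case
    using ty_Pi.IH(2)[OF substitution_ups[OF ty_Pi.prems A]]
    by (simp add: wf_ctx_has_type.ty_Pi)
next
  case (ty_Lam \<Gamma> A i b B)
  have A: "\<Delta> \<turnstile> sub s A : Univ i" using ty_Lam.IH(1)[OF ty_Lam.prems] by simp
  then show ?case
    using ty_Lam.IH(2)[OF substitution_ups[OF ty_Lam.prems A]]
    by (simp add: wf_ctx_has_type.ty_Lam)
next
  case (ty_SigElim \<Gamma> C A B k d p)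
  from ty_SigElim.IH[OF ty_SigElim.prems] show ?case
    by simp (rule wf_ctx_has_type.ty_SigElim[unfolded One_nat_def])
next
  case (ty_NatElim \<Gamma> C k z s' n)
  from ty_NatElim.IH[OF ty_NatElim.prems] show ?case
    by simp (rule wf_ctx_has_type.ty_NatElim[unfolded One_nat_def])
qed (simp_all, (blast intro: wf_ctx_has_type.intros(5-)[unfolded One_nat_def] substitution_wf)+)

lemma has_type_inst:
  assumes "A # \<Gamma> \<turnstile> b : B" "\<Gamma> \<turnstile> a : A"
  shows "\<Gamma> \<turnstile> inst b a : inst B a"
  unfolding inst_def
  by (rule has_type_sub[OF assms(1)])
    (use assms(2) wf_has_type[OF assms(2)] in
      \<open>auto simp: substitution_def less_Suc_eq_0_disj intro: ty_lookup\<close>)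

section \<open>Being a type, inversion and regularity\<close>

definition is_type :: "tm list \<Rightarrow> tm \<Rightarrow> bool" where
  "is_type \<Gamma> A \<longleftrightarrow> (\<exists>k. \<Gamma> \<turnstile> A : Univ k)"

lemma is_typeI: "\<Gamma> \<turnstile> A : Univ k \<Longrightarrow> is_type \<Gamma> A"
  by (auto simp: is_type_def)

lemma is_type_wk: "is_type \<Gamma> B \<Longrightarrow> is_type \<Gamma> A \<Longrightarrow> is_type (A # \<Gamma>) (wk B)"
  unfolding is_type_def using has_type_wk by fastforce

lemma is_type_inst: "is_type (A # \<Gamma>) B \<Longrightarrow> \<Gamma> \<turnstile> a : A \<Longrightarrow> is_type \<Gamma> (inst B a)"
  unfolding is_type_def using has_type_inst by (fastforce simp: inst_def)

text \<open>No confluence is involved: the type \<open>T\<close> is arbitrary, and a conversion step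
  changes only \<open>T\<close>, never the subject \<open>Pi A B\<close>.\<close>

lemma Pi_inversion: "\<Gamma> \<turnstile> Pi A B : T \<Longrightarrow> is_type \<Gamma> A \<and> is_type (A # \<Gamma>) B"
  by (induction \<Gamma> "Pi A B" T arbitrary: A B
      rule: wf_ctx_has_type.inducts(2)[where ?P1.0 = "\<lambda>_. True"]) (auto simp: is_type_def)

lemma Sig_inversion: "\<Gamma> \<turnstile> Sig A B : T \<Longrightarrow> is_type \<Gamma> A \<and> (\<exists>j. \<Gamma> \<turnstile> B : Arr A (Univ j))"
  by (induction \<Gamma> "Sig A B" T arbitrary: A B
      rule: wf_ctx_has_type.inducts(2)[where ?P1.0 = "\<lambda>_. True"]) (auto simp: is_type_def)

lemma Eq_inversion: "\<Gamma> \<turnstile> Eq A a b : T \<Longrightarrow> is_type \<Gamma> A \<and> \<Gamma> \<turnstile> a : A \<and> \<Gamma> \<turnstile> b : A"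
  by (induction \<Gamma> "Eq A a b" T arbitrary: A a b
      rule: wf_ctx_has_type.inducts(2)[where ?P1.0 = "\<lambda>_. True"]) (auto simp: is_type_def)

lemma App_family: "\<Gamma> \<turnstile> C : Arr A (Univ k) \<Longrightarrow> \<Gamma> \<turnstile> p : A \<Longrightarrow> \<Gamma> \<turnstile> App C p : Univ k"
  unfolding Arr_def by (drule (1) ty_App) (simp add: inst_def)

lemma ty_Arr: "\<Gamma> \<turnstile> A : Univ i \<Longrightarrow> \<Gamma> \<turnstile> B : Univ j \<Longrightarrow> \<Gamma> \<turnstile> Arr A B : Univ (max i j)"
  unfolding Arr_def by (rule ty_Pi) (use has_type_wk in fastforce)+

lemma is_type_Univ: "wf_ctx \<Gamma> \<Longrightarrow> is_type \<Gamma> (Univ k)"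
  by (auto simp: is_type_def intro: ty_Univ)

lemma is_type_Pi: "is_type \<Gamma> A \<Longrightarrow> is_type (A # \<Gamma>) B \<Longrightarrow> is_type \<Gamma> (Pi A B)"
  by (auto simp: is_type_def intro: ty_Pi)

lemma is_type_Arr: "is_type \<Gamma> A \<Longrightarrow> is_type \<Gamma> B \<Longrightarrow> is_type \<Gamma> (Arr A B)"
  by (auto simp: is_type_def intro: ty_Arr)

lemma is_type_Sig: "is_type \<Gamma> A \<Longrightarrow> \<Gamma> \<turnstile> B : Arr A (Univ j) \<Longrightarrow> is_type \<Gamma> (Sig A B)"
  by (auto simp: is_type_def intro: ty_Sig)

lemma is_type_Eq: "\<Gamma> \<turnstile> a : A \<Longrightarrow> \<Gamma> \<turnstile> b : A \<Longrightarrow> is_type \<Gamma> A \<Longrightarrow> is_type \<Gamma> (Eq A a b)"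
  by (auto simp: is_type_def intro: ty_Eq)

lemma is_type_Plus: "is_type \<Gamma> A \<Longrightarrow> is_type \<Gamma> B \<Longrightarrow> is_type \<Gamma> (Plus A B)"
  by (auto simp: is_type_def intro: ty_Plus)

lemma is_type_Trunc: "is_type \<Gamma> A \<Longrightarrow> is_type \<Gamma> (Trunc A)"
  by (auto simp: is_type_def intro: ty_Trunc)

text \<open>The motive for contexts supplies the variable case: every looked-up type is a type in
  the whole context. Most eliminators return an applied family, which is a type by its own typing;
  for applications the type of the function, known from the induction hypothesis, is
  inverted.\<close>

theorem regularity:
  assumes "\<Gamma> \<turnstile> t : A"
  shows "is_type \<Gamma> A"
  using assms
proof (induction rule: wf_ctx_has_type.inducts(2)[where
      ?P1.0 = "\<lambda>\<Gamma>. \<forall>n < length \<Gamma>. is_type \<Gamma> (lookup \<Gamma> n)"])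
  case (wf_Cons \<Gamma> A i)
  then have "is_type \<Gamma> A" by (simp add: is_typeI)
  with wf_Cons show ?case by (auto simp: less_Suc_eq_0_disj is_type_wk)
next
  case (ty_Var \<Gamma> n)
  then show ?case by (simp only: flip: lookup_def)
next
  case (ty_App \<Gamma> f A B a)
  from ty_App.IH(1) obtain k where "\<Gamma> \<turnstile> Pi A B : Univ k"
    unfolding is_type_def by blast
  from Pi_inversion[OF this] ty_App.hyps(2) show ?case
    by (blast intro: is_type_inst)
next
  case (ty_EqElim \<Gamma> C A a k d p b)
  from ty_EqElim.IH(3) obtain l where "\<Gamma> \<turnstile> Eq A a b : Univ l"
    unfolding is_type_def by blast
  from Eq_inversion[OF this] have ab: "\<Gamma> \<turnstile> b : A"
    by blast
  \<comment> \<open>The family takes two arguments, and the type of the second one depends on the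
    first: instantiating at \<open>b\<close> turns it into the type of \<open>p\<close>.\<close>
  have "\<Gamma> \<turnstile> App C b : inst (Pi (Eq (wk A) (wk a) (Var 0)) (Univ k)) b"
    using ty_EqElim.hyps ab by (intro ty_App)
  then have "\<Gamma> \<turnstile> App C b : Pi (Eq A a b) (Univ k)"
    by (simp add: inst_def)
  from ty_App[OF this ty_EqElim.hyps(3)] show ?case
    by (auto simp: inst_def is_type_def)
next
  case (ty_TruncPath \<Gamma> t A u)
  then show ?case by (simp add: is_type_Eq)
next
  case (ty_FunExt \<Gamma> f A B g h)
  then show ?case by (simp add: is_type_Eq)
next
  case (ty_PropExt \<Gamma> P i Q p q f g)
  then show ?case by (simp add: is_type_Eq)
next
  case (ty_Refl \<Gamma> a A)
  then show ?case by (simp add: is_type_Eq)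
qed (auto dest: wf_has_type intro: is_type_Univ is_type_Pi is_type_Sig is_type_Eq is_type_Plus
    is_type_Trunc is_type_Arr App_family is_typeI ty_Unit ty_Nat)

text \<open>A typing derivation bounds the free variables by the length of the context, so induction
  over it takes the place of a separate notion of scope. The aim is the closed case: closed terms
  are fixed by every renaming and substitution.\<close>

lemma sub_agree: "\<Gamma> \<turnstile> t : A \<Longrightarrow> (\<And>n. n < length \<Gamma> \<Longrightarrow> s n = Var n) \<Longrightarrow> sub s t = t"
proof (induction arbitrary: s rule: wf_ctx_has_type.inducts(2)[where ?P1.0 = "\<lambda>_. True"])
  case (ty_Pi \<Gamma> A i B j)
  have "sub (ups s) B = B"
    by (rule ty_Pi.IH(2)) (use ty_Pi.prems in \<open>auto simp: less_Suc_eq_0_disj\<close>)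
  then show ?case using ty_Pi by simp
next
  case (ty_Lam \<Gamma> A i b B)
  have "sub (ups s) b = b"
    by (rule ty_Lam.IH(2)) (use ty_Lam.prems in \<open>auto simp: less_Suc_eq_0_disj\<close>)
  then show ?case using ty_Lam by simp
qed simp_all

lemma sub_closed: "[] \<turnstile> t : A \<Longrightarrow> sub s t = t"
  by (rule sub_agree) auto

lemma ren_closed: "[] \<turnstile> t : A \<Longrightarrow> ren r t = t"
  by (simp add: ren_eq_sub sub_closed)

lemma has_type_closed:
  assumes "[] \<turnstile> t : A" "wf_ctx \<Gamma>"
  shows "\<Gamma> \<turnstile> t : A"
proof -
  have "substitution Var [] \<Gamma>" using assms(2) by (simp add: substitution_def)
  from has_type_sub[OF assms(1) this] show ?thesis by simp
qed

section \<open>Inhabitation and dependent pairs\<close>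

lemma sub_cong: "(\<And>n. s n = s' n) \<Longrightarrow> sub s t = sub s' t"
  by (metis ext)

lemma ren_upr_upr [simp]: "ren (upr (upr r)) (ren (upr Suc) B) = ren (upr Suc) (ren (upr r) B)"
  by (simp add: ren_ren)

lemma sub_ups_upr [simp]: "sub (ups (ups s)) (ren (upr Suc) B) = ren (upr Suc) (sub (ups s) B)"
  by (simp add: sub_ren ren_sub ren_ups)

lemma sub_ups_case_upr [simp]: "sub (ups (case_nat a s)) (ren (upr Suc) B) = sub (ups s) B"
  by (simp add: sub_ren)

lemma wf_Cons_iff: "wf_ctx (A # \<Gamma>) \<longleftrightarrow> is_type \<Gamma> A"
  by (auto simp: is_type_def intro: wf_Cons wf_has_type elim: wf_ctx.cases)

lemma is_type_wf: "is_type \<Gamma> A \<Longrightarrow> wf_ctx \<Gamma>"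
  by (auto simp: is_type_def intro: wf_has_type)

lemma ty_wk: "\<Gamma> \<turnstile> t : T \<Longrightarrow> is_type \<Gamma> A \<Longrightarrow> A # \<Gamma> \<turnstile> wk t : wk T"
  by (auto simp: is_type_def intro: has_type_wk)

lemma ty_0: "is_type \<Gamma> A \<Longrightarrow> A # \<Gamma> \<turnstile> Var 0 : wk A"
  by (auto simp: is_type_def intro: ty_Var_0)

lemma ty_1: "is_type (B # \<Gamma>) A \<Longrightarrow> A # B # \<Gamma> \<turnstile> Var (Suc 0) : wk (wk B)"
  using ty_wk[OF ty_0, of \<Gamma> B A] is_type_wf[of "B # \<Gamma>" A] by (simp add: wf_Cons_iff)

lemma is_type_ren: "is_type \<Gamma> A \<Longrightarrow> renaming r \<Gamma> \<Delta> \<Longrightarrow> is_type \<Delta> (ren r A)"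
  unfolding is_type_def using has_type_ren by fastforce

lemma renaming_wk: "is_type \<Gamma> A \<Longrightarrow> renaming Suc \<Gamma> (A # \<Gamma>)"
  by (auto simp: renaming_def wf_Cons_iff)

lemma ty_convI: "\<Gamma> \<turnstile> t : A \<Longrightarrow> A \<cong> B \<Longrightarrow> is_type \<Gamma> B \<Longrightarrow> \<Gamma> \<turnstile> t : B"
  by (auto simp: is_type_def intro: ty_conv)

lemma ty_LamI: "A # \<Gamma> \<turnstile> b : B \<Longrightarrow> \<Gamma> \<turnstile> Lam A b : Pi A B"
  using wf_has_type[of "A # \<Gamma>" b B] by (auto simp: wf_Cons_iff is_type_def intro: ty_Lam)

lemma ty_Lam_Arr: "A # \<Gamma> \<turnstile> b : wk B \<Longrightarrow> \<Gamma> \<turnstile> Lam A b : Arr A B"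
  unfolding Arr_def by (rule ty_LamI)

lemma ty_App_Arr: "\<Gamma> \<turnstile> f : Arr A B \<Longrightarrow> \<Gamma> \<turnstile> a : A \<Longrightarrow> \<Gamma> \<turnstile> App f a : B"
  unfolding Arr_def by (drule (1) ty_App) simp

lemma ty_family: "A # \<Gamma> \<turnstile> B : Univ j \<Longrightarrow> \<Gamma> \<turnstile> Lam A B : Arr A (Univ j)"
  by (rule ty_Lam_Arr) simp

lemma is_type_is_prop: "is_type \<Gamma> P \<Longrightarrow> is_type \<Gamma> (is_prop P)"
  unfolding is_prop_def One_nat_def
  by (intro is_type_Pi is_type_Eq is_type_wk) (auto intro: ty_0 ty_1 is_type_wk)

text \<open>\<open>Sig\<close> expects a family of function type. \<open>SIG\<close> takes an open
  body instead; the family is then a literal \<open>Lam\<close>, and its applications reduce to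
  instances of the body.\<close>

abbreviation SIG :: "tm \<Rightarrow> tm \<Rightarrow> tm" where
  "SIG A B \<equiv> Sig A (Lam A B)"

lemma ty_SIG: "\<Gamma> \<turnstile> A : Univ i \<Longrightarrow> A # \<Gamma> \<turnstile> B : Univ j \<Longrightarrow> \<Gamma> \<turnstile> SIG A B : Univ (max i j)"
  by (intro ty_Sig ty_family)

lemma is_type_SIG: "is_type (A # \<Gamma>) B \<Longrightarrow> is_type \<Gamma> (SIG A B)"
  using is_type_wf[of "A # \<Gamma>" B] by (auto simp: wf_Cons_iff is_type_def intro: ty_SIG)

lemma ty_pair:
  assumes "is_type (A # \<Gamma>) B" "\<Gamma> \<turnstile> a : A" "\<Gamma> \<turnstile> b : inst B a"
  shows "\<Gamma> \<turnstile> Tup (Lam A B) a b : SIG A B"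
proof -
  obtain i j where A: "\<Gamma> \<turnstile> A : Univ i" and B: "A # \<Gamma> \<turnstile> B : Univ j"
    using assms(1) regularity[OF assms(2)] by (auto simp: is_type_def)
  have "\<Gamma> \<turnstile> App (Lam A B) a : Univ j"
    using B assms(2) by (intro App_family[OF ty_family])
  then have "\<Gamma> \<turnstile> b : App (Lam A B) a"
    by (rule ty_conv[OF assms(3) _ conv_sym[OF beta_Pi]])
  then show ?thesis
    by (rule ty_Tup[OF A ty_family[OF B] assms(2)])
qed

text \<open>The type \<open>C\<close> over \<open>SIG A B\<close>, evaluated at the pair of the two innermost variables.\<close>

definition unpair :: "tm \<Rightarrow> tm \<Rightarrow> tm \<Rightarrow> tm" where
  "unpair A B C =
     sub (case_nat (Tup (wk (wk (Lam A B))) (Var (Suc 0)) (Var 0)) (\<lambda>n. Var (Suc (Suc n)))) C"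

lemma unpair_wk [simp]: "unpair A B (wk C) = wk (wk C)"
  by (simp add: unpair_def ren_ren) (simp add: ren_eq_sub)

lemma inst_upr_wk [simp]: "inst (ren (upr Suc) B) (Var 0) = B"
  unfolding inst_def sub_ren
  by (rule trans[OF sub_cong sub_Var]) (simp add: upr_def split: nat.split)

lemma inst_upr_wk_wk [simp]: "inst (ren (upr Suc) (ren (upr Suc) B)) (Var (Suc 0)) = wk B"
  unfolding inst_def sub_ren ren_eq_sub
  by (simp add: sub_sub) (rule sub_cong, simp add: upr_def split: nat.split)

lemma ren_unpair [simp]:
  "ren (upr (upr r)) (unpair A B C) = unpair (ren r A) (ren (upr r) B) (ren (upr r) C)"
  unfolding unpair_def ren_sub sub_ren
  by (rule sub_cong, rename_tac n, case_tac n) simp_all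

text \<open>The primitive eliminator types its method through applications of the family and of the
  motive. Both are literal abstractions here, so domain and codomain of the method beta-reduce to
  the open forms \<open>B\<close> and \<open>unpair A B C\<close>.\<close>

lemma ty_split:
  assumes C: "is_type (SIG A B # \<Gamma>) C"
    and d: "\<Gamma> \<turnstile> d : Pi A (Pi B (unpair A B C))" and p: "\<Gamma> \<turnstile> p : SIG A B"
  shows "\<Gamma> \<turnstile> SigElim (Lam (SIG A B) C) d p : inst C p"
proof -
  let ?F = "Lam A B" and ?C = "Lam (SIG A B) C"
  obtain l where "\<Gamma> \<turnstile> Pi A (Pi B (unpair A B C)) : Univ l"
    using regularity[OF d] by (auto simp: is_type_def)
  from Pi_inversion[OF this] obtain l where A: "is_type \<Gamma> A" and "A # \<Gamma> \<turnstile> Pi B (unpair A B C) : Univ l"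
    by (auto simp: is_type_def)
  from Pi_inversion[OF this(2)] have B: "is_type (A # \<Gamma>) B" by blast
  obtain j k where F: "\<Gamma> \<turnstile> ?F : Arr A (Univ j)" and CC: "\<Gamma> \<turnstile> ?C : Arr (SIG A B) (Univ k)"
    using B C ty_family unfolding is_type_def by blast
  have 1: "A # \<Gamma> \<turnstile> App (wk ?F) (Var 0) : Univ j"
    by (rule App_family[OF ty_wk[OF F A, unfolded ren_Arr ren.simps(2)] ty_0[OF A]])
  let ?\<Delta> = "App (wk ?F) (Var 0) # A # \<Gamma>" and ?t = "Tup (wk (wk ?F)) (Var (Suc 0)) (Var 0)"
  have 2: "is_type (A # \<Gamma>) (App (wk ?F) (Var 0))" using 1 by (rule is_typeI)
  have "?\<Delta> \<turnstile> ?t : Sig (wk (wk A)) (wk (wk ?F))"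
  proof -
    obtain i where i: "\<Gamma> \<turnstile> A : Univ i" using A by (auto simp: is_type_def)
    show ?thesis
    proof (rule ty_Tup)
      show "?\<Delta> \<turnstile> wk (wk A) : Univ i"
        using ty_wk[OF ty_wk[OF i A] 2] by simp
      show "?\<Delta> \<turnstile> wk (wk ?F) : Arr (wk (wk A)) (Univ j)"
        using ty_wk[OF ty_wk[OF F A] 2] by simp
      show "?\<Delta> \<turnstile> Var (Suc 0) : wk (wk A)" by (rule ty_1[OF 2])
      show "?\<Delta> \<turnstile> Var 0 : App (wk (wk ?F)) (Var (Suc 0))" using ty_0[OF 2] by simp
    qed
  qed
  moreover have "?\<Delta> \<turnstile> wk (wk ?C) : Arr (Sig (wk (wk A)) (wk (wk ?F))) (Univ k)"
    using ty_wk[OF ty_wk[OF CC A] 2] by simp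
  ultimately have 3: "?\<Delta> \<turnstile> App (wk (wk ?C)) ?t : Univ k"
    by (intro App_family)
  have 4: "App (wk (wk ?C)) ?t \<cong> unpair A B C"
  proof -
    have "inst (ren (upr Suc) (ren (upr Suc) C)) ?t = unpair A B C"
      unfolding inst_def unpair_def sub_ren
      by (rule sub_cong) (auto simp: upr_def split: nat.split)
    then show ?thesis using beta_Pi[of _ "ren (upr Suc) (ren (upr Suc) C)" ?t] by simp
  qed
  have "\<Gamma> \<turnstile> d : Pi A (Pi (App (wk ?F) (Var 0)) (App (wk (wk ?C)) ?t))"
  proof (rule ty_convI[OF d])
    show "Pi A (Pi B (unpair A B C)) \<cong> Pi A (Pi (App (wk ?F) (Var 0)) (App (wk (wk ?C)) ?t))"
      using beta_Pi[of "wk A" "ren (upr Suc) B" "Var 0"] 4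
      by (auto intro!: cong_Pi conv_refl intro: conv_sym)
    show "is_type \<Gamma> (Pi A (Pi (App (wk ?F) (Var 0)) (App (wk (wk ?C)) ?t)))"
      by (intro is_type_Pi A 2 is_typeI[OF 3])
  qed
  then have "\<Gamma> \<turnstile> SigElim ?C d p : App ?C p"
    by (intro ty_SigElim[OF CC _ p]) simp
  then show ?thesis
    by (rule ty_convI[OF _ beta_Pi is_type_inst[OF C p]])
qed

section \<open>Natural deduction for mere inhabitation\<close>

definition inh :: "tm list \<Rightarrow> tm \<Rightarrow> bool" where
  "inh \<Gamma> A \<longleftrightarrow> (\<exists>t. \<Gamma> \<turnstile> t : A)"

lemma inhI: "\<Gamma> \<turnstile> t : A \<Longrightarrow> inh \<Gamma> A"
  by (auto simp: inh_def)

lemma inh_is_type: "inh \<Gamma> A \<Longrightarrow> is_type \<Gamma> A"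
  by (auto simp: inh_def dest: regularity)

lemma inh_is_type_hd: "inh (A # \<Gamma>) B \<Longrightarrow> is_type \<Gamma> A"
  by (auto simp flip: wf_Cons_iff dest: inh_is_type is_type_wf)

lemma inh_conv: "inh \<Gamma> A \<Longrightarrow> A \<cong> B \<Longrightarrow> is_type \<Gamma> B \<Longrightarrow> inh \<Gamma> B"
  by (auto simp: inh_def intro: ty_convI)

lemma inh_wk: "inh \<Gamma> B \<Longrightarrow> is_type \<Gamma> A \<Longrightarrow> inh (A # \<Gamma>) (wk B)"
  by (auto simp: inh_def intro: ty_wk)

lemma inh_inst: "inh (A # \<Gamma>) B \<Longrightarrow> \<Gamma> \<turnstile> a : A \<Longrightarrow> inh \<Gamma> (inst B a)"
  by (auto simp: inh_def dest: has_type_inst)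

lemma inh_Pi: "inh (A # \<Gamma>) B \<Longrightarrow> inh \<Gamma> (Pi A B)"
  by (auto simp: inh_def dest: ty_LamI)

lemma inh_App: "inh \<Gamma> (Pi A B) \<Longrightarrow> \<Gamma> \<turnstile> a : A \<Longrightarrow> inh \<Gamma> (inst B a)"
  by (auto simp: inh_def dest: ty_App)

text \<open>The product is weakened past the new variable and then applied to it; weakening under
  the binder followed by this instantiation is the identity.\<close>

lemma inh_body:
  assumes "inh \<Gamma> (Pi A B)"
  shows "inh (A # \<Gamma>) B"
proof -
  have A: "is_type \<Gamma> A" using inh_is_type[OF assms] by (auto simp: is_type_def dest: Pi_inversion)
  show ?thesis using inh_App[OF inh_wk[OF assms A, simplified] ty_0[OF A]] by simp
qed

text \<open>Replaces a generic element of a sum by a pair of variables, on which projections and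
  maps compute. The method is built in \<open>\<Gamma>\<close>, weakened past the pair variable and
  eliminated at \<open>Var 0\<close>.\<close>

lemma inh_SIG_elim:
  assumes "is_type (SIG A B # \<Gamma>) C" "inh (B # A # \<Gamma>) (unpair A B C)"
  shows "inh (SIG A B # \<Gamma>) C"
proof -
  let ?S = "SIG A B"
  have S: "is_type \<Gamma> ?S" using assms(1) by (simp add: is_type_wf flip: wf_Cons_iff)
  obtain d where "\<Gamma> \<turnstile> d : Pi A (Pi B (unpair A B C))"
    using inh_Pi[OF inh_Pi[OF assms(2)]] by (auto simp: inh_def)
  from ty_wk[OF this S]
  have d: "?S # \<Gamma> \<turnstile> wk d : Pi (wk A) (Pi (ren (upr Suc) B)
      (unpair (wk A) (ren (upr Suc) B) (ren (upr Suc) C)))"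
    by simp
  obtain k where k: "\<Gamma> \<turnstile> ?S : Univ k" using S by (auto simp: is_type_def)
  have "renaming (upr Suc) (?S # \<Gamma>) (wk ?S # ?S # \<Gamma>)"
    by (rule renaming_upr[OF renaming_wk[OF S]]) (use ty_wk[OF k S] in simp)
  from is_type_ren[OF assms(1) this]
  have "is_type (SIG (wk A) (ren (upr Suc) B) # ?S # \<Gamma>) (ren (upr Suc) C)" by simp
  from inhI[OF ty_split[OF this d]] ty_0[OF S, simplified] have
    "inh (?S # \<Gamma>) (inst (ren (upr Suc) C) (Var 0))" by blast
  then show ?thesis by simp
qed

section \<open>Transport, extensionality and propositions\<close>

lemma inh_EqD:
  assumes "inh \<Gamma> (Eq A a b)"
  shows "is_type \<Gamma> A" "\<Gamma> \<turnstile> a : A" "\<Gamma> \<turnstile> b : A"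
  using inh_is_type[OF assms] by (auto simp: is_type_def dest: Eq_inversion)

lemma inh_refl: "\<Gamma> \<turnstile> a : A \<Longrightarrow> inh \<Gamma> (Eq A a a)"
  by (auto intro: inhI ty_Refl)

lemma is_type_sub: "is_type \<Gamma> A \<Longrightarrow> substitution s \<Gamma> \<Delta> \<Longrightarrow> is_type \<Delta> (sub s A)"
  unfolding is_type_def using has_type_sub by fastforce

text \<open>\<open>Var 0\<close> stands for the path and \<open>Var 1\<close> for its endpoint, the
  order in which the motive of \<open>EqElim\<close> binds them.\<close>

definition inst2 :: "tm \<Rightarrow> tm \<Rightarrow> tm \<Rightarrow> tm" where
  "inst2 C b p = sub (case_nat p (case_nat b Var)) C"

lemma inst2_wk [simp]: "inst2 (wk C) b p = inst C b"
  by (simp add: inst2_def inst_def)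

lemma inst_ups_case: "inst (sub (ups (case_nat b Var)) C) p = inst2 C b p"
  unfolding inst_def inst2_def sub_sub
  by (rule sub_cong, rename_tac n, case_tac n) (auto split: nat.split)

lemma ty_J:
  assumes C: "is_type (Eq (wk A) (wk a) (Var 0) # A # \<Gamma>) C"
    and d: "\<Gamma> \<turnstile> d : inst2 C a (Refl a)" and p: "\<Gamma> \<turnstile> p : Eq A a b"
  shows "\<Gamma> \<turnstile> EqElim (Lam A (Lam (Eq (wk A) (wk a) (Var 0)) C)) d p : inst2 C b p"
proof -
  let ?E = "Eq (wk A) (wk a) (Var 0)"
  let ?C = "Lam A (Lam ?E C)"
  obtain k where k: "?E # A # \<Gamma> \<turnstile> C : Univ k" using C by (auto simp: is_type_def)
  then have CC: "\<Gamma> \<turnstile> ?C : Pi A (Pi ?E (Univ k))" by (intro ty_LamI)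
  have E: "inst ?E x = Eq A a x" for x
    by (simp add: inst_def)
  \<comment> \<open>Applying the motive takes two beta steps. The first leaves a substitution lifted
    under the path binder, which \<open>inst_ups_case\<close> merges with the second.\<close>
  have *: "\<Gamma> \<turnstile> App (App ?C x) q : Univ k" "App (App ?C x) q \<cong> inst2 C x q" "is_type \<Gamma> (inst2 C x q)"
    if q: "\<Gamma> \<turnstile> q : Eq A a x" for x q
  proof -
    note x = inh_EqD(3)[OF inhI[OF q]]
    have "inst (Pi ?E (Univ k)) x = Pi (Eq A a x) (Univ k)"
      by (simp add: inst_def)
    with ty_App[OF CC x] have "\<Gamma> \<turnstile> App ?C x : Pi (Eq A a x) (Univ k)"
      by simp
    from ty_App[OF this q] show "\<Gamma> \<turnstile> App (App ?C x) q : Univ k" by (simp add: inst_def)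
    have "App ?C x \<cong> Lam (Eq A a x) (sub (ups (case_nat x Var)) C)"
      using beta_Pi[of A "Lam ?E C" x] by (simp add: inst_def)
    from conv_trans[OF cong_App[OF this conv_refl] beta_Pi]
    show "App (App ?C x) q \<cong> inst2 C x q"
      by (simp only: inst_ups_case)
    have "substitution (case_nat q (case_nat x Var)) (?E # A # \<Gamma>) \<Gamma>"
      using q x wf_has_type[OF q]
      by (auto simp: substitution_def less_Suc_eq_0_disj intro: ty_lookup)
    from is_type_sub[OF C this] show "is_type \<Gamma> (inst2 C x q)" by (simp add: inst2_def)
  qed
  have "\<Gamma> \<turnstile> Refl a : Eq A a a"
    using inh_EqD[OF inhI[OF p]] by (auto intro: ty_Refl)
  from ty_convI[OF d conv_sym[OF *(2)[OF this]] is_typeI[OF *(1)[OF this]]]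
  have "\<Gamma> \<turnstile> d : App (App ?C a) (Refl a)" .
  from ty_EqElim[OF CC this p] show ?thesis
    by (rule ty_convI[OF _ *(2,3)[OF p]])
qed

text \<open>Path induction with a motive that ignores the path. An explicit term is needed, because
  the argument that propositions are sets uses its computation on \<open>Refl\<close>.\<close>

definition transport :: "tm \<Rightarrow> tm \<Rightarrow> tm \<Rightarrow> tm \<Rightarrow> tm \<Rightarrow> tm" where
  "transport A P a d p = EqElim (Lam A (Lam (Eq (wk A) (wk a) (Var 0)) (wk P))) d p"

lemma ty_transport:
  assumes P: "is_type (A # \<Gamma>) P" and d: "\<Gamma> \<turnstile> d : inst P a" and p: "\<Gamma> \<turnstile> p : Eq A a b"
  shows "\<Gamma> \<turnstile> transport A P a d p : inst P b"
proof -
  note E = inh_EqD[OF inhI[OF p]]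
  have "is_type (Eq (wk A) (wk a) (Var 0) # A # \<Gamma>) (wk P)"
    using E by (intro is_type_wk P is_type_Eq ty_0 ty_wk) auto
  from ty_J[OF this _ p] d show ?thesis by (simp add: transport_def)
qed

lemma inh_transport:
  "is_type (A # \<Gamma>) P \<Longrightarrow> inh \<Gamma> (inst P a) \<Longrightarrow> inh \<Gamma> (Eq A a b) \<Longrightarrow> inh \<Gamma> (inst P b)"
  unfolding inh_def using ty_transport by blast

text \<open>Transport of reflexivity in the family \<open>t a = t x\<close> with \<open>x\<close>
  varying.\<close>

lemma inh_cong:
  assumes "A # \<Gamma> \<turnstile> t : wk B" "inh \<Gamma> (Eq A a b)"
  shows "inh \<Gamma> (Eq B (inst t a) (inst t b))"
proof -
  note E = inh_EqD[OF assms(2)]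
  have t: "\<Gamma> \<turnstile> inst t x : B" if "\<Gamma> \<turnstile> x : A" for x
    using has_type_inst[OF assms(1) that] by simp
  have eq: "inst (Eq (wk B) (wk (inst t a)) t) x = Eq B (inst t a) (inst t x)" for x
    by (simp add: inst_def)
  have "inh \<Gamma> (inst (Eq (wk B) (wk (inst t a)) t) b)"
  proof (rule inh_transport[OF _ _ assms(2)])
    show "is_type (A # \<Gamma>) (Eq (wk B) (wk (inst t a)) t)"
      using assms(1) ty_wk[OF t[OF E(2)] E(1)] regularity by (blast intro: is_type_Eq)
    show "inh \<Gamma> (inst (Eq (wk B) (wk (inst t a)) t) a)"
      unfolding eq by (intro inh_refl t E)
  qed
  then show ?thesis unfolding eq .
qed

lemma inh_sym:
  assumes "inh \<Gamma> (Eq A a b)"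
  shows "inh \<Gamma> (Eq A b a)"
proof -
  note E = inh_EqD[OF assms]
  have "inh \<Gamma> (inst (Eq (wk A) (Var 0) (wk a)) b)"
    by (rule inh_transport[OF _ _ assms])
      (use E in \<open>auto simp: inst_def intro: is_type_Eq ty_0 ty_wk is_type_wk inh_refl\<close>)
  then show ?thesis by (simp add: inst_def)
qed

lemma inh_FunExt:
  assumes "\<Gamma> \<turnstile> f : Pi A B" "\<Gamma> \<turnstile> g : Pi A B"
    and "inh (A # \<Gamma>) (Eq B (App (wk f) (Var 0)) (App (wk g) (Var 0)))"
  shows "inh \<Gamma> (Eq (Pi A B) f g)"
  using inh_Pi[OF assms(3)] assms(1,2) unfolding inh_def by (blast intro: ty_FunExt)

lemma inh_FunExt_Arr:
  assumes "\<Gamma> \<turnstile> f : Arr A B" "\<Gamma> \<turnstile> g : Arr A B"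
    and "inh (A # \<Gamma>) (Eq (wk B) (App (wk f) (Var 0)) (App (wk g) (Var 0)))"
  shows "inh \<Gamma> (Eq (Arr A B) f g)"
  using assms unfolding Arr_def by (rule inh_FunExt)

lemma inh_PropExt:
  assumes "\<Gamma> \<turnstile> P : Univ k" "\<Gamma> \<turnstile> Q : Univ k"
    and "inh \<Gamma> (is_prop P)" "inh \<Gamma> (is_prop Q)"
    and "inh (P # \<Gamma>) (wk Q)" "inh (Q # \<Gamma>) (wk P)"
  shows "inh \<Gamma> (Eq (Univ k) P Q)"
  using assms inh_Pi[OF assms(5)] inh_Pi[OF assms(6)]
  unfolding inh_def Arr_def[symmetric] by (blast intro: ty_PropExt)

lemma inh_Trunc: "inh \<Gamma> A \<Longrightarrow> inh \<Gamma> (Trunc A)"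
  by (auto simp: inh_def intro: ty_TruncIn)

lemma inh_Trunc_elim:
  assumes "inh \<Gamma> (Trunc A)" "inh \<Gamma> (is_prop P)" "is_type \<Gamma> P" "inh (A # \<Gamma>) (wk P)"
  shows "inh \<Gamma> P"
  using assms inh_Pi[OF assms(4)]
  unfolding inh_def Arr_def[symmetric] is_type_def by (blast intro: ty_TruncRec)

section \<open>Closure properties of propositions\<close>

lemma inh_is_propI:
  assumes "inh (wk P # P # \<Gamma>) (Eq (wk (wk P)) (Var (Suc 0)) (Var 0))"
  shows "inh \<Gamma> (is_prop P)"
  unfolding is_prop_def One_nat_def using assms by (intro inh_Pi)

lemma inh_is_propD:
  assumes "inh \<Gamma> (is_prop P)" "\<Gamma> \<turnstile> a : P" "\<Gamma> \<turnstile> b : P"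
  shows "inh \<Gamma> (Eq P a b)"
proof -
  have "inh \<Gamma> (Pi P (Eq (wk P) (wk a) (Var 0)))"
    using inh_App[OF assms(1)[unfolded is_prop_def] assms(2)] by (simp add: inst_def)
  from inh_App[OF this assms(3)] show ?thesis by (simp add: inst_def)
qed

lemma is_prop_type: "inh \<Gamma> (is_prop P) \<Longrightarrow> is_type \<Gamma> P"
  using inh_is_type[of \<Gamma> "is_prop P"] Pi_inversion unfolding is_type_def is_prop_def by blast

lemma inh_is_prop_wk: "inh \<Gamma> (is_prop P) \<Longrightarrow> is_type \<Gamma> A \<Longrightarrow> inh (A # \<Gamma>) (is_prop (wk P))"
  using inh_wk[of \<Gamma> "is_prop P" A] by simp

lemma ty_App_wk_0:
  assumes "\<Gamma> \<turnstile> f : Pi A B"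
  shows "A # \<Gamma> \<turnstile> App (wk f) (Var 0) : B"
proof -
  have A: "is_type \<Gamma> A"
    using regularity[OF assms] Pi_inversion unfolding is_type_def by blast
  show ?thesis using ty_App[OF ty_wk[OF assms A, simplified] ty_0[OF A]] by simp
qed

text \<open>Function extensionality reduces the comparison of two functions to their values. The two
  functions under comparison extend the context, which is why \<open>B\<close> appears renamed twice
  under its binder.\<close>

lemma is_prop_Pi:
  assumes "inh (A # \<Gamma>) (is_prop B)"
  shows "inh \<Gamma> (is_prop (Pi A B))"
proof (rule inh_is_propI)
  let ?P = "Pi A B" let ?\<Delta> = "wk ?P # ?P # \<Gamma>"
  note A = inh_is_type_hd[OF assms]
  have P: "is_type \<Gamma> ?P" by (intro is_type_Pi A is_prop_type assms)
  have P': "is_type (?P # \<Gamma>) (wk ?P)" by (intro is_type_wk P)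
  have A2: "is_type ?\<Delta> (wk (wk A))" by (intro is_type_wk A P P')
  have f: "?\<Delta> \<turnstile> Var (Suc 0) : wk (wk ?P)" and g: "?\<Delta> \<turnstile> Var 0 : wk (wk ?P)"
    by (rule ty_1[OF P'], rule ty_0[OF P'])
  have "inh ?\<Delta> (Pi (wk (wk A)) (ren (upr Suc) (ren (upr Suc) (is_prop B))))"
    using inh_wk[OF inh_wk[OF inh_Pi[OF assms] P] P'] by simp
  then have B: "inh (wk (wk A) # ?\<Delta>) (is_prop (ren (upr Suc) (ren (upr Suc) B)))"
    using inh_body by fastforce
  have App: "wk (wk A) # ?\<Delta> \<turnstile> App (wk h) (Var 0) : ren (upr Suc) (ren (upr Suc) B)"
    if "?\<Delta> \<turnstile> h : wk (wk ?P)" for h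
    using ty_App_wk_0[of ?\<Delta> h] that by simp
  have "inh ?\<Delta> (Eq (Pi (wk (wk A)) (ren (upr Suc) (ren (upr Suc) B))) (Var (Suc 0)) (Var 0))"
  proof (rule inh_FunExt)
    show "inh (wk (wk A) # ?\<Delta>) (Eq (ren (upr Suc) (ren (upr Suc) B))
        (App (wk (Var (Suc 0))) (Var 0)) (App (wk (Var 0)) (Var 0)))"
      by (rule inh_is_propD[OF B App[OF f] App[OF g]])
  qed (use f g in simp_all)
  then show "inh ?\<Delta> (Eq (wk (wk ?P)) (Var (Suc 0)) (Var 0))" by simp
qed


text \<open>Every proposition is a set: a path \<open>p : x = y\<close> is determined by the values \<open>h x x\<close> and
  \<open>h x y\<close> of the witness, since transporting \<open>h x y\<close> back along \<open>h x x\<close> gives \<open>p\<close>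
  by path induction.\<close>

lemma transport_refl_loop:
  assumes q: "\<Gamma> \<turnstile> q : Eq A a b"
  shows "inh \<Gamma> (Eq (Eq A b b) (Refl b) (transport A (Eq (wk A) (Var 0) (wk b)) a q q))"
proof -
  note E = inh_EqD[OF inhI[OF q]]
  let ?E = "Eq (wk A) (wk a) (Var 0)"
  \<comment> \<open>The path variable occurs twice in the transport: as the element that is moved
    and as the path along which it is moved.\<close>
  let ?C = "Eq (Eq (wk (wk A)) (Var (Suc 0)) (Var (Suc 0))) (Refl (Var (Suc 0)))
    (transport (wk (wk A)) (Eq (wk (wk (wk A))) (Var 0) (Var (Suc (Suc 0)))) (wk (wk a)) (Var 0) (Var 0))"
  have tE: "is_type (A # \<Gamma>) ?E"
    by (intro is_type_Eq ty_wk ty_0 is_type_wk E)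
  have v: "?E # A # \<Gamma> \<turnstile> Var (Suc 0) : wk (wk A)" by (rule ty_1[OF tE])
  have A2: "is_type (?E # A # \<Gamma>) (wk (wk A))" by (intro is_type_wk E tE)
  have C: "is_type (?E # A # \<Gamma>) ?C"
  proof (intro is_type_Eq ty_Refl v A2)
    let ?P = "Eq (wk (wk (wk A))) (Var 0) (Var (Suc (Suc 0)))"
    have P: "is_type (wk (wk A) # ?E # A # \<Gamma>) ?P"
      using ty_wk[OF v A2] by (intro is_type_Eq ty_0 is_type_wk A2) auto
    have *: "?E # A # \<Gamma> \<turnstile> Var 0 : Eq (wk (wk A)) (wk (wk a)) (Var (Suc 0))"
      using ty_0[OF tE] by simp
    have "?E # A # \<Gamma> \<turnstile> transport (wk (wk A)) ?P (wk (wk a)) (Var 0) (Var 0) : inst ?P (Var (Suc 0))"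
      by (rule ty_transport[OF P _ *]) (use * in \<open>simp add: inst_def\<close>)
    then show "?E # A # \<Gamma> \<turnstile> transport (wk (wk A)) ?P (wk (wk a)) (Var 0) (Var 0) :
      Eq (wk (wk A)) (Var (Suc 0)) (Var (Suc 0))" by (simp add: inst_def)
  qed
  have i2: "inst2 ?C x r = Eq (Eq A x x) (Refl x) (transport A (Eq (wk A) (Var 0) (wk x)) a r r)" for x r
    by (simp add: inst2_def transport_def)
  have Ra: "\<Gamma> \<turnstile> Refl a : Eq A a a" by (intro ty_Refl E)
  have tr: "\<Gamma> \<turnstile> transport A (Eq (wk A) (Var 0) (wk a)) a (Refl a) (Refl a) : Eq A a a"
    using ty_transport[of A \<Gamma> "Eq (wk A) (Var 0) (wk a)" "Refl a" a "Refl a" a] E Ra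
    by (auto simp: inst_def intro: is_type_Eq ty_wk ty_0 is_type_wk)
  \<comment> \<open>At \<open>Refl a\<close> the transport computes, so the base case is reflexivity
    up to conversion.\<close>
  have "transport A (Eq (wk A) (Var 0) (wk a)) a (Refl a) (Refl a) \<cong> Refl a"
    unfolding transport_def by (rule beta_Eq)
  from inh_conv[OF inh_refl[OF Ra] cong_Eq[OF conv_refl conv_refl conv_sym[OF this]]
      is_type_Eq[OF Ra tr is_type_Eq[OF E(2) E(2) E(1)]]]
  have "inh \<Gamma> (inst2 ?C a (Refl a))" unfolding i2 .
  then obtain d where "\<Gamma> \<turnstile> d : inst2 ?C a (Refl a)" by (auto simp: inh_def)
  from inhI[OF ty_J[OF C this q]] show ?thesis unfolding i2 .
qed

lemma inh_trans:
  assumes ab: "inh \<Gamma> (Eq A a b)" and bc: "inh \<Gamma> (Eq A b c)"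
  shows "inh \<Gamma> (Eq A a c)"
proof -
  note E = inh_EqD[OF ab]
  have "inh \<Gamma> (inst (Eq (wk A) (wk a) (Var 0)) c)"
    by (rule inh_transport[OF _ _ bc])
      (use E ab in \<open>auto simp: inst_def intro: is_type_Eq ty_0 ty_wk is_type_wk\<close>)
  then show ?thesis by (simp add: inst_def)
qed

text \<open>Built from \<open>h\<close> and the endpoints alone, so any two parallel paths that
  equal it are equal to each other.\<close>

definition canonical_path :: "tm \<Rightarrow> tm \<Rightarrow> tm \<Rightarrow> tm \<Rightarrow> tm" where
  "canonical_path P h x y =
     transport P (Eq (wk P) (Var 0) (wk y)) x (App (App h x) y) (App (App h x) x)"

lemma ren_canonical_path [simp]:
  "ren r (canonical_path P h x y) = canonical_path (ren r P) (ren r h) (ren r x) (ren r y)"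
  by (simp add: canonical_path_def transport_def)

lemma sub_canonical_path [simp]:
  "sub s (canonical_path P h x y) = canonical_path (sub s P) (sub s h) (sub s x) (sub s y)"
  by (simp add: canonical_path_def transport_def)

lemma ty_App_is_prop:
  assumes h: "\<Gamma> \<turnstile> h : is_prop P" and x: "\<Gamma> \<turnstile> x : P" and y: "\<Gamma> \<turnstile> y : P"
  shows "\<Gamma> \<turnstile> App (App h x) y : Eq P x y"
proof -
  have "\<Gamma> \<turnstile> App h x : Pi P (Eq (wk P) (wk x) (Var 0))"
    using ty_App[OF h[unfolded is_prop_def] x] by (simp add: inst_def)
  from ty_App[OF this y] show ?thesis by (simp add: inst_def)
qed

lemma ty_canonical_path:
  assumes h: "\<Gamma> \<turnstile> h : is_prop P" and x: "\<Gamma> \<turnstile> x : P" and y: "\<Gamma> \<turnstile> y : P"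
  shows "\<Gamma> \<turnstile> canonical_path P h x y : Eq P x y"
proof -
  note P = regularity[OF x]
  have "is_type (P # \<Gamma>) (Eq (wk P) (Var 0) (wk y))"
    by (intro is_type_Eq ty_0 ty_wk is_type_wk P y)
  from ty_transport[OF this _ ty_App_is_prop[OF h x x]] ty_App_is_prop[OF h x y]
  show ?thesis by (simp add: canonical_path_def inst_def)
qed

text \<open>Path induction on \<open>q\<close>. At \<open>Refl x\<close> the claim says that the
  loop \<open>h x x\<close>, transported along itself, is reflexivity, an instance of
  \<open>transport_refl_loop\<close>.\<close>

lemma inh_canonical_path:
  assumes h: "\<Gamma> \<turnstile> h : is_prop P" and q: "\<Gamma> \<turnstile> q : Eq P x y"
  shows "inh \<Gamma> (Eq (Eq P x y) q (canonical_path P h x y))"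
proof -
  note E = inh_EqD[OF inhI[OF q]]
  let ?E = "Eq (wk P) (wk x) (Var 0)"
  let ?C = "Eq (Eq (wk (wk P)) (wk (wk x)) (Var (Suc 0))) (Var 0)
    (canonical_path (wk (wk P)) (wk (wk h)) (wk (wk x)) (Var (Suc 0)))"
  have tE: "is_type (P # \<Gamma>) ?E"
    by (intro is_type_Eq ty_wk ty_0 is_type_wk E)
  have "?E # P # \<Gamma> \<turnstile> wk (wk h) : is_prop (wk (wk P))"
    using ty_wk[OF ty_wk[OF h E(1)] tE] by simp
  moreover have v0: "?E # P # \<Gamma> \<turnstile> Var 0 : Eq (wk (wk P)) (wk (wk x)) (Var (Suc 0))"
    using ty_0[OF tE] by simp
  ultimately have C: "is_type (?E # P # \<Gamma>) ?C"
    by (intro is_type_Eq ty_canonical_path ty_1 ty_wk E tE is_type_wk)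
  have i2: "inst2 ?C z r = Eq (Eq P x z) r (canonical_path P h x z)" for z r
    by (simp add: inst2_def)
  have "inh \<Gamma> (inst2 ?C x (Refl x))"
    unfolding i2 unfolding canonical_path_def
    by (rule transport_refl_loop[OF ty_App_is_prop[OF h E(2) E(2)]])
  then obtain d where "\<Gamma> \<turnstile> d : inst2 ?C x (Refl x)" by (auto simp: inh_def)
  from inhI[OF ty_J[OF C this q]] show ?thesis unfolding i2 .
qed

lemma is_prop_Eq:
  assumes P: "inh \<Gamma> (is_prop P)" and x: "\<Gamma> \<turnstile> x : P" and y: "\<Gamma> \<turnstile> y : P"
  shows "inh \<Gamma> (is_prop (Eq P x y))"
proof (rule inh_is_propI)
  let ?E = "Eq P x y" let ?\<Delta> = "wk ?E # ?E # \<Gamma>"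
  have E: "is_type \<Gamma> ?E" by (intro is_type_Eq x y regularity[OF x])
  have E': "is_type (?E # \<Gamma>) (wk ?E)" by (intro is_type_wk E)
  obtain h where h: "?\<Delta> \<turnstile> h : is_prop (wk (wk P))"
    using inh_is_prop_wk[OF inh_is_prop_wk[OF P E] E'] by (auto simp: inh_def)
  have "?\<Delta> \<turnstile> Var (Suc 0) : Eq (wk (wk P)) (wk (wk x)) (wk (wk y))"
    "?\<Delta> \<turnstile> Var 0 : Eq (wk (wk P)) (wk (wk x)) (wk (wk y))"
    using ty_1[OF E'] ty_0[OF E'] by simp_all
  from inh_trans[OF inh_canonical_path[OF h this(1)] inh_sym[OF inh_canonical_path[OF h this(2)]]]
  show "inh ?\<Delta> (Eq (wk (wk ?E)) (Var (Suc 0)) (Var 0))" by simp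
qed

text \<open>When two proofs of \<open>is_prop P\<close> are compared, either of them shows that
  \<open>P\<close> is a proposition. The identity types of \<open>P\<close> are then propositions,
  and so is their iterated product \<open>is_prop P\<close>.\<close>

lemma is_prop_is_prop:
  assumes "is_type \<Gamma> P"
  shows "inh \<Gamma> (is_prop (is_prop P))"
proof (rule inh_is_propI)
  let ?Q = "is_prop P" let ?\<Delta> = "wk ?Q # ?Q # \<Gamma>"
  have Q: "is_type \<Gamma> ?Q" by (rule is_type_is_prop[OF assms])
  have Q': "is_type (?Q # \<Gamma>) (wk ?Q)" by (rule is_type_wk[OF Q Q])
  let ?P = "wk (wk P)"
  have f: "?\<Delta> \<turnstile> Var (Suc 0) : is_prop ?P" and g: "?\<Delta> \<turnstile> Var 0 : is_prop ?P"
    using ty_1[OF Q'] ty_0[OF Q'] by simp_all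
  have P: "is_type ?\<Delta> ?P" by (intro is_type_wk assms Q Q')
  have P': "is_type (?P # ?\<Delta>) (wk ?P)" by (intro is_type_wk P)
  have "inh (wk ?P # ?P # ?\<Delta>) (is_prop (wk (wk ?P)))"
    by (intro inh_is_prop_wk inhI[OF f] P P')
  from is_prop_Eq[OF this ty_1[OF P'] ty_0[OF P']]
  have "inh ?\<Delta> (is_prop (is_prop ?P))"
    unfolding is_prop_def[of ?P] One_nat_def by (intro is_prop_Pi)
  from inh_is_propD[OF this f g]
  show "inh ?\<Delta> (Eq (wk (wk ?Q)) (Var (Suc 0)) (Var 0))" by simp
qed

section \<open>Projections and equality in subtypes\<close>

lemma sub_Var_Suc_Suc [simp]: "sub (\<lambda>n. Var (Suc (Suc n))) t = wk (wk t)"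
  by (simp add: ren_ren) (simp add: ren_eq_sub)

lemma sub_ups_Var_Suc_Suc [simp]:
  "sub (ups (\<lambda>n. Var (Suc (Suc n)))) t = ren (upr Suc) (ren (upr Suc) t)"
  unfolding ren_ren unfolding ren_eq_sub by (rule sub_cong, rename_tac n, case_tac n) simp_all

lemma ren_Proj1 [simp]: "ren r (Proj1 A F p) = Proj1 (ren r A) (ren r F) (ren r p)"
  by (simp add: Proj1_def)

lemma sub_Proj1 [simp]: "sub s (Proj1 A F p) = Proj1 (sub s A) (sub s F) (sub s p)"
  by (simp add: Proj1_def)

lemma SIG_inversion:
  assumes "\<Gamma> \<turnstile> p : SIG A B"
  shows "is_type \<Gamma> A" "is_type \<Gamma> (SIG A B)" "\<exists>j. \<Gamma> \<turnstile> Lam A B : Arr A (Univ j)"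
  using regularity[OF assms] Sig_inversion[of \<Gamma> A "Lam A B"] unfolding is_type_def by blast+

text \<open>The method inside \<open>Proj1\<close> has the unreduced domain
  \<open>App (wk F) (Var 0)\<close>, so it is typed by the primitive eliminator and not through
  \<open>ty_split\<close>.\<close>

lemma ty_Proj1:
  assumes p: "\<Gamma> \<turnstile> p : SIG A B"
  shows "\<Gamma> \<turnstile> Proj1 A (Lam A B) p : A"
proof -
  note S = SIG_inversion[OF p]
  obtain j where F: "\<Gamma> \<turnstile> Lam A B : Arr A (Univ j)" using S(3) by blast
  obtain k where A: "\<Gamma> \<turnstile> A : Univ k" using S(1) by (auto simp: is_type_def)
  let ?F = "Lam A B" let ?C = "Lam (Sig A ?F) (wk A)"
  have C: "\<Gamma> \<turnstile> ?C : Arr (Sig A ?F) (Univ k)"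
    using ty_wk[OF A S(2)] by (intro ty_family) simp
  have 1: "A # \<Gamma> \<turnstile> App (wk ?F) (Var 0) : Univ j"
    by (rule App_family[OF ty_wk[OF F S(1), unfolded ren_Arr ren.simps(2)] ty_0[OF S(1)]])
  have 2: "is_type (A # \<Gamma>) (App (wk ?F) (Var 0))" using 1 by (rule is_typeI)
  let ?\<Delta> = "App (wk ?F) (Var 0) # A # \<Gamma>" and ?t = "Tup (wk (wk ?F)) (Var (Suc 0)) (Var 0)"
  have "?\<Delta> \<turnstile> ?t : Sig (wk (wk A)) (wk (wk ?F))"
  proof (rule ty_Tup)
    show "?\<Delta> \<turnstile> wk (wk A) : Univ k"
      using ty_wk[OF ty_wk[OF A S(1)] 2] by simp
    show "?\<Delta> \<turnstile> wk (wk ?F) : Arr (wk (wk A)) (Univ j)"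
      using ty_wk[OF ty_wk[OF F S(1)] 2] by simp
    show "?\<Delta> \<turnstile> Var (Suc 0) : wk (wk A)" by (rule ty_1[OF 2])
    show "?\<Delta> \<turnstile> Var 0 : App (wk (wk ?F)) (Var (Suc 0))" using ty_0[OF 2] by simp
  qed
  moreover have "?\<Delta> \<turnstile> wk (wk ?C) : Arr (Sig (wk (wk A)) (wk (wk ?F))) (Univ k)"
    using ty_wk[OF ty_wk[OF C S(1)] 2] by simp
  ultimately have 3: "is_type ?\<Delta> (App (wk (wk ?C)) ?t)"
    by (intro is_typeI[OF App_family])
  have "App (wk (wk ?C)) ?t \<cong> wk (wk A)"
    using beta_Pi[of "wk (wk (Sig A ?F))" "wk (wk (wk A))" ?t] by simp
  from ty_convI[OF ty_1[OF 2] conv_sym[OF this] 3]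
  have "\<Gamma> \<turnstile> Lam A (Lam (App (wk ?F) (Var 0)) (Var 1))
      : Pi A (Pi (App (wk ?F) (Var 0)) (App (wk (wk ?C)) (Tup (wk (wk ?F)) (Var 1) (Var 0))))"
    unfolding One_nat_def by (intro ty_LamI)
  from ty_SigElim[OF C this p] have "\<Gamma> \<turnstile> Proj1 A ?F p : App ?C p"
    by (simp add: Proj1_def)
  then show ?thesis
    using ty_convI[OF _ beta_Pi, of \<Gamma> _ "Sig A ?F" "wk A" p] S(1) by simp
qed

lemma Proj1_Tup: "Proj1 A F (Tup F' a b) \<cong> a"
proof -
  have "App (Lam A (Lam (App (wk F) (Var 0)) (Var 1))) a \<cong> Lam (App F a) (wk a)"
    using beta_Pi[of A "Lam (App (wk F) (Var 0)) (Var 1)" a] by (simp add: inst_def)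
  from conv_trans[OF cong_App[OF this conv_refl] beta_Pi, of b]
  show ?thesis unfolding Proj1_def by (intro conv_trans[OF beta_Sig]) simp
qed

lemma Proj1_cong: "p \<cong> q \<Longrightarrow> Proj1 A F p \<cong> Proj1 A F q"
  unfolding Proj1_def by (intro cong_SigElim conv_refl)

lemma is_type_upr_wk:
  assumes "is_type (A # \<Gamma>) B" "is_type \<Gamma> C"
  shows "is_type (wk A # C # \<Gamma>) (ren (upr Suc) B)"
proof -
  obtain k where k: "\<Gamma> \<turnstile> A : Univ k"
    using is_type_wf[OF assms(1)] by (auto simp: wf_Cons_iff is_type_def)
  have "renaming (upr Suc) (A # \<Gamma>) (wk A # C # \<Gamma>)"
    by (rule renaming_upr[OF renaming_wk[OF assms(2)]]) (use ty_wk[OF k assms(2)] in simp)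
  from is_type_ren[OF assms(1) this] show ?thesis .
qed

lemma inh_upr_wk:
  assumes "inh (A # \<Gamma>) B" "is_type \<Gamma> C"
  shows "inh (wk A # C # \<Gamma>) (ren (upr Suc) B)"
  using inh_body[OF inh_wk[OF inh_Pi[OF assms(1)] assms(2), unfolded ren_binders]] .

lemma ty_pair_vars:
  assumes "is_type (A # \<Gamma>) B"
  shows "B # A # \<Gamma> \<turnstile> Tup (wk (wk (Lam A B))) (Var (Suc 0)) (Var 0) : wk (wk (SIG A B))"
proof -
  have A: "is_type \<Gamma> A" using is_type_wf[OF assms] by (simp add: wf_Cons_iff)
  have "is_type (wk (wk A) # B # A # \<Gamma>) (ren (upr Suc) (ren (upr Suc) B))"
    by (intro is_type_upr_wk assms A)
  from ty_pair[OF this ty_1[OF assms]] ty_0[OF assms] show ?thesis by simp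
qed

definition Proj2 :: "tm \<Rightarrow> tm \<Rightarrow> tm \<Rightarrow> tm" where
  "Proj2 A B p = SigElim
     (Lam (SIG A B) (inst (ren (upr Suc) B) (Proj1 (wk A) (wk (Lam A B)) (Var 0))))
     (Lam A (Lam B (Var 0))) p"

lemma ren_Proj2 [simp]: "ren r (Proj2 A B p) = Proj2 (ren r A) (ren (upr r) B) (ren r p)"
  by (simp add: Proj2_def)

lemma sub_Proj2 [simp]: "sub s (Proj2 A B p) = Proj2 (sub s A) (sub (ups s) B) (sub s p)"
  by (simp add: Proj2_def)

lemma ty_Proj2:
  assumes B: "is_type (A # \<Gamma>) B" and p: "\<Gamma> \<turnstile> p : SIG A B"
  shows "\<Gamma> \<turnstile> Proj2 A B p : inst B (Proj1 A (Lam A B) p)"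
proof -
  let ?F = "Lam A B"
  let ?C = "inst (ren (upr Suc) B) (Proj1 (wk A) (wk ?F) (Var 0))"
  note S = SIG_inversion[OF p]
  have C: "is_type (SIG A B # \<Gamma>) ?C"
    by (rule is_type_inst[OF is_type_upr_wk[OF B S(2)]])
      (use ty_0[OF S(2)] in \<open>simp add: ty_Proj1\<close>)
  let ?t = "Tup (wk (wk ?F)) (Var (Suc 0)) (Var 0)"
  have u: "unpair A B ?C =
      inst (ren (upr Suc) (ren (upr Suc) B)) (Proj1 (wk (wk A)) (wk (wk ?F)) ?t)"
    by (simp add: unpair_def)
  have "is_type (B # A # \<Gamma>) (unpair A B ?C)" unfolding u
    using ty_pair_vars[OF B]
    by (intro is_type_inst[OF is_type_upr_wk[OF is_type_upr_wk[OF B S(1)] B]]) (simp add: ty_Proj1)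
  \<comment> \<open>At a pair of variables the motive is \<open>B\<close> at the first projection of
    that pair. The projection computes to the first variable, which gives the second variable the
    required type.\<close>
  moreover have "wk B \<cong> unpair A B ?C" unfolding u
    using conv_inst[OF conv_refl conv_sym[OF Proj1_Tup]] by (metis inst_upr_wk_wk)
  ultimately have "B # A # \<Gamma> \<turnstile> Var 0 : unpair A B ?C"
    using ty_0[OF B] by (blast intro: ty_convI)
  from ty_split[OF C ty_LamI[OF ty_LamI[OF this]] p]
  have "\<Gamma> \<turnstile> Proj2 A B p : inst ?C p" unfolding Proj2_def .
  also have "inst ?C p = sub (case_nat p Var) ?C" by (rule inst_def)
  also have "\<dots> = inst B (Proj1 A ?F p)" by simp
  finally show ?thesis .
qed

lemma Proj2_Tup: "Proj2 A B (Tup F' a b) \<cong> b"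
proof -
  have "App (Lam A (Lam B (Var 0))) a \<cong> Lam (inst B a) (Var 0)"
    using beta_Pi[of A "Lam B (Var 0)" a] by (simp add: inst_def)
  from conv_trans[OF cong_App[OF this conv_refl] beta_Pi, of b]
  show ?thesis unfolding Proj2_def by (intro conv_trans[OF beta_Sig]) (simp add: inst_def)
qed


text \<open>With a literally shared first component no transport arises, so \<open>B\<close> may be
  any family; this serves the families \<open>Surj\<close> and \<open>Arr\<close>, whose members are
  not propositions.\<close>

lemma inh_pair_cong:
  assumes B: "is_type (A # \<Gamma>) B" and a: "\<Gamma> \<turnstile> a : A" and b: "inh \<Gamma> (Eq (inst B a) b b')"
  shows "inh \<Gamma> (Eq (SIG A B) (Tup (Lam A B) a b) (Tup (Lam A B) a b'))"
proof -
  let ?F = "Lam A B" and ?Ba = "inst B a"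
  have t: "is_type \<Gamma> ?Ba" by (rule is_type_inst[OF B a])
  have "?Ba # \<Gamma> \<turnstile> Tup (Lam (wk A) (ren (upr Suc) B)) (wk a) (Var 0) : SIG (wk A) (ren (upr Suc) B)"
    by (rule ty_pair[OF is_type_upr_wk[OF B t] ty_wk[OF a t]])
      (use ty_0[OF t] in simp)
  then have "?Ba # \<Gamma> \<turnstile> Tup (wk ?F) (wk a) (Var 0) : wk (SIG A B)" by simp
  from inh_cong[OF this b] show ?thesis by (simp add: inst_def)
qed

text \<open>The statement transported along the path of first components is quantified over the
  second component of the second pair. At the starting point both second components lie in the one
  proposition \<open>inst B a\<close>.\<close>

lemma inh_pair_eq:
  assumes B: "inh (A # \<Gamma>) (is_prop B)" and b: "\<Gamma> \<turnstile> b : inst B a" and b': "\<Gamma> \<turnstile> b' : inst B a'"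
    and eq: "inh \<Gamma> (Eq A a a')"
  shows "inh \<Gamma> (Eq (SIG A B) (Tup (Lam A B) a b) (Tup (Lam A B) a' b'))"
proof -
  let ?F = "Lam A B" and ?S = "SIG A B"
  note E = inh_EqD[OF eq]
  have tB: "is_type (A # \<Gamma>) B" by (rule is_prop_type[OF B])
  have S: "is_type \<Gamma> ?S" by (rule is_type_SIG[OF tB])
  let ?P = "Pi B (Eq (wk (wk ?S)) (wk (wk (Tup ?F a b))) (Tup (wk (wk ?F)) (Var (Suc 0)) (Var 0)))"
  have P: "is_type (A # \<Gamma>) ?P"
    by (intro is_type_Pi is_type_Eq is_type_wk ty_wk ty_pair_vars ty_pair tB S E b)
  have i: "inst ?P x = Pi (inst B x) (Eq (wk ?S) (wk (Tup ?F a b)) (Tup (wk ?F) (wk x) (Var 0)))" for x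
    by (simp add: inst_def)
  have "inh \<Gamma> (inst ?P a)" unfolding i
  proof (rule inh_Pi)
    let ?Ba = "inst B a" let ?B = "ren (upr Suc) B"
    have t: "is_type \<Gamma> ?Ba" by (rule is_type_inst[OF tB E(2)])
    have e: "inst ?B (wk a) = wk ?Ba" by simp
    have "inh (?Ba # \<Gamma>) (is_prop (wk ?Ba))"
      using inh_inst[OF B E(2)] t by (simp add: inst_def inh_is_prop_wk)
    from inh_is_propD[OF this ty_wk[OF b t] ty_0[OF t]]
    have "inh (?Ba # \<Gamma>) (Eq (inst ?B (wk a)) (wk b) (Var 0))" by simp
    from inh_pair_cong[OF is_type_upr_wk[OF tB t] ty_wk[OF E(2) t] this]
    show "inh (?Ba # \<Gamma>) (Eq (wk ?S) (wk (Tup ?F a b)) (Tup (wk ?F) (wk a) (Var 0)))" by simp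
  qed
  from inh_transport[OF P this eq, unfolded i]
  have "inh \<Gamma> (inst (Eq (wk ?S) (wk (Tup ?F a b)) (Tup (wk ?F) (wk a') (Var 0))) b')"
    by (rule inh_App[OF _ b'])
  then show ?thesis by (simp add: inst_def)
qed

text \<open>After splitting \<open>p\<close> into variables both projections compute, and the claim
  becomes reflexivity up to conversion.\<close>

lemma inh_SIG_eta:
  assumes B: "is_type (A # \<Gamma>) B" and p: "\<Gamma> \<turnstile> p : SIG A B"
  shows "inh \<Gamma> (Eq (SIG A B) (Tup (Lam A B) (Proj1 A (Lam A B) p) (Proj2 A B p)) p)"
proof -
  let ?F = "Lam A B" and ?S = "SIG A B"
  note S = SIG_inversion[OF p]
  let ?\<eta> = "\<lambda>A B p. Eq (SIG A B) (Tup (Lam A B) (Proj1 A (Lam A B) p) (Proj2 A B p)) p"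
  have tt: "is_type \<Delta> (?\<eta> A B p)" if "is_type (A # \<Delta>) B" "\<Delta> \<turnstile> p : SIG A B" for \<Delta> A B p
    by (rule is_type_Eq[OF ty_pair[OF that(1) ty_Proj1 ty_Proj2[OF that(1)]] that(2)
          is_type_SIG[OF that(1)]])
      (rule that)+
  let ?C = "?\<eta> (wk A) (ren (upr Suc) B) (Var 0)"
  have C: "is_type (?S # \<Gamma>) ?C"
    by (rule tt[OF is_type_upr_wk[OF B S(2)]]) (use ty_0[OF S(2)] in simp)
  let ?A = "wk (wk A)" and ?B = "ren (upr Suc) (ren (upr Suc) B)"
  let ?t = "Tup (wk (wk ?F)) (Var (Suc 0)) (Var 0)"
  note t = ty_pair_vars[OF B]
  have u: "unpair A B ?C = ?\<eta> ?A ?B ?t" by (simp add: unpair_def)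
  have "inh (B # A # \<Gamma>) (?\<eta> ?A ?B ?t)"
  proof (rule inh_conv[OF inh_refl[OF t]])
    show "Eq (wk (wk ?S)) ?t ?t \<cong> ?\<eta> ?A ?B ?t"
      unfolding ren_binders ren.simps(6)
      by (rule cong_Eq[OF conv_refl cong_Tup[OF conv_refl conv_sym[OF Proj1_Tup]
            conv_sym[OF Proj2_Tup]] conv_refl])
    show "is_type (B # A # \<Gamma>) (?\<eta> ?A ?B ?t)"
      by (rule tt[OF is_type_upr_wk[OF is_type_upr_wk[OF B S(1)] B]]) (use t in simp)
  qed
  then have "inh (?S # \<Gamma>) ?C" by (intro inh_SIG_elim[OF C]) (simp only: u)
  from inh_inst[OF this p] show ?thesis by (simp add: inst_def)
qed

text \<open>The shape that occurs below: the left side, built from an image, is a literal pair,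
  while the right side is an arbitrary element.\<close>

lemma inh_subtype_eq:
  assumes B: "inh (A # \<Gamma>) (is_prop B)" and b: "\<Gamma> \<turnstile> b : inst B a" and p: "\<Gamma> \<turnstile> p : SIG A B"
    and eq: "inh \<Gamma> (Eq A a (Proj1 A (Lam A B) p))"
  shows "inh \<Gamma> (Eq (SIG A B) (Tup (Lam A B) a b) p)"
  using inh_trans[OF inh_pair_eq[OF B b ty_Proj2[OF is_prop_type[OF B] p] eq]
      inh_SIG_eta[OF is_prop_type[OF B] p]] .

section \<open>Images\<close>

lemma ren_Omega [simp]: "ren r (Omega k) = Omega k"
  by (simp add: Omega_def)

lemma sub_Omega [simp]: "sub s (Omega k) = Omega k"
  by (simp add: Omega_def)

lemma ren_Member [simp]: "ren r (Member k S x) = Member k (ren r S) (ren r x)"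
  by (simp add: Member_def)

lemma sub_Member [simp]: "sub s (Member k S x) = Member k (sub s S) (sub s x)"
  by (simp add: Member_def)

lemma ren_Total [simp]: "ren r (Total k X S) = Total k (ren r X) (ren r S)"
  by (simp add: Total_def)

lemma sub_Total [simp]: "sub s (Total k X S) = Total k (sub s X) (sub s S)"
  by (simp add: Total_def)

lemma inst_Member [simp]: "inst (Member k (wk S) (Var 0)) x = Member k S x"
  by (simp add: inst_def)

lemma is_type_Var_0: "wf_ctx \<Gamma> \<Longrightarrow> is_type (Univ k # \<Gamma>) (Var 0)"
  using ty_0[OF is_type_Univ, of \<Gamma> k] by (auto intro: is_typeI)

lemma inh_is_prop_is_prop_Var:
  "wf_ctx \<Gamma> \<Longrightarrow> inh (Univ k # \<Gamma>) (is_prop (is_prop (Var 0)))"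
  by (intro is_prop_is_prop is_type_Var_0)

lemma is_type_Omega: "wf_ctx \<Gamma> \<Longrightarrow> is_type \<Gamma> (Omega k)"
  unfolding Omega_def by (intro is_type_SIG is_type_is_prop is_type_Var_0)

lemma ty_Member: "\<Gamma> \<turnstile> S : Arr X (Omega k) \<Longrightarrow> \<Gamma> \<turnstile> x : X \<Longrightarrow> \<Gamma> \<turnstile> Member k S x : Univ k"
  unfolding Member_def by (intro ty_Proj1) (simp flip: Omega_def add: ty_App_Arr)

lemma inh_is_prop_Member:
  assumes "\<Gamma> \<turnstile> S : Arr X (Omega k)" "\<Gamma> \<turnstile> x : X"
  shows "inh \<Gamma> (is_prop (Member k S x))"
proof -
  have "\<Gamma> \<turnstile> App S x : SIG (Univ k) (is_prop (Var 0))"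
    using ty_App_Arr[OF assms] by (simp add: Omega_def)
  from ty_Proj2[OF is_prop_type[OF inh_is_prop_is_prop_Var[OF wf_has_type[OF this]]] this]
  show ?thesis by (auto simp: inst_def Member_def intro: inhI)
qed

lemma Arr_inversion: "\<Gamma> \<turnstile> f : Arr A B \<Longrightarrow> is_type \<Gamma> A"
  using regularity[of \<Gamma> f "Arr A B"] Pi_inversion unfolding is_type_def Arr_def by blast

abbreviation total_family :: "nat \<Rightarrow> tm \<Rightarrow> tm \<Rightarrow> tm" where
  "total_family k X S \<equiv> Lam X (Member k (wk S) (Var 0))"

lemma ty_Member_0:
  assumes "\<Gamma> \<turnstile> S : Arr X (Omega k)"
  shows "X # \<Gamma> \<turnstile> Member k (wk S) (Var 0) : Univ k" "inh (X # \<Gamma>) (is_prop (Member k (wk S) (Var 0)))"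
proof -
  note X = Arr_inversion[OF assms]
  have "X # \<Gamma> \<turnstile> wk S : Arr (wk X) (Omega k)" using ty_wk[OF assms X] by simp
  from ty_Member[OF this ty_0[OF X]] inh_is_prop_Member[OF this ty_0[OF X]]
  show "X # \<Gamma> \<turnstile> Member k (wk S) (Var 0) : Univ k"
    "inh (X # \<Gamma>) (is_prop (Member k (wk S) (Var 0)))" .
qed

lemma is_type_Total: "\<Gamma> \<turnstile> S : Arr X (Omega k) \<Longrightarrow> is_type \<Gamma> (Total k X S)"
  unfolding Total_def by (intro is_type_SIG is_typeI[OF ty_Member_0(1)])

lemma ty_Total_pair:
  assumes "\<Gamma> \<turnstile> S : Arr X (Omega k)" "\<Gamma> \<turnstile> x : X" "\<Gamma> \<turnstile> a : Member k S x"
  shows "\<Gamma> \<turnstile> Tup (total_family k X S) x a : Total k X S"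
  unfolding Total_def using assms by (intro ty_pair is_typeI[OF ty_Member_0(1)]) auto

lemma ty_Total_Proj1: "\<Gamma> \<turnstile> p : Total k X S \<Longrightarrow> \<Gamma> \<turnstile> Proj1 X (total_family k X S) p : X"
  unfolding Total_def by (rule ty_Proj1)

lemma inh_Total_Proj2:
  assumes "\<Gamma> \<turnstile> S : Arr X (Omega k)" "\<Gamma> \<turnstile> p : Total k X S"
  shows "inh \<Gamma> (Member k S (Proj1 X (total_family k X S) p))"
  using ty_Proj2[OF is_typeI[OF ty_Member_0(1)[OF assms(1)]] assms(2)[unfolded Total_def]]
  by (auto intro: inhI)

section \<open>Fibres and truncation\<close>

definition fibre :: "tm \<Rightarrow> tm \<Rightarrow> tm \<Rightarrow> tm \<Rightarrow> tm" where
  "fibre I X f x = SIG I (Eq (wk X) (App (wk f) (Var 0)) (wk x))"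

lemma ren_fibre [simp]: "ren r (fibre I X f x) = fibre (ren r I) (ren r X) (ren r f) (ren r x)"
  by (simp add: fibre_def)

lemma sub_fibre [simp]: "sub s (fibre I X f x) = fibre (sub s I) (sub s X) (sub s f) (sub s x)"
  by (simp add: fibre_def)

lemma ty_App_wk_0_Arr: "\<Gamma> \<turnstile> f : Arr A B \<Longrightarrow> A # \<Gamma> \<turnstile> App (wk f) (Var 0) : wk B"
  unfolding Arr_def by (rule ty_App_wk_0)

text \<open>The sum ranges over \<open>I\<close> in \<open>Univ j\<close> and its body is a path
  type of \<open>X\<close> in \<open>Univ i\<close>; this is the origin of the level
  \<open>max i j\<close> of the subsets.\<close>

lemma ty_fibre:
  assumes "\<Gamma> \<turnstile> X : Univ i" "\<Gamma> \<turnstile> I : Univ j" "\<Gamma> \<turnstile> f : Arr I X" "\<Gamma> \<turnstile> x : X"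
  shows "\<Gamma> \<turnstile> fibre I X f x : Univ (max i j)"
proof -
  note I = is_typeI[OF assms(2)]
  have "I # \<Gamma> \<turnstile> Eq (wk X) (App (wk f) (Var 0)) (wk x) : Univ i"
    using ty_wk[OF assms(1) I] ty_App_wk_0_Arr[OF assms(3)] ty_wk[OF assms(4) I] by (simp add: ty_Eq)
  from ty_SIG[OF assms(2) this] show ?thesis by (simp add: fibre_def max.commute)
qed

lemma is_type_fibre:
  assumes "\<Gamma> \<turnstile> f : Arr I X" "\<Gamma> \<turnstile> x : X"
  shows "is_type \<Gamma> (fibre I X f x)"
  using ty_fibre[OF _ _ assms] regularity[OF assms(2)] Arr_inversion[OF assms(1)]
  unfolding is_type_def by blast

lemma inh_SIG: "is_type (A # \<Gamma>) B \<Longrightarrow> \<Gamma> \<turnstile> a : A \<Longrightarrow> inh \<Gamma> (inst B a) \<Longrightarrow> inh \<Gamma> (SIG A B)"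
  unfolding inh_def using ty_pair by blast

lemma inst_fibre [simp]:
  "inst (Eq (wk X) (App (wk f) (Var 0)) (wk x)) a = Eq X (App f a) x"
  by (simp add: inst_def)

lemma inh_fibre:
  assumes "\<Gamma> \<turnstile> f : Arr I X" "\<Gamma> \<turnstile> a : I" "inh \<Gamma> (Eq X (App f a) x)"
  shows "inh \<Gamma> (fibre I X f x)"
  unfolding fibre_def
proof (rule inh_SIG[OF _ assms(2)])
  note E = inh_EqD[OF assms(3)]
  note I = Arr_inversion[OF assms(1)]
  show "is_type (I # \<Gamma>) (Eq (wk X) (App (wk f) (Var 0)) (wk x))"
    by (intro is_type_Eq ty_App_wk_0_Arr assms(1) ty_wk E I is_type_wk)
qed (simp add: assms(3))

lemma inh_fibre_elim:
  assumes f: "\<Gamma> \<turnstile> f : Arr I X" and x: "\<Gamma> \<turnstile> x : X" and P: "is_type \<Gamma> P"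
    and "inh (Eq (wk X) (App (wk f) (Var 0)) (wk x) # I # \<Gamma>) (wk (wk P))"
  shows "inh (fibre I X f x # \<Gamma>) (wk P)"
  unfolding fibre_def
  by (rule inh_SIG_elim) (use assms is_type_fibre[OF f x] in \<open>auto intro: is_type_wk simp: fibre_def\<close>)

text \<open>Mere inhabitation does not suffice here, since this witness is a component of the image
  and thereby of the inverse map.\<close>

definition trunc_prop :: "tm \<Rightarrow> tm" where
  "trunc_prop A = Lam (Trunc A) (Lam (wk (Trunc A)) (TruncPath (Var (Suc 0)) (Var 0)))"

lemma ren_trunc_prop [simp]: "ren r (trunc_prop A) = trunc_prop (ren r A)"
  by (simp add: trunc_prop_def)

lemma sub_trunc_prop [simp]: "sub s (trunc_prop A) = trunc_prop (sub s A)"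
  by (simp add: trunc_prop_def)

lemma ty_trunc_prop:
  assumes "is_type \<Gamma> A"
  shows "\<Gamma> \<turnstile> trunc_prop A : is_prop (Trunc A)"
proof -
  let ?T = "Trunc A"
  have T: "is_type \<Gamma> ?T" by (rule is_type_Trunc[OF assms])
  have T': "is_type (?T # \<Gamma>) (wk ?T)" by (rule is_type_wk[OF T T])
  have "wk ?T # ?T # \<Gamma> \<turnstile> TruncPath (Var (Suc 0)) (Var 0) : Eq (wk (wk ?T)) (Var (Suc 0)) (Var 0)"
    using ty_TruncPath[of "wk ?T # ?T # \<Gamma>" "Var (Suc 0)" "wk (wk A)" "Var 0"] ty_1[OF T'] ty_0[OF T']
    by simp
  then show ?thesis unfolding trunc_prop_def is_prop_def One_nat_def by (intro ty_LamI)
qed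

lemma inh_is_prop_Trunc: "is_type \<Gamma> A \<Longrightarrow> inh \<Gamma> (is_prop (Trunc A))"
  by (intro inhI[OF ty_trunc_prop])

lemma inh_Trunc_elim_ctx:
  assumes "inh (A # \<Gamma>) (wk P)" "inh \<Gamma> (is_prop P)"
  shows "inh (Trunc A # \<Gamma>) (wk P)"
proof (rule inh_Trunc_elim)
  have A: "is_type \<Gamma> A" by (rule inh_is_type_hd[OF assms(1)])
  have T: "is_type \<Gamma> (Trunc A)" by (rule is_type_Trunc[OF A])
  show "inh (Trunc A # \<Gamma>) (Trunc (wk A))" using inhI[OF ty_0[OF T]] by simp
  show "inh (Trunc A # \<Gamma>) (is_prop (wk P))" by (rule inh_is_prop_wk[OF assms(2) T])
  show "is_type (Trunc A # \<Gamma>) (wk P)" by (intro is_type_wk is_prop_type[OF assms(2)] T)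
  show "inh (wk A # Trunc A # \<Gamma>) (wk (wk P))" using inh_upr_wk[OF assms(1) T] by simp
qed

section \<open>The image of a family and its corestriction\<close>

definition img_at :: "tm \<Rightarrow> tm \<Rightarrow> tm \<Rightarrow> nat \<Rightarrow> tm \<Rightarrow> tm" where
  "img_at I X f k x = Tup (Lam (Univ k) (is_prop (Var 0))) (Trunc (fibre I X f x)) (trunc_prop (fibre I X f x))"

definition img :: "nat \<Rightarrow> tm \<Rightarrow> tm \<Rightarrow> tm \<Rightarrow> tm" where
  "img k I X f = Lam X (img_at (wk I) (wk X) (wk f) k (Var 0))"

lemma ren_img_at [simp]:
  "ren r (img_at I X f k x) = img_at (ren r I) (ren r X) (ren r f) k (ren r x)"
  by (simp add: img_at_def)

lemma sub_img_at [simp]: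
  "sub s (img_at I X f k x) = img_at (sub s I) (sub s X) (sub s f) k (sub s x)"
  by (simp add: img_at_def)

lemma ren_img [simp]: "ren r (img k I X f) = img k (ren r I) (ren r X) (ren r f)"
  by (simp add: img_def)

lemma sub_img [simp]: "sub s (img k I X f) = img k (sub s I) (sub s X) (sub s f)"
  by (simp add: img_def)

lemma App_img: "App (img k I X f) x \<cong> img_at I X f k x"
  using beta_Pi[of X "img_at (wk I) (wk X) (wk f) k (Var 0)" x]
  by (simp add: img_def inst_def)

text \<open>The image at a point is a literal pair whose first projection computes. Membership and
  truncated fibre can therefore be exchanged by conversion, without a path.\<close>

lemma Member_img: "Member k (img k I X f) x \<cong> Trunc (fibre I X f x)"
  unfolding Member_def
  by (rule conv_trans[OF Proj1_cong[OF App_img]]) (simp add: img_at_def Proj1_Tup)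

lemma ty_img_at:
  assumes X: "\<Gamma> \<turnstile> X : Univ i" and I: "\<Gamma> \<turnstile> I : Univ j" and f: "\<Gamma> \<turnstile> f : Arr I X"
    and x: "\<Gamma> \<turnstile> x : X"
  shows "\<Gamma> \<turnstile> img_at I X f (max i j) x : Omega (max i j)"
  unfolding img_at_def Omega_def
proof (rule ty_pair)
  show "is_type (Univ (max i j) # \<Gamma>) (is_prop (Var 0))"
    by (intro is_type_is_prop is_type_Var_0 wf_has_type[OF X])
  show "\<Gamma> \<turnstile> Trunc (fibre I X f x) : Univ (max i j)"
    by (intro ty_Trunc ty_fibre X I f x)
  show "\<Gamma> \<turnstile> trunc_prop (fibre I X f x) : inst (is_prop (Var 0)) (Trunc (fibre I X f x))"
    using ty_trunc_prop[OF is_type_fibre[OF f x]] by (simp add: inst_def)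
qed

lemma ty_img:
  assumes X: "\<Gamma> \<turnstile> X : Univ i" and I: "\<Gamma> \<turnstile> I : Univ j" and f: "\<Gamma> \<turnstile> f : Arr I X"
  shows "\<Gamma> \<turnstile> img (max i j) I X f : Arr X (Omega (max i j))"
proof -
  note tX = is_typeI[OF X]
  from ty_img_at[OF ty_wk[OF X tX, simplified] ty_wk[OF I tX, simplified]
      ty_wk[OF f tX, simplified] ty_0[OF tX]]
  show ?thesis unfolding img_def by (intro ty_Lam_Arr) simp
qed

definition img_point :: "nat \<Rightarrow> tm \<Rightarrow> tm \<Rightarrow> tm \<Rightarrow> tm \<Rightarrow> tm" where
  "img_point k I X f a = Tup (total_family k X (img k I X f)) (App f a)
     (TruncIn (Tup (Lam I (Eq (wk X) (App (wk f) (Var 0)) (wk (App f a)))) a (Refl (App f a))))"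

definition corestr :: "nat \<Rightarrow> tm \<Rightarrow> tm \<Rightarrow> tm \<Rightarrow> tm" where
  "corestr k I X f = Lam I (img_point k (wk I) (wk X) (wk f) (Var 0))"

lemma ren_img_point [simp]:
  "ren r (img_point k I X f a) = img_point k (ren r I) (ren r X) (ren r f) (ren r a)"
  by (simp add: img_point_def)

lemma sub_img_point [simp]:
  "sub s (img_point k I X f a) = img_point k (sub s I) (sub s X) (sub s f) (sub s a)"
  by (simp add: img_point_def)

lemma ren_corestr [simp]: "ren r (corestr k I X f) = corestr k (ren r I) (ren r X) (ren r f)"
  by (simp add: corestr_def)

lemma sub_corestr [simp]: "sub s (corestr k I X f) = corestr k (sub s I) (sub s X) (sub s f)"
  by (simp add: corestr_def)

lemma App_corestr: "App (corestr k I X f) a \<cong> img_point k I X f a"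
  using beta_Pi[of I "img_point k (wk I) (wk X) (wk f) (Var 0)" a]
  by (simp add: corestr_def inst_def)

text \<open>The path \<open>Refl (App f a)\<close> puts \<open>a\<close> into the fibre over its own
  value; the truncation of this point is read as membership through
  \<open>Member_img\<close>.\<close>

lemma ty_img_point:
  assumes X: "\<Gamma> \<turnstile> X : Univ i" and I: "\<Gamma> \<turnstile> I : Univ j" and f: "\<Gamma> \<turnstile> f : Arr I X"
    and a: "\<Gamma> \<turnstile> a : I"
  shows "\<Gamma> \<turnstile> TruncIn (Tup (Lam I (Eq (wk X) (App (wk f) (Var 0)) (wk (App f a)))) a (Refl (App f a)))
      : Member (max i j) (img (max i j) I X f) (App f a)" (is ?pt)
    and "\<Gamma> \<turnstile> img_point (max i j) I X f a : Total (max i j) X (img (max i j) I X f)"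
proof -
  have fa: "\<Gamma> \<turnstile> App f a : X" by (rule ty_App_Arr[OF f a])
  note im = ty_img[OF X I f]
  have "is_type (I # \<Gamma>) (Eq (wk X) (App (wk f) (Var 0)) (wk (App f a)))"
    by (intro is_type_Eq ty_App_wk_0_Arr f ty_wk fa is_typeI[OF I] is_type_wk is_typeI[OF X])
  moreover have "\<Gamma> \<turnstile> Refl (App f a) : inst (Eq (wk X) (App (wk f) (Var 0)) (wk (App f a))) a"
    unfolding inst_fibre by (rule ty_Refl[OF fa])
  ultimately have "\<Gamma> \<turnstile>
      Tup (Lam I (Eq (wk X) (App (wk f) (Var 0)) (wk (App f a)))) a (Refl (App f a)) : fibre I X f (App f a)"
    unfolding fibre_def using a by (intro ty_pair)
  from ty_convI[OF ty_TruncIn[OF this] conv_sym[OF Member_img] is_typeI[OF ty_Member[OF im fa]]]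
  show ?pt .
  from ty_Total_pair[OF im fa this]
  show "\<Gamma> \<turnstile> img_point (max i j) I X f a : Total (max i j) X (img (max i j) I X f)"
    by (simp add: img_point_def)
qed

lemma ty_corestr:
  assumes X: "\<Gamma> \<turnstile> X : Univ i" and I: "\<Gamma> \<turnstile> I : Univ j" and f: "\<Gamma> \<turnstile> f : Arr I X"
  shows "\<Gamma> \<turnstile> corestr (max i j) I X f : Arr I (Total (max i j) X (img (max i j) I X f))"
proof -
  note tI = is_typeI[OF I]
  from ty_img_point(2)[OF ty_wk[OF X tI, simplified] ty_wk[OF I tI, simplified]
      ty_wk[OF f tI, simplified] ty_0[OF tI]]
  show ?thesis unfolding corestr_def by (intro ty_Lam_Arr) simp
qed


section \<open>Surjectivity of the corestriction\<close>

definition is_surj :: "tm \<Rightarrow> tm \<Rightarrow> tm \<Rightarrow> tm" where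
  "is_surj I Y e = Pi Y (Trunc (fibre (wk I) (wk Y) (wk e) (Var 0)))"

lemma ren_is_surj [simp]: "ren r (is_surj I Y e) = is_surj (ren r I) (ren r Y) (ren r e)"
  by (simp add: is_surj_def)

lemma sub_is_surj [simp]: "sub s (is_surj I Y e) = is_surj (sub s I) (sub s Y) (sub s e)"
  by (simp add: is_surj_def)

abbreviation surj_family :: "tm \<Rightarrow> tm \<Rightarrow> tm" where
  "surj_family I Y \<equiv> Lam (Arr I Y) (is_surj (wk I) (wk Y) (Var 0))"

lemma Surj_eq: "Surj I Y = SIG (Arr I Y) (is_surj (wk I) (wk Y) (Var 0))"
  by (simp add: Surj_def is_surj_def fibre_def)

lemma ren_Surj [simp]: "ren r (Surj I Y) = Surj (ren r I) (ren r Y)"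
  by (simp add: Surj_eq)

lemma sub_Surj [simp]: "sub s (Surj I Y) = Surj (sub s I) (sub s Y)"
  by (simp add: Surj_eq)

lemma inst_is_surj [simp]: "inst (is_surj (wk I) (wk Y) (Var 0)) e = is_surj I Y e"
  by (simp add: inst_def)

lemma inh_is_prop_is_surj:
  assumes "\<Gamma> \<turnstile> e : Arr I Y" "is_type \<Gamma> Y"
  shows "inh \<Gamma> (is_prop (is_surj I Y e))"
  unfolding is_surj_def
proof (intro is_prop_Pi inh_is_prop_Trunc is_type_fibre)
  show "Y # \<Gamma> \<turnstile> wk e : Arr (wk I) (wk Y)" using ty_wk[OF assms] by simp
  show "Y # \<Gamma> \<turnstile> Var 0 : wk Y" by (rule ty_0[OF assms(2)])
qed

lemma inh_is_prop_is_surj_Var: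
  assumes "is_type \<Gamma> I" "is_type \<Gamma> Y"
  shows "inh (Arr I Y # \<Gamma>) (is_prop (is_surj (wk I) (wk Y) (Var 0)))"
proof -
  have "is_type \<Gamma> (Arr I Y)" by (rule is_type_Arr[OF assms])
  from inh_is_prop_is_surj[OF _ is_type_wk[OF assms(2) this]] ty_0[OF this]
  show ?thesis by simp
qed

lemma is_type_Surj: "is_type \<Gamma> I \<Longrightarrow> is_type \<Gamma> Y \<Longrightarrow> is_type \<Gamma> (Surj I Y)"
  unfolding Surj_eq by (intro is_type_SIG is_prop_type[OF inh_is_prop_is_surj_Var])

lemma inh_is_surjD:
  assumes "inh \<Gamma> (is_surj I Y e)" "\<Gamma> \<turnstile> y : Y"
  shows "inh \<Gamma> (Trunc (fibre I Y e y))"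
  using inh_App[OF assms(1)[unfolded is_surj_def] assms(2)] by (simp add: inst_def)

text \<open>The path in \<open>X\<close> lifts to the total space: the membership proof built by
  \<open>corestr\<close> and the given \<open>m\<close> may differ, but membership is a
  proposition.\<close>

lemma inh_fibre_corestr:
  assumes X: "\<Gamma> \<turnstile> X : Univ i" and I: "\<Gamma> \<turnstile> I : Univ j" and f: "\<Gamma> \<turnstile> f : Arr I X"
    and m: "\<Gamma> \<turnstile> m : Member (max i j) (img (max i j) I X f) x"
    and a: "\<Gamma> \<turnstile> a : I" and eq: "inh \<Gamma> (Eq X (App f a) x)"
  defines "S \<equiv> img (max i j) I X f"
  shows "inh \<Gamma> (fibre I (Total (max i j) X S) (corestr (max i j) I X f)
      (Tup (total_family (max i j) X S) x m))"
proof (rule inh_fibre[OF ty_corestr[OF X I f, folded S_def] a])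
  let ?k = "max i j" and ?T = "Total (max i j) X S"
  let ?p = "Tup (total_family (max i j) X S) x m"
  note im = ty_img[OF X I f, folded S_def]
  note pt = ty_img_point[OF X I f a, folded S_def]
  have x: "\<Gamma> \<turnstile> x : X" by (rule inh_EqD(3)[OF eq])
  have "inh \<Gamma> (Eq ?T (img_point ?k I X f a) ?p)"
    unfolding Total_def img_point_def S_def[symmetric]
    by (rule inh_pair_eq[OF ty_Member_0(2)[OF im] _ _ eq])
      (use pt(1) m[folded S_def] in \<open>simp_all only: inst_Member\<close>)
  then show "inh \<Gamma> (Eq ?T (App (corestr ?k I X f) a) ?p)"
    by (rule inh_conv[OF _ cong_Eq[OF conv_refl conv_sym[OF App_corestr] conv_refl]])
      (intro is_type_Eq ty_App_Arr[OF ty_corestr[OF X I f, folded S_def] a]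
        ty_Total_pair[OF im x m[folded S_def]] is_type_Total[OF im])
qed

text \<open>By conversion \<open>m\<close> is an element of a truncated fibre of \<open>f\<close>.
  It may be opened because the goal is itself a truncation.\<close>

lemma inh_Trunc_fibre_corestr:
  assumes X: "\<Gamma> \<turnstile> X : Univ i" and I: "\<Gamma> \<turnstile> I : Univ j" and f: "\<Gamma> \<turnstile> f : Arr I X"
    and m: "\<Gamma> \<turnstile> m : Member (max i j) (img (max i j) I X f) x" and x: "\<Gamma> \<turnstile> x : X"
  defines "S \<equiv> img (max i j) I X f"
  shows "inh \<Gamma> (Trunc (fibre I (Total (max i j) X S) (corestr (max i j) I X f)
      (Tup (total_family (max i j) X S) x m)))" (is "inh \<Gamma> ?P")
proof -
  note im = ty_img[OF X I f, folded S_def]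
  note tm = ty_Total_pair[OF im x m[folded S_def]]
  note fib = is_type_fibre[OF ty_corestr[OF X I f, folded S_def] tm]
  note tf = is_type_fibre[OF f x]
  let ?E = "Eq (wk X) (App (wk f) (Var 0)) (wk x)"
  have E: "is_type (I # \<Gamma>) ?E"
    by (intro is_type_Eq ty_App_wk_0_Arr f ty_wk x is_typeI[OF I] is_type_wk is_typeI[OF X])
  have wk2: "?E # I # \<Gamma> \<turnstile> wk (wk t) : wk (wk T)" if "\<Gamma> \<turnstile> t : T" for t T
    by (intro ty_wk that is_typeI[OF I] E)
  have "inh (?E # I # \<Gamma>) (wk (wk ?P))"
    using inh_Trunc[OF inh_fibre_corestr[OF wk2[OF X, simplified] wk2[OF I, simplified] wk2[OF f, simplified]
        wk2[OF m, simplified] ty_1[OF E] inhI[OF ty_0[OF E, simplified]]]]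
    by (simp add: S_def)
  from inh_fibre_elim[OF f x is_type_Trunc[OF fib] this]
  have "inh (fibre I X f x # \<Gamma>) (wk ?P)" .
  moreover have "inh \<Gamma> (Trunc (fibre I X f x))"
    by (rule inh_conv[OF inhI[OF m] Member_img is_type_Trunc[OF tf]])
  ultimately show ?thesis
    by (intro inh_Trunc_elim[OF _ inh_is_prop_Trunc[OF fib] is_type_Trunc[OF fib]])
qed

text \<open>A point of the total space is split into an element and its membership proof, which
  brings it into the literal form handled before.\<close>

lemma inh_is_surj_corestr:
  assumes X: "\<Gamma> \<turnstile> X : Univ i" and I: "\<Gamma> \<turnstile> I : Univ j" and f: "\<Gamma> \<turnstile> f : Arr I X"
  shows "inh \<Gamma> (is_surj I (Total (max i j) X (img (max i j) I X f)) (corestr (max i j) I X f))"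
proof -
  let ?k = "max i j"
  let ?S = "img ?k I X f" let ?M = "Member ?k (wk ?S) (Var 0)" let ?T = "SIG X ?M"
  let ?C = "Trunc (fibre (wk I) (wk ?T) (wk (corestr ?k I X f)) (Var 0))"
  note tX = is_typeI[OF X]
  note im = ty_img[OF X I f]
  note cor = ty_corestr[OF X I f, unfolded Total_def]
  have T: "is_type \<Gamma> ?T" using is_type_Total[OF im] by (simp only: Total_def)
  have M: "is_type (X # \<Gamma>) ?M" by (rule is_typeI[OF ty_Member_0(1)[OF im]])
  have C: "is_type (?T # \<Gamma>) ?C"
    by (intro is_type_Trunc is_type_fibre ty_0 T) (use ty_wk[OF cor T] in simp)
  have wk2: "?M # X # \<Gamma> \<turnstile> wk (wk t) : wk (wk T)" if "\<Gamma> \<turnstile> t : T" for t T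
    by (intro ty_wk that tX M)
  have "inh (?M # X # \<Gamma>) (unpair X ?M ?C)"
    using inh_Trunc_fibre_corestr[of "?M # X # \<Gamma>" "wk (wk X)" i "wk (wk I)" j "wk (wk f)" "Var 0" "Var (Suc 0)"]
      wk2[OF X] wk2[OF I] wk2[OF f] ty_1[OF M] ty_0[OF M]
    by (simp add: unpair_def Total_def)
  from inh_SIG_elim[OF C this] show ?thesis unfolding is_surj_def Total_def by (rule inh_Pi)
qed


section \<open>The image of the map underlying a cover\<close>

definition underlying :: "nat \<Rightarrow> tm \<Rightarrow> tm \<Rightarrow> tm \<Rightarrow> tm \<Rightarrow> tm" where
  "underlying k X S I e = Lam I (Proj1 (wk X) (wk (total_family k X S)) (App (wk e) (Var 0)))"

lemma ren_underlying [simp]: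
  "ren r (underlying k X S I e) = underlying k (ren r X) (ren r S) (ren r I) (ren r e)"
  by (simp add: underlying_def)

lemma sub_underlying [simp]:
  "sub s (underlying k X S I e) = underlying k (sub s X) (sub s S) (sub s I) (sub s e)"
  by (simp add: underlying_def)

lemma ty_underlying:
  assumes e: "\<Gamma> \<turnstile> e : Arr I (Total k X S)"
  shows "\<Gamma> \<turnstile> underlying k X S I e : Arr I X"
proof -
  have "I # \<Gamma> \<turnstile> App (wk e) (Var 0) : Total k (wk X) (wk S)"
    using ty_App_wk_0_Arr[OF e] by simp
  from ty_Total_Proj1[OF this] show ?thesis unfolding underlying_def by (intro ty_Lam_Arr) simp
qed

lemma App_underlying: "App (underlying k X S I e) a \<cong> Proj1 X (total_family k X S) (App e a)"
  using beta_Pi[of I "Proj1 (wk X) (wk (total_family k X S)) (App (wk e) (Var 0))" a]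
  by (simp add: underlying_def inst_def)

lemma inh_Member_transport:
  assumes S: "\<Gamma> \<turnstile> S : Arr X (Omega k)" and p: "\<Gamma> \<turnstile> p : Total k X S"
    and eq: "inh \<Gamma> (Eq X (Proj1 X (total_family k X S) p) x)"
  shows "inh \<Gamma> (Member k S x)"
  using inh_transport[OF is_typeI[OF ty_Member_0(1)[OF S]] _ eq] inh_Total_Proj2[OF S p]
  unfolding inst_Member .

lemma inh_Eq_App_underlying:
  assumes e: "\<Gamma> \<turnstile> e : Arr I (Total k X S)" and a: "\<Gamma> \<turnstile> a : I"
  shows "inh \<Gamma> (Eq X (App (underlying k X S I e) a) x) \<longleftrightarrow>
    inh \<Gamma> (Eq X (Proj1 X (total_family k X S) (App e a)) x)"
proof -
  note c = App_underlying[of k X S I e a]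
  have 1: "\<Gamma> \<turnstile> App (underlying k X S I e) a : X" by (rule ty_App_Arr[OF ty_underlying[OF e] a])
  have 2: "\<Gamma> \<turnstile> Proj1 X (total_family k X S) (App e a) : X"
    by (rule ty_Total_Proj1[OF ty_App_Arr[OF e a]])
  show ?thesis
    using inh_conv[OF _ cong_Eq[OF conv_refl c conv_refl] is_type_Eq[OF 2 _ regularity[OF 2]], of x]
      inh_conv[OF _ cong_Eq[OF conv_refl conv_sym[OF c] conv_refl] is_type_Eq[OF 1 _ regularity[OF 1]], of x]
      inh_EqD(3) by blast
qed

text \<open>The point \<open>e a\<close> brings a proof that its first component belongs to
  \<open>S\<close>; the path in the fibre carries this proof over to \<open>x\<close>.\<close>

lemma inh_Member_if_fibre:
  assumes S: "\<Gamma> \<turnstile> S : Arr X (Omega k)" and e: "\<Gamma> \<turnstile> e : Arr I (Total k X S)" and x: "\<Gamma> \<turnstile> x : X"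
  shows "inh (fibre I X (underlying k X S I e) x # \<Gamma>) (wk (Member k S x))"
proof (rule inh_fibre_elim[OF ty_underlying[OF e] x is_typeI[OF ty_Member[OF S x]]])
  let ?f = "underlying k X S I e"
  let ?E = "Eq (wk X) (App (wk ?f) (Var 0)) (wk x)"
  note I = Arr_inversion[OF e] note X = regularity[OF x]
  have E: "is_type (I # \<Gamma>) ?E"
    by (intro is_type_Eq ty_App_wk_0_Arr ty_underlying[OF e] ty_wk x I is_type_wk X)
  let ?\<Delta> = "?E # I # \<Gamma>"
  have wk2: "?\<Delta> \<turnstile> wk (wk t) : wk (wk T)" if "\<Gamma> \<turnstile> t : T" for t T
    by (intro ty_wk that I E)
  have S': "?\<Delta> \<turnstile> wk (wk S) : Arr (wk (wk X)) (Omega k)"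
    and e': "?\<Delta> \<turnstile> wk (wk e) : Arr (wk (wk I)) (Total k (wk (wk X)) (wk (wk S)))"
    using wk2[OF S] wk2[OF e] by simp_all
  have a: "?\<Delta> \<turnstile> Var (Suc 0) : wk (wk I)" by (rule ty_1[OF E])
  have "inh ?\<Delta> (Eq (wk (wk X)) (App (underlying k (wk (wk X)) (wk (wk S)) (wk (wk I)) (wk (wk e)))
      (Var (Suc 0))) (wk (wk x)))"
    using inhI[OF ty_0[OF E]] by simp
  from inh_Member_transport[OF S' ty_App_Arr[OF e' a] this[unfolded inh_Eq_App_underlying[OF e' a]]]
  show "inh ?\<Delta> (wk (wk (Member k S x)))" by simp
qed

lemma inh_cong_Proj1:
  assumes "inh \<Gamma> (Eq (SIG A B) p q)"
  shows "inh \<Gamma> (Eq A (Proj1 A (Lam A B) p) (Proj1 A (Lam A B) q))"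
proof -
  have S: "is_type \<Gamma> (SIG A B)" by (rule inh_EqD[OF assms])
  have "SIG A B # \<Gamma> \<turnstile> Proj1 (wk A) (wk (Lam A B)) (Var 0) : wk A"
    using ty_Proj1[of "SIG A B # \<Gamma>" "Var 0" "wk A"] ty_0[OF S] by simp
  from inh_cong[OF this assms] show ?thesis by (simp add: inst_def)
qed

lemma inh_fibre_underlying:
  assumes e: "\<Gamma> \<turnstile> e : Arr I (Total k X S)" and a: "\<Gamma> \<turnstile> a : I"
    and eq: "inh \<Gamma> (Eq (Total k X S) (App e a) (Tup (total_family k X S) x m))"
    and x: "\<Gamma> \<turnstile> x : X"
  shows "inh \<Gamma> (fibre I X (underlying k X S I e) x)"
proof (rule inh_fibre[OF ty_underlying[OF e] a])
  note * = inh_cong_Proj1[OF eq[unfolded Total_def]]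
  have "inh \<Gamma> (Eq X (Proj1 X (total_family k X S) (App e a)) x)"
    by (rule inh_conv[OF * cong_Eq[OF conv_refl conv_refl Proj1_Tup]])
      (intro is_type_Eq inh_EqD[OF *] x)
  then show "inh \<Gamma> (Eq X (App (underlying k X S I e) a) x)"
    unfolding inh_Eq_App_underlying[OF e a] .
qed

text \<open>Surjectivity at the point \<open>(x, m)\<close> merely gives some \<open>a\<close> with
  \<open>e a = (x, m)\<close>, and the first projection of this path lies in \<open>X\<close>. The
  truncation may be opened because the goal is truncated.\<close>

lemma inh_fibre_if_Member:
  assumes S: "\<Gamma> \<turnstile> S : Arr X (Omega k)" and e: "\<Gamma> \<turnstile> e : Arr I (Total k X S)" and x: "\<Gamma> \<turnstile> x : X"
    and surj: "inh \<Gamma> (is_surj I (Total k X S) e)" and m: "\<Gamma> \<turnstile> m : Member k S x"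
  shows "inh \<Gamma> (Trunc (fibre I X (underlying k X S I e) x))"
proof -
  let ?f = "underlying k X S I e" let ?T = "Total k X S" let ?p = "Tup (total_family k X S) x m"
  note p = ty_Total_pair[OF S x m]
  let ?E = "Eq (wk ?T) (App (wk e) (Var 0)) (wk ?p)"
  note I = Arr_inversion[OF e] note T = regularity[OF p]
  have fib: "is_type \<Gamma> (fibre I X ?f x)" by (rule is_type_fibre[OF ty_underlying[OF e] x])
  have E: "is_type (I # \<Gamma>) ?E"
    by (intro is_type_Eq ty_App_wk_0_Arr e ty_wk p I is_type_wk T)
  let ?\<Delta> = "?E # I # \<Gamma>"
  have wk2: "?\<Delta> \<turnstile> wk (wk t) : wk (wk T)" if "\<Gamma> \<turnstile> t : T" for t T
    by (intro ty_wk that I E)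
  have e': "?\<Delta> \<turnstile> wk (wk e) : Arr (wk (wk I)) (Total k (wk (wk X)) (wk (wk S)))"
    using wk2[OF e] by simp
  have "inh ?\<Delta> (Eq (Total k (wk (wk X)) (wk (wk S))) (App (wk (wk e)) (Var (Suc 0)))
      (Tup (total_family k (wk (wk X)) (wk (wk S))) (wk (wk x)) (wk (wk m))))"
    using inhI[OF ty_0[OF E]] by simp
  from inh_Trunc[OF inh_fibre_underlying[OF e' ty_1[OF E] this wk2[OF x]]]
  have "inh ?\<Delta> (wk (wk (Trunc (fibre I X ?f x))))" by simp
  from inh_fibre_elim[OF e p is_type_Trunc[OF fib] this]
  show ?thesis
    by (intro inh_Trunc_elim[OF inh_is_surjD[OF surj p] inh_is_prop_Trunc[OF fib] is_type_Trunc[OF fib]])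
qed

lemma inh_img_underlying_eq:
  assumes X: "\<Gamma> \<turnstile> X : Univ i" and I: "\<Gamma> \<turnstile> I : Univ j"
    and S: "\<Gamma> \<turnstile> S : Arr X (Omega (max i j))" and e: "\<Gamma> \<turnstile> e : Arr I (Total (max i j) X S)"
    and surj: "inh \<Gamma> (is_surj I (Total (max i j) X S) e)"
  shows "inh \<Gamma> (Eq (Arr X (Omega (max i j))) (img (max i j) I X (underlying (max i j) X S I e)) S)"
proof -
  let ?k = "max i j"
  \<comment> \<open>Stated for arbitrary contexts and data, because function extensionality uses it
    in the context extended by a point of \<open>X\<close>, with everything weakened.\<close>
  have pointwise: "inh \<Delta> (Eq (Omega ?k) (App (img ?k I X (underlying ?k X S I e)) x) (App S x))"
    if X: "\<Delta> \<turnstile> X : Univ i" and I: "\<Delta> \<turnstile> I : Univ j"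
      and S: "\<Delta> \<turnstile> S : Arr X (Omega ?k)" and e: "\<Delta> \<turnstile> e : Arr I (Total ?k X S)"
      and surj: "inh \<Delta> (is_surj I (Total ?k X S) e)" and x: "\<Delta> \<turnstile> x : X" for \<Delta> X I S e x
  proof -
    let ?f = "underlying ?k X S I e"
    let ?F = "fibre I X ?f x" let ?M = "Member ?k S x"
    note f = ty_underlying[OF e]
    have wf: "wf_ctx \<Delta>" by (rule wf_has_type[OF x])
    have F: "\<Delta> \<turnstile> Trunc ?F : Univ ?k" by (intro ty_Trunc ty_fibre[OF X I f x])
    have pF: "inh \<Delta> (is_prop (Trunc ?F))" by (intro inh_is_prop_Trunc is_type_fibre f x)
    have M: "\<Delta> \<turnstile> ?M : Univ ?k" by (rule ty_Member[OF S x])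
    note tM = is_typeI[OF M]
    have wkM: "?M # \<Delta> \<turnstile> wk t : wk T" if "\<Delta> \<turnstile> t : T" for t T by (intro ty_wk that tM)
    have "inh (?M # \<Delta>) (wk (Trunc ?F))"
      using inh_fibre_if_Member[of "?M # \<Delta>" "wk S" "wk X" ?k "wk e" "wk I" "wk x" "Var 0"]
        wkM[OF S] wkM[OF e] wkM[OF x] inh_wk[OF surj tM] ty_0[OF tM] by simp
    then have "inh \<Delta> (Eq (Univ ?k) (Trunc ?F) ?M)"
      by (intro inh_PropExt F M pF inh_is_prop_Member[OF S x] inh_Trunc_elim_ctx
          inh_Member_if_fibre[OF S e x])
    \<comment> \<open>The path between the underlying types lifts to \<open>Omega\<close>, since
      being a proposition is a proposition.\<close>
    then have "inh \<Delta> (Eq (Omega ?k) (img_at I X ?f ?k x) (App S x))"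
      unfolding Omega_def img_at_def Member_def
      by (intro inh_subtype_eq[OF inh_is_prop_is_prop_Var[OF wf]])
        (use ty_App_Arr[OF S x] ty_trunc_prop[OF is_type_fibre[OF f x]] in
          \<open>simp_all add: inst_def flip: Omega_def\<close>)
    then show ?thesis
      by (rule inh_conv[OF _ cong_Eq[OF conv_refl conv_sym[OF App_img] conv_refl]])
        (intro is_type_Eq is_type_Omega wf ty_App_Arr[OF ty_img[OF X I f] x] ty_App_Arr[OF S x])
  qed
  note tX = is_typeI[OF X]
  have wkX: "X # \<Gamma> \<turnstile> wk t : wk T" if "\<Gamma> \<turnstile> t : T" for t T by (intro ty_wk that tX)
  show ?thesis
  proof (rule inh_FunExt_Arr[OF ty_img[OF X I ty_underlying[OF e]] S])
    show "inh (X # \<Gamma>) (Eq (wk (Omega ?k)) (App (wk (img ?k I X (underlying ?k X S I e))) (Var 0))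
        (App (wk S) (Var 0)))"
      using pointwise[of "X # \<Gamma>" "wk X" "wk I" "wk S" "wk e" "Var 0"]
        wkX[OF X] wkX[OF I] wkX[OF S] wkX[OF e] inh_wk[OF surj tX] ty_0[OF tX] by simp
  qed
qed

section \<open>Covered subsets\<close>

definition cover_rest :: "nat \<Rightarrow> nat \<Rightarrow> tm \<Rightarrow> tm \<Rightarrow> tm" where
  "cover_rest k j X S = SIG (Univ j) (Surj (Var 0) (Total k (wk X) (wk S)))"

lemma ren_cover_rest [simp]: "ren r (cover_rest k j X S) = cover_rest k j (ren r X) (ren r S)"
  by (simp add: cover_rest_def)

lemma sub_cover_rest [simp]: "sub s (cover_rest k j X S) = cover_rest k j (sub s X) (sub s S)"
  by (simp add: cover_rest_def)

abbreviation cover_family :: "nat \<Rightarrow> nat \<Rightarrow> tm \<Rightarrow> tm" where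
  "cover_family i j X \<equiv> Lam (Arr X (Omega (max i j))) (cover_rest (max i j) j (wk X) (Var 0))"

lemma CoveredSubsets_eq: "CoveredSubsets i j X = Sig (Arr X (Omega (max i j))) (cover_family i j X)"
  by (simp add: CoveredSubsets_def cover_rest_def)

lemma ren_CoveredSubsets [simp]: "ren r (CoveredSubsets i j X) = CoveredSubsets i j (ren r X)"
  by (simp add: CoveredSubsets_eq)

lemma sub_CoveredSubsets [simp]: "sub s (CoveredSubsets i j X) = CoveredSubsets i j (sub s X)"
  by (simp add: CoveredSubsets_eq)

lemma ren_Families [simp]: "ren r (Families j X) = Families j (ren r X)"
  by (simp add: Families_def)

lemma sub_Families [simp]: "sub s (Families j X) = Families j (sub s X)"
  by (simp add: Families_def)

definition cover :: "nat \<Rightarrow> nat \<Rightarrow> tm \<Rightarrow> tm \<Rightarrow> tm \<Rightarrow> tm \<Rightarrow> tm" where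
  "cover i j X S I t = Tup (cover_family i j X) S
     (Tup (Lam (Univ j) (Surj (Var 0) (Total (max i j) (wk X) (wk S)))) I t)"

lemma ren_cover [simp]:
  "ren r (cover i j X S I t) = cover i j (ren r X) (ren r S) (ren r I) (ren r t)"
  by (simp add: cover_def)

lemma sub_cover [simp]:
  "sub s (cover i j X S I t) = cover i j (sub s X) (sub s S) (sub s I) (sub s t)"
  by (simp add: cover_def)

lemma is_type_Surj_Var:
  assumes "\<Gamma> \<turnstile> S : Arr X (Omega k)"
  shows "is_type (Univ j # \<Gamma>) (Surj (Var 0) (Total k (wk X) (wk S)))"
proof -
  have wf: "wf_ctx \<Gamma>" by (rule wf_has_type[OF assms])
  have "Univ j # \<Gamma> \<turnstile> wk S : Arr (wk X) (Omega k)"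
    using ty_wk[OF assms is_type_Univ[OF wf]] by simp
  then show ?thesis by (intro is_type_Surj is_type_Var_0 wf is_type_Total)
qed

lemma is_type_cover_rest: "\<Gamma> \<turnstile> S : Arr X (Omega k) \<Longrightarrow> is_type \<Gamma> (cover_rest k j X S)"
  unfolding cover_rest_def by (intro is_type_SIG is_type_Surj_Var)

lemma is_type_cover_rest_Var:
  assumes "is_type \<Gamma> X"
  shows "is_type (Arr X (Omega k) # \<Gamma>) (cover_rest k j (wk X) (Var 0))"
  using is_type_cover_rest[of "Arr X (Omega k) # \<Gamma>" "Var 0" "wk X"]
    ty_0[OF is_type_Arr[OF assms is_type_Omega[OF is_type_wf[OF assms]]], of k] by simp

lemma is_type_CoveredSubsets: "is_type \<Gamma> X \<Longrightarrow> is_type \<Gamma> (CoveredSubsets i j X)"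
  unfolding CoveredSubsets_eq by (intro is_type_SIG is_type_cover_rest_Var)

lemma is_type_Arr_Var: "is_type \<Gamma> X \<Longrightarrow> is_type (Univ j # \<Gamma>) (Arr (Var 0) (wk X))"
  by (intro is_type_Arr is_type_Var_0 is_type_wk is_type_Univ) (auto intro: is_type_wf)

lemma is_type_Families: "is_type \<Gamma> X \<Longrightarrow> is_type \<Gamma> (Families j X)"
  unfolding Families_def by (intro is_type_SIG is_type_Arr_Var)

lemma ty_cover:
  assumes S: "\<Gamma> \<turnstile> S : Arr X (Omega (max i j))" and I: "\<Gamma> \<turnstile> I : Univ j"
    and t: "\<Gamma> \<turnstile> t : Surj I (Total (max i j) X S)"
  shows "\<Gamma> \<turnstile> cover i j X S I t : CoveredSubsets i j X"
proof -
  have "\<Gamma> \<turnstile> Tup (Lam (Univ j) (Surj (Var 0) (Total (max i j) (wk X) (wk S)))) I t :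
      cover_rest (max i j) j X S"
    unfolding cover_rest_def by (rule ty_pair[OF is_type_Surj_Var[OF S] I]) (use t in \<open>simp add: inst_def\<close>)
  then show ?thesis unfolding CoveredSubsets_eq cover_def
    by (intro ty_pair is_type_cover_rest_Var S Arr_inversion[OF S]) (simp add: inst_def)
qed

lemma inh_cover_cong:
  assumes S: "\<Gamma> \<turnstile> S : Arr X (Omega (max i j))" and I: "\<Gamma> \<turnstile> I : Univ j"
    and eq: "inh \<Gamma> (Eq (Surj I (Total (max i j) X S)) t t')"
  shows "inh \<Gamma> (Eq (CoveredSubsets i j X) (cover i j X S I t) (cover i j X S I t'))"
proof -
  let ?k = "max i j"
  have "inh \<Gamma> (Eq (inst (Surj (Var 0) (Total ?k (wk X) (wk S))) I) t t')"
    using eq by (simp add: inst_def)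
  from inh_pair_cong[OF is_type_Surj_Var[OF S] I this]
  have "inh \<Gamma> (Eq (inst (cover_rest ?k j (wk X) (Var 0)) S)
      (Tup (Lam (Univ j) (Surj (Var 0) (Total ?k (wk X) (wk S)))) I t)
      (Tup (Lam (Univ j) (Surj (Var 0) (Total ?k (wk X) (wk S)))) I t'))"
    by (simp add: inst_def flip: cover_rest_def)
  from inh_pair_cong[OF is_type_cover_rest_Var[OF Arr_inversion[OF S]] S this]
  show ?thesis unfolding CoveredSubsets_eq cover_def .
qed

section \<open>Comparing covers of one subset, then of two equal subsets\<close>

definition surj_map :: "tm \<Rightarrow> tm \<Rightarrow> tm \<Rightarrow> tm" where
  "surj_map I Y t = Proj1 (Arr I Y) (surj_family I Y) t"

lemma ren_surj_map [simp]: "ren r (surj_map I Y t) = surj_map (ren r I) (ren r Y) (ren r t)"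
  by (simp add: surj_map_def)

lemma sub_surj_map [simp]: "sub s (surj_map I Y t) = surj_map (sub s I) (sub s Y) (sub s t)"
  by (simp add: surj_map_def)

lemma ty_surj_map: "\<Gamma> \<turnstile> t : Surj I Y \<Longrightarrow> \<Gamma> \<turnstile> surj_map I Y t : Arr I Y"
  unfolding Surj_eq surj_map_def by (rule ty_Proj1)

lemma inh_is_surj_surj_map:
  assumes "\<Gamma> \<turnstile> t : Surj I Y" "is_type \<Gamma> I" "is_type \<Gamma> Y"
  shows "inh \<Gamma> (is_surj I Y (surj_map I Y t))"
  using ty_Proj2[OF is_prop_type[OF inh_is_prop_is_surj_Var[OF assms(2,3)]] assms(1)[unfolded Surj_eq]]
  by (auto simp: surj_map_def intro: inhI)

text \<open>The type of proofs that \<open>f\<close> and the map underlying the surjection \<open>t\<close> onto the total space of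
  \<open>S\<close> have the same values in \<open>X\<close>.  Having \<open>S\<close> and \<open>t\<close> as independent parameters is what allows
  transport along a path between subsets.\<close>

definition agrees :: "nat \<Rightarrow> tm \<Rightarrow> tm \<Rightarrow> tm \<Rightarrow> tm \<Rightarrow> tm \<Rightarrow> tm" where
  "agrees k X S I f t = Pi I (Eq (wk X) (App (wk f) (Var 0))
     (Proj1 (wk X) (wk (total_family k X S)) (App (wk (surj_map I (Total k X S) t)) (Var 0))))"

lemma ren_agrees [simp]:
  "ren r (agrees k X S I f t) = agrees k (ren r X) (ren r S) (ren r I) (ren r f) (ren r t)"
  by (simp add: agrees_def)

lemma sub_agrees [simp]:
  "sub s (agrees k X S I f t) = agrees k (sub s X) (sub s S) (sub s I) (sub s f) (sub s t)"
  by (simp add: agrees_def)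

lemma is_type_agrees:
  assumes X: "is_type \<Gamma> X" and f: "\<Gamma> \<turnstile> f : Arr I X" and t: "\<Gamma> \<turnstile> t : Surj I (Total k X S)"
  shows "is_type \<Gamma> (agrees k X S I f t)"
proof -
  note I = Arr_inversion[OF f]
  have "I # \<Gamma> \<turnstile> App (wk (surj_map I (Total k X S) t)) (Var 0) : Total k (wk X) (wk S)"
    using ty_App_wk_0_Arr[OF ty_surj_map[OF t]] by simp
  from ty_Total_Proj1[OF this] show ?thesis unfolding agrees_def
    by (intro is_type_Pi I is_type_Eq ty_App_wk_0_Arr[OF f] is_type_wk X) simp_all
qed

lemma inh_corestr_eq_at:
  assumes X: "\<Gamma> \<turnstile> X : Univ i" and I: "\<Gamma> \<turnstile> I : Univ j" and f: "\<Gamma> \<turnstile> f : Arr I X" and a: "\<Gamma> \<turnstile> a : I"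
  defines "S \<equiv> img (max i j) I X f"
  assumes p: "\<Gamma> \<turnstile> p : Total (max i j) X S"
    and eq: "inh \<Gamma> (Eq X (App f a) (Proj1 X (total_family (max i j) X S) p))"
  shows "inh \<Gamma> (Eq (Total (max i j) X S) (App (corestr (max i j) I X f) a) p)"
proof -
  let ?k = "max i j"
  note im = ty_img[OF X I f, folded S_def]
  have "inh \<Gamma> (Eq (Total ?k X S) (img_point ?k I X f a) p)"
    unfolding Total_def img_point_def S_def[symmetric]
    by (rule inh_subtype_eq[OF ty_Member_0(2)[OF im] _ p[unfolded Total_def] eq])
      (use ty_img_point(1)[OF X I f a, folded S_def] in \<open>simp only: inst_Member\<close>)
  then show ?thesis
    by (rule inh_conv[OF _ cong_Eq[OF conv_refl conv_sym[OF App_corestr] conv_refl]])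
      (intro is_type_Eq p is_type_Total im ty_App_Arr[OF ty_corestr[OF X I f, folded S_def] a])
qed

text \<open>The starting point of the transport: subset and index type coincide, so only the
  surjections remain. Their maps agree by function extensionality and
  \<open>inh_corestr_eq_at\<close>, and their surjectivity proofs inhabit a proposition.\<close>

lemma inh_cover_img_eq:
  assumes X: "\<Gamma> \<turnstile> X : Univ i" and I: "\<Gamma> \<turnstile> I : Univ j" and f: "\<Gamma> \<turnstile> f : Arr I X"
  defines "S \<equiv> img (max i j) I X f" and "c \<equiv> corestr (max i j) I X f"
  assumes s: "\<Gamma> \<turnstile> s : is_surj I (Total (max i j) X S) c"
    and t: "\<Gamma> \<turnstile> t : Surj I (Total (max i j) X S)"
    and q: "inh \<Gamma> (agrees (max i j) X S I f t)"
  shows "inh \<Gamma> (Eq (CoveredSubsets i j X)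
      (cover i j X S I (Tup (surj_family I (Total (max i j) X S)) c s)) (cover i j X S I t))"
proof (rule inh_cover_cong[OF ty_img[OF X I f, folded S_def] I])
  let ?k = "max i j" let ?T = "Total ?k X S" let ?e = "surj_map I ?T t"
  note tI = is_typeI[OF I]
  note im = ty_img[OF X I f, folded S_def]
  have wkI: "I # \<Gamma> \<turnstile> wk u : wk U" if "\<Gamma> \<turnstile> u : U" for u U by (intro ty_wk that tI)
  have "inh (I # \<Gamma>) (Eq (wk ?T) (App (wk c) (Var 0)) (App (wk ?e) (Var 0)))"
    using inh_corestr_eq_at[of "I # \<Gamma>" "wk X" i "wk I" j "wk f" "Var 0" "App (wk ?e) (Var 0)"]
      wkI[OF X] wkI[OF I] wkI[OF f] ty_0[OF tI] ty_App_wk_0_Arr[OF ty_surj_map[OF t]]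
      inh_body[OF q[unfolded agrees_def]]
    by (simp add: S_def c_def)
  from inh_FunExt_Arr[OF ty_corestr[OF X I f, folded S_def c_def] ty_surj_map[OF t] this]
  show "inh \<Gamma> (Eq (Surj I ?T) (Tup (surj_family I ?T) c s) t)"
    unfolding Surj_eq surj_map_def
    by (intro inh_subtype_eq[OF inh_is_prop_is_surj_Var[OF tI is_type_Total[OF im]]])
      (use s t in \<open>simp_all only: inst_is_surj Surj_eq\<close>)
qed

text \<open>\<open>t\<close> lives over \<open>S\<close> while the cover on the left lives over the
  image \<open>R\<close>, so the surjections cannot be compared directly. Both are brought under one
  statement about a variable subset, which is then moved from \<open>R\<close> to
  \<open>S\<close>.\<close>

lemma inh_cover_eq:
  assumes X: "\<Gamma> \<turnstile> X : Univ i" and I: "\<Gamma> \<turnstile> I : Univ j" and S: "\<Gamma> \<turnstile> S : Arr X (Omega (max i j))"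
    and t: "\<Gamma> \<turnstile> t : Surj I (Total (max i j) X S)"
  defines "f \<equiv> underlying (max i j) X S I (surj_map I (Total (max i j) X S) t)"
  defines "R \<equiv> img (max i j) I X f" and "c \<equiv> corestr (max i j) I X f"
  assumes s: "\<Gamma> \<turnstile> s : is_surj I (Total (max i j) X R) c"
  shows "inh \<Gamma> (Eq (CoveredSubsets i j X)
      (cover i j X R I (Tup (surj_family I (Total (max i j) X R)) c s)) (cover i j X S I t))"
proof -
  let ?k = "max i j" let ?O = "Omega ?k" let ?e = "surj_map I (Total ?k X S) t"
  let ?c = "cover i j X R I (Tup (surj_family I (Total ?k X R)) c s)"
  have e: "\<Gamma> \<turnstile> ?e : Arr I (Total ?k X S)" by (rule ty_surj_map[OF t])
  have f: "\<Gamma> \<turnstile> f : Arr I X" unfolding f_def by (rule ty_underlying[OF e])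
  have R: "\<Gamma> \<turnstile> R : Arr X ?O" unfolding R_def by (rule ty_img[OF X I f])
  have c: "\<Gamma> \<turnstile> c : Arr I (Total ?k X R)" unfolding R_def c_def by (rule ty_corestr[OF X I f])
  note tX = is_typeI[OF X] and tI = is_typeI[OF I]
  note tT = is_type_Total[OF R]
  have "\<Gamma> \<turnstile> Tup (surj_family I (Total ?k X R)) c s : Surj I (Total ?k X R)"
    unfolding Surj_eq
    by (rule ty_pair[OF is_prop_type[OF inh_is_prop_is_surj_Var[OF tI tT]] c]) (simp only: inst_is_surj s)
  then have tc: "\<Gamma> \<turnstile> ?c : CoveredSubsets i j X" by (intro ty_cover R I)
  \<comment> \<open>The transported family \<open>?P\<close>: for a variable subset, every
    surjection onto its total space that agrees with \<open>f\<close> makes a cover equal to the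
    fixed \<open>?c\<close>. Quantifying over the surjection avoids any computation with a
    transported \<open>t\<close>.\<close>
  let ?A1 = "Arr X ?O"
  let ?A2 = "Surj (wk I) (Total ?k (wk X) (Var 0))"
  let ?A3 = "agrees ?k (wk (wk X)) (Var (Suc 0)) (wk (wk I)) (wk (wk f)) (Var 0)"
  let ?E = "Eq (CoveredSubsets i j (wk (wk (wk X)))) (wk (wk (wk ?c)))
    (cover i j (wk (wk (wk X))) (Var (Suc (Suc 0))) (wk (wk (wk I))) (Var (Suc 0)))"
  let ?P = "Pi ?A2 (Pi ?A3 ?E)"
  have A1: "is_type \<Gamma> ?A1" by (intro is_type_Arr tX is_type_Omega wf_has_type[OF X])
  have v1: "?A1 # \<Gamma> \<turnstile> Var 0 : Arr (wk X) ?O" using ty_0[OF A1] by simp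
  have A2: "is_type (?A1 # \<Gamma>) ?A2" by (intro is_type_Surj is_type_wk tI A1 is_type_Total v1)
  have wk2: "?A2 # ?A1 # \<Gamma> \<turnstile> wk (wk u) : wk (wk U)" if "\<Gamma> \<turnstile> u : U" for u U
    by (intro ty_wk that A1 A2)
  have v2: "?A2 # ?A1 # \<Gamma> \<turnstile> Var 0 : Surj (wk (wk I)) (Total ?k (wk (wk X)) (Var (Suc 0)))"
    using ty_0[OF A2] by simp
  have A3: "is_type (?A2 # ?A1 # \<Gamma>) ?A3"
    using wk2[OF f] by (intro is_type_agrees is_type_wk tX A1 A2 v2) simp
  have E: "is_type (?A3 # ?A2 # ?A1 # \<Gamma>) ?E"
  proof (intro is_type_Eq is_type_CoveredSubsets is_type_wk tX A1 A2 A3)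
    show "?A3 # ?A2 # ?A1 # \<Gamma> \<turnstile> wk (wk (wk ?c)) : CoveredSubsets i j (wk (wk (wk X)))"
      using ty_wk[OF wk2[OF tc] A3] by simp
    show "?A3 # ?A2 # ?A1 # \<Gamma> \<turnstile>
        cover i j (wk (wk (wk X))) (Var (Suc (Suc 0))) (wk (wk (wk I))) (Var (Suc 0)) :
        CoveredSubsets i j (wk (wk (wk X)))"
      by (rule ty_cover)
        (use ty_wk[OF ty_wk[OF v1 A2] A3] ty_wk[OF wk2[OF I] A3] ty_wk[OF v2 A3] in simp_all)
  qed
  have P: "is_type (?A1 # \<Gamma>) ?P" by (intro is_type_Pi A2 A3 E)
  let ?Q2 = "\<lambda>Q. Surj I (Total ?k X Q)"
  let ?Q3 = "\<lambda>Q. agrees ?k (wk X) (wk Q) (wk I) (wk f) (Var 0)"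
  let ?QE = "\<lambda>Q. Eq (CoveredSubsets i j (wk (wk X))) (wk (wk ?c))
    (cover i j (wk (wk X)) (wk (wk Q)) (wk (wk I)) (Var (Suc 0)))"
  have inst_P: "inst ?P Q = Pi (?Q2 Q) (Pi (?Q3 Q) (?QE Q))" for Q
    by (simp add: inst_def)
  have "inh \<Gamma> (inst ?P R)" unfolding inst_P
  proof (intro inh_Pi)
    have B2: "is_type \<Gamma> (?Q2 R)" by (intro is_type_Surj tI tT)
    have u2: "?Q2 R # \<Gamma> \<turnstile> Var 0 : Surj (wk I) (Total ?k (wk X) (wk R))"
      using ty_0[OF B2] by simp
    have B3: "is_type (?Q2 R # \<Gamma>) (?Q3 R)"
      using ty_wk[OF f B2] by (intro is_type_agrees is_type_wk tX B2 u2) simp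
    have wk2: "?Q3 R # ?Q2 R # \<Gamma> \<turnstile> wk (wk u) : wk (wk U)" if "\<Gamma> \<turnstile> u : U" for u U
      by (intro ty_wk that B2 B3)
    show "inh (?Q3 R # ?Q2 R # \<Gamma>) (?QE R)"
      using inh_cover_img_eq[of "?Q3 R # ?Q2 R # \<Gamma>" "wk (wk X)" i "wk (wk I)" j "wk (wk f)" "wk (wk s)" "Var (Suc 0)"]
        wk2[OF X] wk2[OF I] wk2[OF f] wk2[OF s] ty_1[OF B3] inhI[OF ty_0[OF B3]]
      by (simp add: R_def c_def)
  qed
  \<comment> \<open>The path from the image to the subset; surjectivity of the map underlying
    \<open>t\<close> enters here.\<close>
  moreover have "inh \<Gamma> (Eq ?A1 R S)"
    unfolding R_def f_def
    by (intro inh_img_underlying_eq X I S e inh_is_surj_surj_map t tI is_type_Total)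
  ultimately have "inh \<Gamma> (inst ?P S)" by (rule inh_transport[OF P])
  from inh_App[OF this[unfolded inst_P] t]
  have *: "inh \<Gamma> (Pi (agrees ?k X S I f t) (Eq (CoveredSubsets i j (wk X)) (wk ?c)
      (cover i j (wk X) (wk S) (wk I) (wk t))))"
    by (simp add: inst_def)
  have wkI: "I # \<Gamma> \<turnstile> wk u : wk U" if "\<Gamma> \<turnstile> u : U" for u U by (intro ty_wk that tI)
  \<comment> \<open>Since \<open>f\<close> is by definition the first projection after
    \<open>?e\<close>, its agreement with \<open>t\<close> over \<open>S\<close> is reflexivity up
    to a beta step.\<close>
  have "inh (I # \<Gamma>) (Eq (wk X) (App (wk f) (Var 0))
      (Proj1 (wk X) (wk (total_family ?k X S)) (App (wk ?e) (Var 0))))"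
  proof -
    have e': "I # \<Gamma> \<turnstile> wk ?e : Arr (wk I) (Total ?k (wk X) (wk S))" using wkI[OF e] by simp
    have "inh (I # \<Gamma>) (Eq (wk X) (Proj1 (wk X) (wk (total_family ?k X S)) (App (wk ?e) (Var 0)))
        (Proj1 (wk X) (wk (total_family ?k X S)) (App (wk ?e) (Var 0))))"
      using ty_Total_Proj1[OF ty_App_Arr[OF e' ty_0[OF tI]]] by (intro inh_refl) simp
    then show ?thesis
      using inh_Eq_App_underlying[OF e' ty_0[OF tI]] by (simp add: f_def)
  qed
  then obtain q where "\<Gamma> \<turnstile> q : agrees ?k X S I f t"
    using inh_Pi unfolding agrees_def inh_def by blast
  from inh_App[OF * this] show ?thesis by (simp add: inst_def)
qed

section \<open>The equivalence\<close>

declare conv_trans [trans]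

section \<open>Maps out of nested sums\<close>

definition uncurry :: "tm \<Rightarrow> tm \<Rightarrow> tm \<Rightarrow> tm \<Rightarrow> tm" where
  "uncurry A B C g = Lam (SIG A B) (SigElim (wk (Lam (SIG A B) (wk C))) (wk (Lam A g)) (Var 0))"

lemma ren_uncurry [simp]:
  "ren r (uncurry A B C g) = uncurry (ren r A) (ren (upr r) B) (ren r C) (ren (upr r) g)"
  by (simp add: uncurry_def)

lemma sub_uncurry [simp]:
  "sub s (uncurry A B C g) = uncurry (sub s A) (sub (ups s) B) (sub s C) (sub (ups s) g)"
  by (simp add: uncurry_def)

lemma ty_uncurry:
  assumes B: "is_type (A # \<Gamma>) B" and C: "is_type \<Gamma> C" and g: "A # \<Gamma> \<turnstile> g : Arr B (wk C)"
  shows "\<Gamma> \<turnstile> uncurry A B C g : Arr (SIG A B) C"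
  unfolding uncurry_def
proof (rule ty_Lam_Arr)
  let ?S = "SIG A B"
  have S: "is_type \<Gamma> ?S" by (rule is_type_SIG[OF B])
  have "\<Gamma> \<turnstile> Lam A g : Pi A (Pi B (wk (wk C)))"
    using ty_LamI[OF g] by (simp add: Arr_def)
  from ty_wk[OF this S]
  have d: "?S # \<Gamma> \<turnstile> wk (Lam A g) : Pi (wk A) (Pi (ren (upr Suc) B)
      (unpair (wk A) (ren (upr Suc) B) (wk (wk C))))"
    by simp
  have S': "is_type (?S # \<Gamma>) (SIG (wk A) (ren (upr Suc) B))"
    using is_type_wk[OF S S] by simp
  from ty_split[OF is_type_wk[OF is_type_wk[OF C S] S'] d] ty_0[OF S]
  show "?S # \<Gamma> \<turnstile> SigElim (wk (Lam ?S (wk C))) (wk (Lam A g)) (Var 0) : wk C"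
    by simp
qed

lemma App_uncurry: "App (uncurry A B C g) (Tup F a b) \<cong> App (inst g a) b"
proof -
  have "App (uncurry A B C g) (Tup F a b) \<cong>
      SigElim (Lam (SIG A B) (wk C)) (Lam A g) (Tup F a b)"
    unfolding uncurry_def by (rule conv_trans[OF beta_Pi]) (simp add: inst_def conv_refl)
  also have "\<dots> \<cong> App (App (Lam A g) a) b" by (rule beta_Sig)
  also have "\<dots> \<cong> App (inst g a) b" by (intro cong_App beta_Pi conv_refl)
  finally show ?thesis .
qed

section \<open>From covered subsets to families\<close>

definition family :: "nat \<Rightarrow> tm \<Rightarrow> tm \<Rightarrow> tm \<Rightarrow> tm" where
  "family j X I f = Tup (Lam (Univ j) (Arr (Var 0) (wk X))) I f"

lemma ren_family [simp]: "ren r (family j X I f) = family j (ren r X) (ren r I) (ren r f)"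
  by (simp add: family_def)

lemma sub_family [simp]: "sub s (family j X I f) = family j (sub s X) (sub s I) (sub s f)"
  by (simp add: family_def)

lemma ty_family_pair:
  assumes "is_type \<Gamma> X" "\<Gamma> \<turnstile> I : Univ j" "\<Gamma> \<turnstile> f : Arr I X"
  shows "\<Gamma> \<turnstile> family j X I f : Families j X"
  unfolding family_def Families_def
  by (rule ty_pair[OF is_type_Arr_Var[OF assms(1)] assms(2)]) (use assms(3) in \<open>simp add: inst_def\<close>)

text \<open>The suffix counts the components already given: \<open>to_family2\<close> awaits only
  the surjection, \<open>to_family1\<close> also the index type, and \<open>to_family\<close> the
  subset as well. Each nested pair is taken apart by one \<open>uncurry\<close>.\<close>

definition to_family2 :: "nat \<Rightarrow> nat \<Rightarrow> tm \<Rightarrow> tm \<Rightarrow> tm \<Rightarrow> tm" where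
  "to_family2 k j X S I = Lam (Surj I (Total k X S)) (family j (wk X) (wk I)
     (underlying k (wk X) (wk S) (wk I) (surj_map (wk I) (wk (Total k X S)) (Var 0))))"

definition to_family1 :: "nat \<Rightarrow> nat \<Rightarrow> tm \<Rightarrow> tm \<Rightarrow> tm" where
  "to_family1 k j X S = uncurry (Univ j) (Surj (Var 0) (Total k (wk X) (wk S))) (Families j X)
     (to_family2 k j (wk X) (wk S) (Var 0))"

definition to_family :: "nat \<Rightarrow> nat \<Rightarrow> tm \<Rightarrow> tm" where
  "to_family i j X = uncurry (Arr X (Omega (max i j))) (cover_rest (max i j) j (wk X) (Var 0))
     (Families j X) (to_family1 (max i j) j (wk X) (Var 0))"

lemma ren_to_family [simp]:
  "ren r (to_family2 k j X S I) = to_family2 k j (ren r X) (ren r S) (ren r I)"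
  "ren r (to_family1 k j X S) = to_family1 k j (ren r X) (ren r S)"
  "ren r (to_family i j X) = to_family i j (ren r X)"
proof -
  show 2: "ren r (to_family2 k j X S I) = to_family2 k j (ren r X) (ren r S) (ren r I)" for r X S I k
    by (simp add: to_family2_def)
  show 1: "ren r (to_family1 k j X S) = to_family1 k j (ren r X) (ren r S)" for r X S k
    by (simp add: to_family1_def 2)
  show "ren r (to_family i j X) = to_family i j (ren r X)"
    by (simp add: to_family_def 1)
qed

lemma sub_to_family [simp]:
  "sub s (to_family2 k j X S I) = to_family2 k j (sub s X) (sub s S) (sub s I)"
  "sub s (to_family1 k j X S) = to_family1 k j (sub s X) (sub s S)"
  "sub s (to_family i j X) = to_family i j (sub s X)"
proof -
  show 2: "sub s (to_family2 k j X S I) = to_family2 k j (sub s X) (sub s S) (sub s I)" for s X S I k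
    by (simp add: to_family2_def)
  show 1: "sub s (to_family1 k j X S) = to_family1 k j (sub s X) (sub s S)" for s X S k
    by (simp add: to_family1_def 2)
  show "sub s (to_family i j X) = to_family i j (sub s X)"
    by (simp add: to_family_def 1)
qed

lemma ty_to_family2:
  assumes X: "is_type \<Gamma> X" and S: "\<Gamma> \<turnstile> S : Arr X (Omega k)" and I: "\<Gamma> \<turnstile> I : Univ j"
  shows "\<Gamma> \<turnstile> to_family2 k j X S I : Arr (Surj I (Total k X S)) (Families j X)"
  unfolding to_family2_def
proof (rule ty_Lam_Arr)
  let ?A = "Surj I (Total k X S)"
  have A: "is_type \<Gamma> ?A" by (intro is_type_Surj is_typeI[OF I] is_type_Total S)
  have "?A # \<Gamma> \<turnstile> Var 0 : Surj (wk I) (Total k (wk X) (wk S))" using ty_0[OF A] by simp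
  from ty_family_pair[OF is_type_wk[OF X A] _ ty_underlying[OF ty_surj_map[OF this]]] ty_wk[OF I A]
  show "?A # \<Gamma> \<turnstile> family j (wk X) (wk I)
      (underlying k (wk X) (wk S) (wk I) (surj_map (wk I) (wk (Total k X S)) (Var 0))) :
      wk (Families j X)" by simp
qed

lemma ty_to_family1:
  assumes X: "is_type \<Gamma> X" and S: "\<Gamma> \<turnstile> S : Arr X (Omega k)"
  shows "\<Gamma> \<turnstile> to_family1 k j X S : Arr (cover_rest k j X S) (Families j X)"
  unfolding to_family1_def cover_rest_def
proof (rule ty_uncurry[OF is_type_Surj_Var[OF S] is_type_Families[OF X]])
  have U: "is_type \<Gamma> (Univ j)" by (rule is_type_Univ[OF is_type_wf[OF X]])
  show "Univ j # \<Gamma> \<turnstile> to_family2 k j (wk X) (wk S) (Var 0) :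
      Arr (Surj (Var 0) (Total k (wk X) (wk S))) (wk (Families j X))"
    using ty_to_family2[OF is_type_wk[OF X U], of "wk S" k "Var 0" j] ty_wk[OF S U] ty_0[OF U] by simp
qed

lemma ty_to_family:
  assumes X: "is_type \<Gamma> X"
  shows "\<Gamma> \<turnstile> to_family i j X : Arr (CoveredSubsets i j X) (Families j X)"
  unfolding to_family_def CoveredSubsets_eq
proof (rule ty_uncurry[OF is_type_cover_rest_Var[OF X] is_type_Families[OF X]])
  let ?A = "Arr X (Omega (max i j))"
  have A: "is_type \<Gamma> ?A" by (intro is_type_Arr X is_type_Omega is_type_wf[OF X])
  show "?A # \<Gamma> \<turnstile> to_family1 (max i j) j (wk X) (Var 0) :
      Arr (cover_rest (max i j) j (wk X) (Var 0)) (wk (Families j X))"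
    using ty_to_family1[OF is_type_wk[OF X A], of "Var 0" "max i j" j] ty_0[OF A] by simp
qed

text \<open>Both occurrences of \<open>uncurry\<close> compute on the literal pairs of
  \<open>cover\<close>, so the passage to families creates no path.\<close>

lemma App_to_family:
  "App (to_family i j X) (cover i j X S I t) \<cong>
    family j X I (underlying (max i j) X S I (surj_map I (Total (max i j) X S) t))"
proof -
  let ?k = "max i j"
  have 1: "inst (to_family1 ?k j (wk X) (Var 0)) S = to_family1 ?k j X S"
    and 2: "inst (to_family2 ?k j (wk X) (wk S) (Var 0)) I = to_family2 ?k j X S I"
    by (simp_all add: inst_def)
  have "App (to_family i j X) (cover i j X S I t) \<cong>
      App (to_family1 ?k j X S) (Tup (Lam (Univ j) (Surj (Var 0) (Total ?k (wk X) (wk S)))) I t)"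
    unfolding to_family_def cover_def
      by (rule App_uncurry[where g = "to_family1 ?k j (wk X) (Var 0)" and a = S, unfolded 1])
  also have "\<dots> \<cong> App (to_family2 ?k j X S I) t"
    unfolding to_family1_def
      by (rule App_uncurry[where g = "to_family2 ?k j (wk X) (wk S) (Var 0)" and a = I, unfolded 2])
  also have "\<dots> \<cong> family j X I (underlying ?k X S I (surj_map I (Total ?k X S) t))"
    unfolding to_family2_def by (rule conv_trans[OF beta_Pi]) (simp add: inst_def conv_refl)
  finally show ?thesis .
qed

text \<open>Choosing a closed term keeps the map from families to covers stable under substitution; its
  existence is the content of the lemma below.\<close>

definition surj_proof :: "nat \<Rightarrow> nat \<Rightarrow> tm" where
  "surj_proof i j = (SOME t. [] \<turnstile> t : Pi (Univ i) (Pi (Univ j) (Pi (Arr (Var 0) (Var (Suc 0)))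
     (is_surj (Var (Suc 0))
       (Total (max i j) (Var (Suc (Suc 0))) (img (max i j) (Var (Suc 0)) (Var (Suc (Suc 0))) (Var 0)))
       (corestr (max i j) (Var (Suc 0)) (Var (Suc (Suc 0))) (Var 0))))))"

text \<open>Surjectivity of the corestriction, proved in the generic context of \<open>X\<close>,
  \<open>I\<close> and \<open>f\<close> and then abstracted three times, supplies the existence that
  the choice requires.\<close>

lemma ty_surj_proof_closed:
  "[] \<turnstile> surj_proof i j : Pi (Univ i) (Pi (Univ j) (Pi (Arr (Var 0) (Var (Suc 0)))
     (is_surj (Var (Suc 0))
       (Total (max i j) (Var (Suc (Suc 0))) (img (max i j) (Var (Suc 0)) (Var (Suc (Suc 0))) (Var 0)))
       (corestr (max i j) (Var (Suc 0)) (Var (Suc (Suc 0))) (Var 0)))))"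
  unfolding surj_proof_def
proof (rule someI_ex, fold inh_def, intro inh_Pi)
  let ?\<Gamma> = "[Arr (Var 0) (Var (Suc 0)), Univ j, Univ i]"
  have U: "is_type [] (Univ i)" "is_type [Univ i] (Univ j)"
    by (auto intro!: is_type_Univ wf_Nil simp: wf_Cons_iff)
  have X: "[Univ j, Univ i] \<turnstile> Var (Suc 0) : Univ i" and I: "[Univ j, Univ i] \<turnstile> Var 0 : Univ j"
    using ty_1[OF U(2)] ty_0[OF U(2)] by simp_all
  have A: "is_type [Univ j, Univ i] (Arr (Var 0) (Var (Suc 0)))"
    by (intro is_type_Arr is_typeI[OF X] is_typeI[OF I])
  from inh_is_surj_corestr[of ?\<Gamma> "Var (Suc (Suc 0))" i "Var (Suc 0)" j "Var 0"]
    ty_wk[OF X A] ty_wk[OF I A] ty_0[OF A]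
  show "inh ?\<Gamma> (is_surj (Var (Suc 0))
       (Total (max i j) (Var (Suc (Suc 0))) (img (max i j) (Var (Suc 0)) (Var (Suc (Suc 0))) (Var 0)))
       (corestr (max i j) (Var (Suc 0)) (Var (Suc (Suc 0))) (Var 0)))"
    by simp
qed

lemma ren_surj_proof [simp]: "ren r (surj_proof i j) = surj_proof i j"
  by (rule ren_closed[OF ty_surj_proof_closed])

lemma sub_surj_proof [simp]: "sub s (surj_proof i j) = surj_proof i j"
  by (rule sub_closed[OF ty_surj_proof_closed])

lemma ty_surj_proof:
  assumes X: "\<Gamma> \<turnstile> X : Univ i" and I: "\<Gamma> \<turnstile> I : Univ j" and f: "\<Gamma> \<turnstile> f : Arr I X"
  shows "\<Gamma> \<turnstile> App (App (App (surj_proof i j) X) I) f :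
    is_surj I (Total (max i j) X (img (max i j) I X f)) (corestr (max i j) I X f)"
proof -
  note p = has_type_closed[OF ty_surj_proof_closed wf_has_type[OF X], of i j]
  from ty_App[OF p X] have "\<Gamma> \<turnstile> App (surj_proof i j) X : Pi (Univ j) (Pi (Arr (Var 0) (wk X))
      (is_surj (Var (Suc 0))
        (Total (max i j) (wk (wk X)) (img (max i j) (Var (Suc 0)) (wk (wk X)) (Var 0)))
        (corestr (max i j) (Var (Suc 0)) (wk (wk X)) (Var 0))))"
    by (simp add: inst_def)
  from ty_App[OF this I] have "\<Gamma> \<turnstile> App (App (surj_proof i j) X) I : Pi (Arr I X)
      (is_surj (wk I) (Total (max i j) (wk X) (img (max i j) (wk I) (wk X) (Var 0)))
        (corestr (max i j) (wk I) (wk X) (Var 0)))"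
    by (simp add: inst_def)
  from ty_App[OF this f] show ?thesis by (simp add: inst_def)
qed

section \<open>From families to covered subsets\<close>

definition img_cover :: "nat \<Rightarrow> nat \<Rightarrow> tm \<Rightarrow> tm \<Rightarrow> tm \<Rightarrow> tm" where
  "img_cover i j X I f = cover i j X (img (max i j) I X f) I
     (Tup (surj_family I (Total (max i j) X (img (max i j) I X f))) (corestr (max i j) I X f)
       (App (App (App (surj_proof i j) X) I) f))"

lemma ren_img_cover [simp]:
  "ren r (img_cover i j X I f) = img_cover i j (ren r X) (ren r I) (ren r f)"
  by (simp add: img_cover_def)

lemma sub_img_cover [simp]:
  "sub s (img_cover i j X I f) = img_cover i j (sub s X) (sub s I) (sub s f)"
  by (simp add: img_cover_def)

lemma ty_img_cover:
  assumes X: "\<Gamma> \<turnstile> X : Univ i" and I: "\<Gamma> \<turnstile> I : Univ j" and f: "\<Gamma> \<turnstile> f : Arr I X"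
  shows "\<Gamma> \<turnstile> img_cover i j X I f : CoveredSubsets i j X"
  unfolding img_cover_def
proof (rule ty_cover[OF ty_img[OF X I f] I])
  let ?T = "Total (max i j) X (img (max i j) I X f)"
  show "\<Gamma> \<turnstile> Tup (surj_family I ?T) (corestr (max i j) I X f)
      (App (App (App (surj_proof i j) X) I) f) : Surj I ?T"
    unfolding Surj_eq
    by (rule ty_pair[OF is_prop_type[OF inh_is_prop_is_surj_Var] ty_corestr[OF X I f]])
      (simp_all only: inst_is_surj ty_surj_proof[OF X I f] is_typeI[OF I] is_type_Total[OF ty_img[OF X I f]])
qed

definition of_family1 :: "nat \<Rightarrow> nat \<Rightarrow> tm \<Rightarrow> tm \<Rightarrow> tm" where
  "of_family1 i j X I = Lam (Arr I X) (img_cover i j (wk X) (wk I) (Var 0))"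

definition of_family :: "nat \<Rightarrow> nat \<Rightarrow> tm \<Rightarrow> tm" where
  "of_family i j X = uncurry (Univ j) (Arr (Var 0) (wk X)) (CoveredSubsets i j X)
     (of_family1 i j (wk X) (Var 0))"

lemma ren_of_family [simp]:
  "ren r (of_family1 i j X I) = of_family1 i j (ren r X) (ren r I)"
  "ren r (of_family i j X) = of_family i j (ren r X)"
  by (simp_all add: of_family1_def of_family_def)

lemma sub_of_family [simp]:
  "sub s (of_family1 i j X I) = of_family1 i j (sub s X) (sub s I)"
  "sub s (of_family i j X) = of_family i j (sub s X)"
  by (simp_all add: of_family1_def of_family_def)

lemma ty_of_family1:
  assumes X: "\<Gamma> \<turnstile> X : Univ i" and I: "\<Gamma> \<turnstile> I : Univ j"
  shows "\<Gamma> \<turnstile> of_family1 i j X I : Arr (Arr I X) (CoveredSubsets i j X)"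
  unfolding of_family1_def
proof (rule ty_Lam_Arr)
  have A: "is_type \<Gamma> (Arr I X)" by (intro is_type_Arr is_typeI[OF X] is_typeI[OF I])
  show "Arr I X # \<Gamma> \<turnstile> img_cover i j (wk X) (wk I) (Var 0) : wk (CoveredSubsets i j X)"
    using ty_img_cover[of "Arr I X # \<Gamma>" "wk X" i "wk I" j "Var 0"] ty_wk[OF X A] ty_wk[OF I A] ty_0[OF A]
    by simp
qed

lemma ty_of_family:
  assumes X: "\<Gamma> \<turnstile> X : Univ i"
  shows "\<Gamma> \<turnstile> of_family i j X : Arr (Families j X) (CoveredSubsets i j X)"
  unfolding of_family_def Families_def
proof (rule ty_uncurry)
  note tX = is_typeI[OF X]
  show "is_type (Univ j # \<Gamma>) (Arr (Var 0) (wk X))" by (rule is_type_Arr_Var[OF tX])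
  show "is_type \<Gamma> (CoveredSubsets i j X)" by (rule is_type_CoveredSubsets[OF tX])
  have U: "is_type \<Gamma> (Univ j)" by (rule is_type_Univ[OF is_type_wf[OF tX]])
  show "Univ j # \<Gamma> \<turnstile> of_family1 i j (wk X) (Var 0) :
      Arr (Arr (Var 0) (wk X)) (wk (CoveredSubsets i j X))"
    using ty_of_family1[of "Univ j # \<Gamma>" "wk X" i "Var 0" j] ty_wk[OF X U] ty_0[OF U] by simp
qed

lemma App_of_family: "App (of_family i j X) (family j X I f) \<cong> img_cover i j X I f"
proof -
  have 1: "inst (of_family1 i j (wk X) (Var 0)) I = of_family1 i j X I"
    by (simp add: inst_def)
  have "App (of_family i j X) (family j X I f) \<cong> App (of_family1 i j X I) f"
    unfolding of_family_def family_def
      by (rule App_uncurry[where g = "of_family1 i j (wk X) (Var 0)" and a = I, unfolded 1])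
  also have "\<dots> \<cong> img_cover i j X I f"
    unfolding of_family1_def by (rule conv_trans[OF beta_Pi]) (simp add: inst_def conv_refl)
  finally show ?thesis .
qed

section \<open>The two round trips\<close>

lemma Proj1_corestr: "Proj1 A F (App (corestr k I X f) a) \<cong> App f a"
  by (rule conv_trans[OF Proj1_cong[OF App_corestr]]) (simp only: img_point_def Proj1_Tup)

lemma inh_Families_roundtrip_pair:
  assumes X: "\<Gamma> \<turnstile> X : Univ i" and I: "\<Gamma> \<turnstile> I : Univ j" and f: "\<Gamma> \<turnstile> f : Arr I X"
  shows "inh \<Gamma> (Eq (Families j X) (App (to_family i j X) (App (of_family i j X) (family j X I f)))
    (family j X I f))"
proof -
  let ?k = "max i j" let ?S = "img ?k I X f" let ?T = "Total ?k X ?S" let ?c = "corestr ?k I X f"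
  let ?f = "Lam I (App (wk f) (Var 0))"
  note tX = is_typeI[OF X]
  have "App (to_family i j X) (App (of_family i j X) (family j X I f)) \<cong>
      App (to_family i j X) (img_cover i j X I f)"
    by (intro cong_App conv_refl App_of_family)
  also have "\<dots> \<cong> family j X I (underlying ?k X ?S I (surj_map I ?T
      (Tup (surj_family I ?T) ?c (App (App (App (surj_proof i j) X) I) f))))"
    unfolding img_cover_def by (rule App_to_family)
  also have "\<dots> \<cong> family j X I (underlying ?k X ?S I ?c)"
    unfolding family_def underlying_def surj_map_def
    by (intro cong_Tup cong_Lam Proj1_cong cong_App conv_ren Proj1_Tup conv_refl)
  also have "\<dots> \<cong> family j X I ?f"
  proof -
    have "Proj1 (wk X) (wk (total_family ?k X ?S)) (App (wk ?c) (Var 0)) \<cong> App (wk f) (Var 0)"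
      using Proj1_corestr[of "wk X" "wk (total_family ?k X ?S)" ?k "wk I" "wk X" "wk f" "Var 0"] by simp
    then show ?thesis unfolding family_def underlying_def by (intro cong_Tup cong_Lam conv_refl)
  qed
  finally have c: "App (to_family i j X) (App (of_family i j X) (family j X I f)) \<cong> family j X I ?f" .
  have eta: "\<Gamma> \<turnstile> ?f : Arr I X" by (intro ty_Lam_Arr ty_App_wk_0_Arr f)
  have fb: "I # \<Gamma> \<turnstile> App (wk f) (Var 0) : wk X" by (rule ty_App_wk_0_Arr[OF f])
  \<comment> \<open>The computed family is the eta-expansion of \<open>f\<close>. In the absence of
    a definitional eta rule the two are joined by function extensionality, after a beta step at a
    fresh variable.\<close>
  have "App (wk ?f) (Var 0) \<cong> App (wk f) (Var 0)"
    using beta_Pi[of "wk I" "App (wk (wk f)) (Var 0)" "Var 0"] by (simp add: inst_def)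
  from inh_conv[OF inh_refl[OF fb] cong_Eq[OF conv_refl conv_sym[OF this] conv_refl]
      is_type_Eq[OF ty_App_wk_0_Arr[OF eta] fb regularity[OF fb]]]
  have "inh (I # \<Gamma>) (Eq (wk X) (App (wk ?f) (Var 0)) (App (wk f) (Var 0)))" .
  from inh_FunExt_Arr[OF eta f this]
  have "inh \<Gamma> (Eq (inst (Arr (Var 0) (wk X)) I) ?f f)" by (simp add: inst_def)
  from inh_pair_cong[OF is_type_Arr_Var[OF tX] I this]
  have "inh \<Gamma> (Eq (Families j X) (family j X I ?f) (family j X I f))"
    unfolding Families_def family_def .
  then show ?thesis
    by (rule inh_conv[OF _ cong_Eq[OF conv_refl conv_sym[OF c] conv_refl]])
      (intro is_type_Eq is_type_Families tX ty_family_pair I f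
        ty_App_Arr[OF ty_to_family[OF tX] ty_App_Arr[OF ty_of_family[OF X]]])
qed

lemma inh_CoveredSubsets_roundtrip_pair:
  assumes X: "\<Gamma> \<turnstile> X : Univ i" and S: "\<Gamma> \<turnstile> S : Arr X (Omega (max i j))" and I: "\<Gamma> \<turnstile> I : Univ j"
    and t: "\<Gamma> \<turnstile> t : Surj I (Total (max i j) X S)"
  shows "inh \<Gamma> (Eq (CoveredSubsets i j X)
    (App (of_family i j X) (App (to_family i j X) (cover i j X S I t))) (cover i j X S I t))"
proof -
  let ?f = "underlying (max i j) X S I (surj_map I (Total (max i j) X S) t)"
  note tX = is_typeI[OF X]
  have c: "App (of_family i j X) (App (to_family i j X) (cover i j X S I t)) \<cong> img_cover i j X I ?f"
    by (rule conv_trans[OF cong_App[OF conv_refl App_to_family] App_of_family])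
  have "inh \<Gamma> (Eq (CoveredSubsets i j X) (img_cover i j X I ?f) (cover i j X S I t))"
    unfolding img_cover_def
    \<comment> \<open>\<open>inh_cover_eq\<close> accepts any proof that the corestriction is
      surjective; here it is the chosen closed term applied to the data.\<close>
    by (rule inh_cover_eq[OF X I S t ty_surj_proof[OF X I ty_underlying[OF ty_surj_map[OF t]]]])
  then show ?thesis
    by (rule inh_conv[OF _ cong_Eq[OF conv_refl conv_sym[OF c] conv_refl]])
      (intro is_type_Eq is_type_CoveredSubsets tX ty_cover S I t
        ty_App_Arr[OF ty_of_family[OF X] ty_App_Arr[OF ty_to_family[OF tX]]])
qed


lemma inh_Families_roundtrip:
  assumes X: "\<Gamma> \<turnstile> X : Univ i"
  shows "inh (Families j X # \<Gamma>) (Eq (wk (Families j X))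
    (App (wk (to_family i j X)) (App (wk (of_family i j X)) (Var 0))) (Var 0))"
proof -
  let ?M = "Arr (Var 0) (wk X)"
  let ?C = "Eq (Families j (wk X)) (App (to_family i j (wk X)) (App (of_family i j (wk X)) (Var 0))) (Var 0)"
  note tX = is_typeI[OF X]
  have F: "is_type \<Gamma> (Families j X)" by (rule is_type_Families[OF tX])
  have U: "is_type \<Gamma> (Univ j)" by (rule is_type_Univ[OF is_type_wf[OF tX]])
  have M: "is_type (Univ j # \<Gamma>) ?M" by (rule is_type_Arr_Var[OF tX])
  have X1: "Families j X # \<Gamma> \<turnstile> wk X : Univ i" using ty_wk[OF X F] by simp
  have v: "Families j X # \<Gamma> \<turnstile> Var 0 : Families j (wk X)" using ty_0[OF F] by simp
  have C: "is_type (SIG (Univ j) ?M # \<Gamma>) ?C"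
    unfolding Families_def[symmetric]
    by (intro is_type_Eq v is_type_Families[OF is_typeI[OF X1]]
        ty_App_Arr[OF ty_to_family[OF is_typeI[OF X1]] ty_App_Arr[OF ty_of_family[OF X1] v]])
  have "inh (?M # Univ j # \<Gamma>) (unpair (Univ j) ?M ?C)"
    using inh_Families_roundtrip_pair[of "?M # Univ j # \<Gamma>" "wk (wk X)" i "Var (Suc 0)" j "Var 0"]
      ty_wk[OF ty_wk[OF X U] M] ty_1[OF M] ty_0[OF M]
    by (simp add: unpair_def family_def)
  from inh_SIG_elim[OF C this] show ?thesis
    by (simp flip: Families_def)
qed

lemma inh_CoveredSubsets_roundtrip:
  assumes X: "\<Gamma> \<turnstile> X : Univ i"
  shows "inh (CoveredSubsets i j X # \<Gamma>) (Eq (wk (CoveredSubsets i j X))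
    (App (wk (of_family i j X)) (App (wk (to_family i j X)) (Var 0))) (Var 0))"
proof -
  let ?k = "max i j" let ?A = "Arr X (Omega ?k)"
  let ?R = "cover_rest ?k j (wk X) (Var 0)"
  let ?M = "Surj (Var 0) (Total ?k (wk (wk X)) (Var (Suc 0)))"
  let ?rt = "\<lambda>X p. Eq (CoveredSubsets i j X) (App (of_family i j X) (App (to_family i j X) p)) p"
  have rt: "is_type \<Delta> (?rt X p)" if "\<Delta> \<turnstile> X : Univ i" "\<Delta> \<turnstile> p : CoveredSubsets i j X" for \<Delta> X p
    using is_type_Eq[OF ty_App_Arr[OF ty_of_family[OF that(1)]
        ty_App_Arr[OF ty_to_family[OF is_typeI[OF that(1)]] that(2)]] that(2)
        is_type_CoveredSubsets[OF is_typeI[OF that(1)]]] .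
  note tX = is_typeI[OF X]
  have A: "is_type \<Gamma> ?A" by (intro is_type_Arr tX is_type_Omega is_type_wf[OF tX])
  have R: "is_type (?A # \<Gamma>) ?R" by (rule is_type_cover_rest_Var[OF tX])
  have S1: "?A # \<Gamma> \<turnstile> Var 0 : Arr (wk X) (Omega ?k)" using ty_0[OF A] by simp
  have U: "is_type (?A # \<Gamma>) (Univ j)" by (rule is_type_Univ[OF is_type_wf[OF R]])
  have M: "is_type (Univ j # ?A # \<Gamma>) ?M" using is_type_Surj_Var[OF S1] by simp
  let ?\<Delta> = "?M # Univ j # ?A # \<Gamma>"
  let ?X3 = "wk (wk (wk X))"
  \<comment> \<open>The cover after the outer split only: \<open>Var (Suc 0)\<close> is the subset
    and \<open>Var 0\<close> the unsplit pair of index type and surjection. It forms the motive of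
    the inner split.\<close>
  let ?p2 = "Tup (cover_family i j (wk (wk X))) (Var (Suc 0)) (Var 0)"
  have X3: "?\<Delta> \<turnstile> ?X3 : Univ i"
    using ty_wk[OF ty_wk[OF ty_wk[OF X A] U] M] by simp
  have "inh ?\<Delta> (?rt ?X3 (cover i j ?X3 (Var (Suc (Suc 0))) (Var (Suc 0)) (Var 0)))"
    using inh_CoveredSubsets_roundtrip_pair[OF X3, of "Var (Suc (Suc 0))" j "Var (Suc 0)" "Var 0"]
      ty_wk[OF ty_wk[OF S1 U] M] ty_1[OF M] ty_0[OF M] by simp
  then have 1: "inh ?\<Delta> (unpair (Univ j) ?M (?rt (wk (wk X)) ?p2))"
    by (simp add: unpair_def cover_def)
  have C2: "is_type (?R # ?A # \<Gamma>) (?rt (wk (wk X)) ?p2)"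
    using ty_wk[OF ty_wk[OF X A] R] ty_pair_vars[OF R]
    by (intro rt) (simp_all add: CoveredSubsets_eq)
  have R_eq: "?R = SIG (Univ j) ?M" by (simp add: cover_rest_def)
  have "inh (?R # ?A # \<Gamma>) (?rt (wk (wk X)) ?p2)"
    using inh_SIG_elim[OF C2[unfolded R_eq] 1] unfolding R_eq .
  then have 2: "inh (?R # ?A # \<Gamma>) (unpair ?A ?R (?rt (wk X) (Var 0)))"
    by (simp add: unpair_def)
  have T: "is_type \<Gamma> (CoveredSubsets i j X)" by (rule is_type_CoveredSubsets[OF tX])
  have C1: "is_type (CoveredSubsets i j X # \<Gamma>) (?rt (wk X) (Var 0))"
    using ty_wk[OF X T] ty_0[OF T] by (intro rt) simp_all
  from inh_SIG_elim[OF C1[unfolded CoveredSubsets_eq[of i j X]] 2]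
  show ?thesis by (simp flip: CoveredSubsets_eq)
qed

section \<open>Assembling the equivalence\<close>

lemma is_type_homotopies:
  assumes f: "\<Gamma> \<turnstile> f : Arr A B" and A: "is_type \<Gamma> A" and B: "is_type \<Gamma> B"
  shows "is_type (Arr B A # \<Gamma>) (Pi (wk B) (Eq (wk (wk B)) (App (wk (wk f)) (App (Var (Suc 0)) (Var 0))) (Var 0)))"
    and "is_type (Arr B A # \<Gamma>) (Pi (wk A) (Eq (wk (wk A)) (App (Var (Suc 0)) (App (wk (wk f)) (Var 0))) (Var 0)))"
proof -
  let ?G = "Arr B A"
  have G: "is_type \<Gamma> ?G" by (rule is_type_Arr[OF B A])
  have B1: "is_type (?G # \<Gamma>) (wk B)" and A1: "is_type (?G # \<Gamma>) (wk A)"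
    by (intro is_type_wk A B G)+
  have g: "wk C # ?G # \<Gamma> \<turnstile> Var (Suc 0) : Arr (wk (wk B)) (wk (wk A))"
    and f': "wk C # ?G # \<Gamma> \<turnstile> wk (wk f) : Arr (wk (wk A)) (wk (wk B))"
    if "is_type (?G # \<Gamma>) (wk C)" for C
    using ty_1[OF that] ty_wk[OF ty_wk[OF f G] that] by simp_all
  show "is_type (Arr B A # \<Gamma>) (Pi (wk B) (Eq (wk (wk B)) (App (wk (wk f)) (App (Var (Suc 0)) (Var 0))) (Var 0)))"
    by (intro is_type_Pi is_type_Eq B1 ty_App_Arr[OF f' ty_App_Arr[OF g]] ty_0 is_type_wk[OF B1])
  show "is_type (Arr B A # \<Gamma>) (Pi (wk A) (Eq (wk (wk A)) (App (Var (Suc 0)) (App (wk (wk f)) (Var 0))) (Var 0)))"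
    by (intro is_type_Pi is_type_Eq A1 ty_App_Arr[OF g ty_App_Arr[OF f']] ty_0 is_type_wk[OF A1])
qed

text \<open>The single map \<open>g\<close> serves both as the section and as the
  retraction.\<close>

lemma inh_Equiv:
  assumes f: "\<Gamma> \<turnstile> f : Arr A B" and g: "\<Gamma> \<turnstile> g : Arr B A"
    and A: "is_type \<Gamma> A" and B: "is_type \<Gamma> B"
    and fg: "inh (B # \<Gamma>) (Eq (wk B) (App (wk f) (App (wk g) (Var 0))) (Var 0))"
    and gf: "inh (A # \<Gamma>) (Eq (wk A) (App (wk g) (App (wk f) (Var 0))) (Var 0))"
  shows "inh \<Gamma> (Equiv A B)"
proof -
  \<comment> \<open>These types are functions of \<open>A\<close>, \<open>B\<close> and
    \<open>f\<close> because they occur twice: over a variable map, as the body of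
    \<open>Equiv\<close>, and at the given \<open>f\<close>.\<close>
  let ?sec = "\<lambda>A B f. SIG (Arr B A) (Pi (wk B) (Eq (wk (wk B)) (App (wk (wk f)) (App (Var (Suc 0)) (Var 0))) (Var 0)))"
  let ?ret = "\<lambda>A B f. SIG (Arr B A) (Pi (wk A) (Eq (wk (wk A)) (App (Var (Suc 0)) (App (wk (wk f)) (Var 0))) (Var 0)))"
  let ?H = "\<lambda>A B f. SIG (?sec A B f) (wk (?ret A B f))"
  have types: "is_type \<Delta> (?sec A B f)" "is_type \<Delta> (?ret A B f)" "is_type \<Delta> (?H A B f)"
    if "\<Delta> \<turnstile> f : Arr A B" "is_type \<Delta> A" "is_type \<Delta> B" for \<Delta> A B f
  proof -
    show 1: "is_type \<Delta> (?sec A B f)" by (rule is_type_SIG[OF is_type_homotopies(1)[OF that]])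
    show 2: "is_type \<Delta> (?ret A B f)" by (rule is_type_SIG[OF is_type_homotopies(2)[OF that]])
    show "is_type \<Delta> (?H A B f)" by (rule is_type_SIG[OF is_type_wk[OF 2 1]])
  qed
  have E: "Equiv A B = SIG (Arr A B) (?H (wk A) (wk B) (Var 0))"
    by (simp add: Equiv_def Prod_def numeral_2_eq_2)
  have F: "is_type \<Gamma> (Arr A B)" by (rule is_type_Arr[OF A B])
  have "inh \<Gamma> (?sec A B f)"
    by (rule inh_SIG[OF is_type_homotopies(1)[OF f A B] g]) (use inh_Pi[OF fg] in \<open>simp add: inst_def\<close>)
  then obtain s where s: "\<Gamma> \<turnstile> s : ?sec A B f" by (auto simp: inh_def)
  have r: "inh \<Gamma> (?ret A B f)"
    by (rule inh_SIG[OF is_type_homotopies(2)[OF f A B] g]) (use inh_Pi[OF gf] in \<open>simp add: inst_def\<close>)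
  have "inh \<Gamma> (?H A B f)"
    by (rule inh_SIG[OF is_type_wk[OF types(2,1)[OF f A B]] s]) (use r in \<open>simp only: inst_wk\<close>)
  then have "inh \<Gamma> (inst (?H (wk A) (wk B) (Var 0)) f)" by (simp add: inst_def)
  moreover have "is_type (Arr A B # \<Gamma>) (?H (wk A) (wk B) (Var 0))"
    by (rule types(3)) (use ty_0[OF F] in \<open>simp_all add: is_type_wk A B F\<close>)
  ultimately show ?thesis unfolding E by (intro inh_SIG[OF _ f])
qed

theorem theorem6p7:
  fixes i j :: nat
  shows "\<exists>t. [Univ i] \<turnstile> t : Equiv (CoveredSubsets i j (Var 0)) (Families j (Var 0))"
proof -
  have "is_type [] (Univ i)" by (intro is_type_Univ wf_Nil)
  from ty_0[OF this] have X: "[Univ i] \<turnstile> Var 0 : Univ i" by simp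
  note tX = is_typeI[OF X]
  have "inh [Univ i] (Equiv (CoveredSubsets i j (Var 0)) (Families j (Var 0)))"
    by (rule inh_Equiv[OF ty_to_family[OF tX] ty_of_family[OF X] is_type_CoveredSubsets[OF tX]
          is_type_Families[OF tX] inh_Families_roundtrip[OF X] inh_CoveredSubsets_roundtrip[OF X]])
  then show ?thesis by (simp only: inh_def)
qed

end
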